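(* Suppose $\overline u_l<\underline u_r$, or $\overline u_l=\underline u_r$ with $\mathcal{K}_0\ne\varnothing$. Let $u$ be the entropy solution of $u_t+f(u)_x=0$, $u|_{t=0}=\varphi$, with $\varphi\in L^\infty(\mathbb{R})$ satisfying $\varphi-\underline u_r\in L^p([0,\infty))$ and $\varphi-\overline u_l\in L^p((-\infty,0])$ for $p\in[1,\infty)$, and let $w$ be the generalized $N$-wave. Then: (i) For any two divides $e(t)$ and $h(t)$ with $e(t)<h(t)$ and for any $q>0$, as $t\to\infty$, $$\|f'(u(\cdot,t))-f'(w(\cdot,t))\|_{L^q([e(t),h(t)])}\le o(1)\,t^{-1}.$$ (ii) If $\inf\mathcal{K}_0>-\infty$ and/or $\sup\mathcal{K}_0<\infty$, then for any two forward generalized characteristics $x_1(t)\in\mathcal{H}_{-\infty}$ and/or $x_2(t)\in\mathcal{H}_\infty$ with $x_1(t)<x_2(t)$, and for any $q>\frac{p}{p+1+\alpha}$, as $t\to\infty$, $$\|f'(u(\cdot,t))-f'(w(\cdot,t))\|_{L^q([x_1(t),x_2(t)])}\le o(1)\,t^{-1+\frac{p/q}{p+1+\alpha}},$$ where $\alpha=\alpha_l$ if $x_1(t)\in\mathcal{H}_{-\infty}$, $x_2(t)\in\mathcal{H}_{(e_n,h_n)}$; $\alpha=\alpha_r$ if $x_1(t)\in\mathcal{H}_{(e_n,h_n)}$, $x_2(t)\in\mathcal{H}_\infty$; $\alpha=\min\{\alpha_l,\alpha_r\}$ if $x_1(t)\in\mathcal{H}_{-\infty}$, $x_2(t)\in\mathcal{H}_\infty$.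 In particular, if $x_0^+=\sup\mathcal{K}_0<\infty$ with $\mathrm D_+\bar\Phi(x_0^+)<\underline{\mathrm D}_+\Phi(x_0^+)$ and/or $x_0^-=\inf\mathcal{K}_0>-\infty$ with $\overline{\mathrm D}_-\Phi(x_0^-)<\mathrm D_-\bar\Phi(x_0^-)$, then for any $q>0$, as $t\to\infty$, $$\|f'(u(\cdot,t))-f'(w(\cdot,t))\|_{L^q([x_1(t),x_2(t)])}\le o(1)\,t^{-1}.$$
   Context: Setting: $f\in C^2(\mathbb{R})$, $f''\ge0$, $\mathcal{L}\{f''=0\}=0$ ($\mathcal L$ Lebesgue measure), so $f'$ is strictly increasing. For $t>0$: $E(u;x,t)=t\int_0^u f''(s)(\varphi(x-tf'(s))-s)\,ds$; $\mathcal{U}(x,t)$ is the (nonempty compact) set of maximizers of $E(\cdot\,;x,t)$; the entropy solution is $u(x,t)=\inf\mathcal{U}(x,t)$, with $u(x-,t)=\sup\mathcal{U}(x,t)$, $u(x+,t)=\inf\mathcal{U}(x,t)$. $\alpha_r,\alpha_l\ge0$ are the exponents with $f''(u)=(N_\pm+o(1))|u-c|^{\alpha}$ as $u\to c\pm$ (for some $N_\pm>0$), with $\alpha=\alpha_r$ at $c=\underline u_r$ and $\alpha=\alpha_l$ at $c=\overline u_l$. $\Phi(x)=\int_0^x\varphi\,d\xi$; $\overline u_l=\limsup_{x\to-\infty}\Phi(x)/x$, $\underline u_r=\liminf_{x\to\infty}\Phi(x)/x$; $\overline{\mathrm D}_-\Phi(x)=\limsup_{l\to0-}\frac{\Phi(x+l)-\Phi(x)}l$,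 $\underline{\mathrm D}_+\Phi(x)=\liminf_{l\to0+}\frac{\Phi(x+l)-\Phi(x)}l$. $\bar\Phi(x)=\lim_{N\to\infty}\bar\Phi_N(x)\in[-\infty,\infty)$, where $\bar\Phi_N$ is the convex hull (largest convex minorant) of $\Phi|_{[-N,N]}$ on $[-N,N]$ and equals $\Phi$ for $|x|\ge N$; $\mathrm D_\pm\bar\Phi$ are the right/left derivatives of the convex function $\bar\Phi$. $\mathcal{K}_0=\{x_0:\Phi(x_0)=\bar\Phi(x_0)\}$. $L_c(x_0)=\{(x,t):x=x_0+tf'(c),\ t>0\}$ is a divide emitting from $x_0$ if $\mathcal{U}(x,t)=\{c\}$ on all of it; $\mathcal{K}$ is the union of all divides. $\mathbb{R}\setminus\mathcal{K}_0=\bigcup_n(e_n,h_n)$ (components); for bounded $(e_n,h_n)$: $c_n=\frac{\Phi(h_n)-\Phi(e_n)}{h_n-e_n}$, $e_n(t)=e_n+tf'(c_n)$, $h_n(t)=h_n+tf'(c_n)$, $\mathcal{H}_{(e_n,h_n)}=\{t>0,\ e_n(t)<x<h_n(t)\}$. If $x_0^+=\sup\mathcal{K}_0<\infty$: $x_0^+(t)=x_0^++tf'(\underline u_r)$, $\mathcal{H}_\infty=\{t>0,\ x>x_0^+(t)\}$. If $x_0^-=\inf\mathcal{K}_0>-\infty$: $x_0^-(t)=x_0^-+tf'(\overline u_l)$, $\mathcal{H}_{-\infty}=\{t>0,\ x<x_0^-(t)\}$. Forward generalized characteristics: for $t>0$, $\Delta_I(x,t)=\{(\xi,\tau):\xi=x+(\tau-t)f'(v),\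 0<\tau<t,\ v\in[u(x+,t),u(x-,t)]\}$; the forward generalized characteristic of $(x_0,t_0)$, $t_0>0$, is the unique curve $x(t)$, $t\ge t_0$, $x(t_0)=x_0$, with $\Delta_I(x_0,t_0)\subset\Delta_I(x(t_1),t_1)\subset\Delta_I(x(t_2),t_2)$ for $t_2>t_1>t_0$; one on $[0,\infty)$ is a continuous curve whose restriction to each $[t_0,\infty)$, $t_0>0$, is the forward generalized characteristic of $(x(t_0),t_0)$. (Any two forward generalized characteristics in the same $\mathcal{H}$-region coincide for large $t$.) Generalized $N$-wave $w$: (1) on $\mathcal{K}$, $w(x,t)=(f')^{-1}(\frac{x-x_0}{t})$ if $(x,t)$ lies on a divide emitting from $x_0$; (2) in $\mathcal{H}_{(e_n,h_n)}$ (bounded $(e_n,h_n)$), for any chosen forward generalized characteristic $x_n(t)$, $t\ge0$, in $\mathcal{H}_{(e_n,h_n)}$: $w=(f')^{-1}(\frac{x-e_n}{t})$ if $e_n(t)<x<x_n(t)$ and $w=(f')^{-1}(\frac{x-h_n}{t})$ if $x_n(t)<x<h_n(t)$; (3) for any chosen forward generalized characteristic $x_+(t)$, $t\ge0$, in $\mathcal{H}_\infty$: $w=(f')^{-1}(\frac{x-x_0^+}{t})$ if $x_0^+(t)<x<x_+(t)$; (4) for any chosen $x_-(t)$, $t\ge0$, in $\mathcal{H}_{-\infty}$: $w=(f')^{-1}(\frac{x-x_0^-}{t})$ if $x_-(t)<x<x_0^-(t)$. $\|g\|_{L^q(A)}=(\int_A|g|^q)^{1/q}$ for $q>0$. *)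

theory Defs
  imports "HOL-Analysis.Analysis" "HOL-Library.Landau_Symbols"
begin

text \<open>
  Throughout, the arguments \<open>f'\<close> and \<open>f''\<close> stand for the first and second derivative of the flux
  \<open>f\<close>, and \<open>\<phi>\<close> is a Lebesgue measurable, essentially bounded representative of the initial datum.
  Integrals are taken with respect to \<open>lebesgue\<close> (not \<open>lborel\<close>) because \<open>\<phi>\<close> need not be Borel.
\<close>

definition energy ::
  "(real \<Rightarrow> real) \<Rightarrow> (real \<Rightarrow> real) \<Rightarrow> (real \<Rightarrow> real) \<Rightarrow> real \<Rightarrow> real \<Rightarrow> real \<Rightarrow> real" where
  "energy f' f'' \<phi> u x t =
     t * interval_lebesgue_integral lebesgue (ereal 0) (ereal u)
           (\<lambda>s. f'' s * (\<phi> (x - t * f' s) - s))"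

definition maximizers ::
  "(real \<Rightarrow> real) \<Rightarrow> (real \<Rightarrow> real) \<Rightarrow> (real \<Rightarrow> real) \<Rightarrow> real \<Rightarrow> real \<Rightarrow> real set" where
  "maximizers f' f'' \<phi> x t = {u. \<forall>v. energy f' f'' \<phi> v x t \<le> energy f' f'' \<phi> u x t}"

text \<open>
  The entropy solution is given by its variational formula.
  The one-sided traces are \<open>u(x-,t) = Sup\<close> and \<open>u(x+,t) = Inf\<close> of the set of maximizers; the
  entropy solution is normalised to be \<open>u(x+,t)\<close>.
\<close>

definition entropy_sol ::
  "(real \<Rightarrow> real) \<Rightarrow> (real \<Rightarrow> real) \<Rightarrow> (real \<Rightarrow> real) \<Rightarrow> real \<Rightarrow> real \<Rightarrow> real" where
  "entropy_sol f' f'' \<phi> x t = Inf (maximizers f' f'' \<phi> x t)"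

definition entropy_sol_left ::
  "(real \<Rightarrow> real) \<Rightarrow> (real \<Rightarrow> real) \<Rightarrow> (real \<Rightarrow> real) \<Rightarrow> real \<Rightarrow> real \<Rightarrow> real" where
  "entropy_sol_left f' f'' \<phi> x t = Sup (maximizers f' f'' \<phi> x t)"

subsection \<open>The primitive of the datum and its convex hull\<close>

definition primitive :: "(real \<Rightarrow> real) \<Rightarrow> real \<Rightarrow> real" where
  "primitive \<phi> x = interval_lebesgue_integral lebesgue (ereal 0) (ereal x) \<phi>"

text \<open>
  \<open>u_left\<close> is the limes superior at \<open>-\<infinity>\<close> and \<open>u_right\<close> the limes inferior at \<open>\<infinity>\<close>. They are formed
  in \<open>ereal\<close> and are finite for essentially bounded \<open>\<phi>\<close>.
\<close>

definition u_left :: "(real \<Rightarrow> real) \<Rightarrow> real" where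
  "u_left \<phi> = real_of_ereal (Limsup at_bot (\<lambda>x. ereal (primitive \<phi> x / x)))"

definition u_right :: "(real \<Rightarrow> real) \<Rightarrow> real" where
  "u_right \<phi> = real_of_ereal (Liminf at_top (\<lambda>x. ereal (primitive \<phi> x / x)))"

definition upper_left_Dini :: "(real \<Rightarrow> real) \<Rightarrow> real \<Rightarrow> ereal" where
  "upper_left_Dini F x = Limsup (at_left 0) (\<lambda>l. ereal ((F (x + l) - F x) / l))"

definition lower_right_Dini :: "(real \<Rightarrow> real) \<Rightarrow> real \<Rightarrow> ereal" where
  "lower_right_Dini F x = Liminf (at_right 0) (\<lambda>l. ereal ((F (x + l) - F x) / l))"

definition hull_on :: "(real \<Rightarrow> real) \<Rightarrow> real \<Rightarrow> real \<Rightarrow> real" where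
  "hull_on F N x =
     (if \<bar>x\<bar> < N
      then Sup {g x | g. convex_on {-N..N} g \<and> (\<forall>y\<in>{-N..N}. g y \<le> F y)}
      else F x)"

text \<open>The limit lies in \<open>[-\<infinity>, \<infinity>)\<close>, hence the type \<open>ereal\<close>; it exists since \<open>hull_on F N x\<close> is
  nonincreasing in \<open>N\<close>.\<close>

definition convex_env :: "(real \<Rightarrow> real) \<Rightarrow> real \<Rightarrow> ereal" where
  "convex_env F x = Lim at_top (\<lambda>N::real. ereal (hull_on F N x))"

definition right_deriv :: "(real \<Rightarrow> ereal) \<Rightarrow> real \<Rightarrow> ereal" where
  "right_deriv G x = Lim (at_right 0) (\<lambda>l. (G (x + l) - G x) / ereal l)"

definition left_deriv :: "(real \<Rightarrow> ereal) \<Rightarrow> real \<Rightarrow> ereal" where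
  "left_deriv G x = Lim (at_left 0) (\<lambda>l. (G (x + l) - G x) / ereal l)"

definition contact_set :: "(real \<Rightarrow> real) \<Rightarrow> real set" where
  "contact_set \<phi> = {x. ereal (primitive \<phi> x) = convex_env (primitive \<phi>) x}"

subsection \<open>Divides and the regions between them\<close>

definition ray :: "(real \<Rightarrow> real) \<Rightarrow> real \<Rightarrow> real \<Rightarrow> (real \<times> real) set" where
  "ray f' c x0 = {(x, t). x = x0 + t * f' c \<and> t > 0}"

definition is_divide ::
  "(real \<Rightarrow> real) \<Rightarrow> (real \<Rightarrow> real) \<Rightarrow> (real \<Rightarrow> real) \<Rightarrow> real \<Rightarrow> real \<Rightarrow> bool" where
  "is_divide f' f'' \<phi> c x0 \<longleftrightarrow> (\<forall>(x, t) \<in> ray f' c x0. maximizers f' f'' \<phi> x t = {c})"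

definition bounded_gap :: "(real \<Rightarrow> real) \<Rightarrow> real \<Rightarrow> real \<Rightarrow> bool" where
  "bounded_gap \<phi> e h \<longleftrightarrow> e < h \<and> {e<..<h} \<in> components (- contact_set \<phi>)"

definition gap_slope :: "(real \<Rightarrow> real) \<Rightarrow> real \<Rightarrow> real \<Rightarrow> real" where
  "gap_slope \<phi> e h = (primitive \<phi> h - primitive \<phi> e) / (h - e)"

definition gap_region ::
  "(real \<Rightarrow> real) \<Rightarrow> (real \<Rightarrow> real) \<Rightarrow> real \<Rightarrow> real \<Rightarrow> (real \<times> real) set" where
  "gap_region f' \<phi> e h =
     {(x, t). t > 0 \<and> e + t * f' (gap_slope \<phi> e h) < x \<and> x < h + t * f' (gap_slope \<phi> e h)}"

text \<open>The next two regions are meaningful only if the contact set is bounded above, respectively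
  below.\<close>

definition right_region :: "(real \<Rightarrow> real) \<Rightarrow> (real \<Rightarrow> real) \<Rightarrow> (real \<times> real) set" where
  "right_region f' \<phi> = {(x, t). t > 0 \<and> x > Sup (contact_set \<phi>) + t * f' (u_right \<phi>)}"

definition left_region :: "(real \<Rightarrow> real) \<Rightarrow> (real \<Rightarrow> real) \<Rightarrow> (real \<times> real) set" where
  "left_region f' \<phi> = {(x, t). t > 0 \<and> x < Inf (contact_set \<phi>) + t * f' (u_left \<phi>)}"

subsection \<open>Forward generalized characteristics\<close>

definition backward_cone ::
  "(real \<Rightarrow> real) \<Rightarrow> (real \<Rightarrow> real) \<Rightarrow> (real \<Rightarrow> real) \<Rightarrow> real \<Rightarrow> real \<Rightarrow> (real \<times> real) set" where
  "backward_cone f' f'' \<phi> x t =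
     {(\<xi>, \<tau>). 0 < \<tau> \<and> \<tau> < t \<and>
        (\<exists>v \<in> {entropy_sol f' f'' \<phi> x t .. entropy_sol_left f' f'' \<phi> x t}.
           \<xi> = x + (\<tau> - t) * f' v)}"

text \<open>For given \<open>x0\<close> and \<open>t0\<close> the curve in the next definition is unique on \<open>[t0, \<infinity>)\<close>.\<close>

definition fwd_char_from ::
  "(real \<Rightarrow> real) \<Rightarrow> (real \<Rightarrow> real) \<Rightarrow> (real \<Rightarrow> real) \<Rightarrow> real \<Rightarrow> real \<Rightarrow> (real \<Rightarrow> real) \<Rightarrow> bool" where
  "fwd_char_from f' f'' \<phi> x0 t0 X \<longleftrightarrow>
     0 < t0 \<and> continuous_on {t0..} X \<and> X t0 = x0 \<and>
     (\<forall>t1 t2. t0 < t1 \<and> t1 < t2 \<longrightarrow>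
        backward_cone f' f'' \<phi> x0 t0 \<subseteq> backward_cone f' f'' \<phi> (X t1) t1 \<and>
        backward_cone f' f'' \<phi> (X t1) t1 \<subseteq> backward_cone f' f'' \<phi> (X t2) t2)"

text \<open>\<open>fwd_char f' f'' \<phi> t0 X\<close>: the restriction of \<open>X\<close> to \<open>[t0, \<infinity>)\<close>, where \<open>t0 \<ge> 0\<close>, is a forward
  generalized characteristic. Values of \<open>X\<close> before \<open>t0\<close> are irrelevant.\<close>

definition fwd_char ::
  "(real \<Rightarrow> real) \<Rightarrow> (real \<Rightarrow> real) \<Rightarrow> (real \<Rightarrow> real) \<Rightarrow> real \<Rightarrow> (real \<Rightarrow> real) \<Rightarrow> bool" where
  "fwd_char f' f'' \<phi> t0 X \<longleftrightarrow>
     (if t0 = 0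
      then continuous_on {0..} X \<and> (\<forall>s>0. fwd_char_from f' f'' \<phi> (X s) s X)
      else fwd_char_from f' f'' \<phi> (X t0) t0 X)"

definition runs_in :: "real \<Rightarrow> (real \<Rightarrow> real) \<Rightarrow> (real \<times> real) set \<Rightarrow> bool" where
  "runs_in t0 X R \<longleftrightarrow> (\<forall>t>0. t0 \<le> t \<longrightarrow> (X t, t) \<in> R)"

subsection \<open>Generalized N-waves\<close>

text \<open>
  The generalized N-wave depends on a choice of one characteristic in each region and is left
  unspecified elsewhere (on the chosen characteristics, and beyond those in the two unbounded
  regions), so it is rendered as a predicate on \<open>w\<close>. The inverse of the strictly increasing \<open>f'\<close> is
  \<open>inv f'\<close>. If the range of \<open>f'\<close> is not all of the reals, then for small \<open>t\<close> the argument may lie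
  outside that range and \<open>inv f'\<close> is some arbitrary value there.
\<close>

definition gen_N_wave ::
  "(real \<Rightarrow> real) \<Rightarrow> (real \<Rightarrow> real) \<Rightarrow> (real \<Rightarrow> real) \<Rightarrow> (real \<Rightarrow> real \<Rightarrow> real) \<Rightarrow> bool" where
  "gen_N_wave f' f'' \<phi> w \<longleftrightarrow>
     (\<forall>c x0 x t. is_divide f' f'' \<phi> c x0 \<and> (x, t) \<in> ray f' c x0 \<longrightarrow>
        w x t = inv f' ((x - x0) / t)) \<and>
     (\<forall>e h. bounded_gap \<phi> e h \<longrightarrow>
        (\<exists>X. fwd_char f' f'' \<phi> 0 X \<and> runs_in 0 X (gap_region f' \<phi> e h) \<and>
          (\<forall>x t. t > 0 \<longrightarrow>
             (e + t * f' (gap_slope \<phi> e h) < x \<and> x < X t \<longrightarrow> w x t = inv f' ((x - e) / t)) \<and>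
             (X t < x \<and> x < h + t * f' (gap_slope \<phi> e h) \<longrightarrow> w x t = inv f' ((x - h) / t))))) \<and>
     (bdd_above (contact_set \<phi>) \<longrightarrow>
        (\<exists>X. fwd_char f' f'' \<phi> 0 X \<and> runs_in 0 X (right_region f' \<phi>) \<and>
          (\<forall>x t. t > 0 \<and> Sup (contact_set \<phi>) + t * f' (u_right \<phi>) < x \<and> x < X t \<longrightarrow>
             w x t = inv f' ((x - Sup (contact_set \<phi>)) / t)))) \<and>
     (bdd_below (contact_set \<phi>) \<longrightarrow>
        (\<exists>X. fwd_char f' f'' \<phi> 0 X \<and> runs_in 0 X (left_region f' \<phi>) \<and>
          (\<forall>x t. t > 0 \<and> X t < x \<and> x < Inf (contact_set \<phi>) + t * f' (u_left \<phi>) \<longrightarrow>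
             w x t = inv f' ((x - Inf (contact_set \<phi>)) / t))))"

subsection \<open>Degeneracy exponents and rates in \<open>L\<^sup>q\<close>\<close>

definition degeneracy_exponent :: "(real \<Rightarrow> real) \<Rightarrow> real \<Rightarrow> real \<Rightarrow> bool" where
  "degeneracy_exponent f'' c \<alpha> \<longleftrightarrow>
     0 \<le> \<alpha> \<and>
     (\<exists>N>0. ((\<lambda>u. f'' u / \<bar>u - c\<bar> powr \<alpha>) \<longlongrightarrow> N) (at_right c)) \<and>
     (\<exists>N>0. ((\<lambda>u. f'' u / \<bar>u - c\<bar> powr \<alpha>) \<longlongrightarrow> N) (at_left c))"

definition Lq_norm :: "real \<Rightarrow> real set \<Rightarrow> (real \<Rightarrow> real) \<Rightarrow> real" where
  "Lq_norm q A g = (LINT x:A|lebesgue. \<bar>g x\<bar> powr q) powr (1 / q)"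

text \<open>
  \<open>Lq_rate q a b g r\<close> says that the \<open>L\<^sup>q([a(t), b(t)])\<close>-norm of \<open>g(\<cdot>, t)\<close> is at most \<open>o(1) t\<^sup>r\<close> as
  \<open>t\<close> tends to \<open>\<infinity>\<close>. The Bochner integral of a nonintegrable function is 0 by convention, so
  finiteness of the norm for large \<open>t\<close> has to be part of the claim.
\<close>

definition Lq_rate ::
  "real \<Rightarrow> (real \<Rightarrow> real) \<Rightarrow> (real \<Rightarrow> real) \<Rightarrow> (real \<Rightarrow> real \<Rightarrow> real) \<Rightarrow> real \<Rightarrow> bool" where
  "Lq_rate q a b g r \<longleftrightarrow>
     (\<forall>\<^sub>F t in at_top. set_integrable lebesgue {a t..b t} (\<lambda>x. \<bar>g x t\<bar> powr q)) \<and>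
     (\<lambda>t. Lq_norm q {a t..b t} (\<lambda>x. g x t)) \<in> o(\<lambda>t. t powr r)"

end

theory Submission
  imports Defs
begin

text \<open>
  A change of variables turns the maximization of the energy into the minimization of
  \<open>\<Phi> (x - t f' u) + t (u f' u - f u)\<close> over \<open>u\<close>, so everything is governed by the foot
  \<open>y = x - t f' u\<close> of a minimizer. Feet are nondecreasing in \<open>x\<close>, and a divide with value \<open>c\<close> emits
  from \<open>y\<close> exactly if the line of slope \<open>c\<close> through \<open>(y, \<Phi> y)\<close> supports \<open>\<Phi>\<close> globally.

  The key observation is that whenever minimizers at times tending to infinity have converging feet,
  the limit foot carries a supporting line, i.e. is a contact point. Along a forward generalized
  characteristic the foot interval increases with \<open>t\<close>, because the backward cones are nested. Hence in
  a gap \<open>(e, h)\<close> its end points tend to \<open>e\<close> and \<open>h\<close>, and in the right unbounded region to the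
  supremum \<open>a\<close> of the contact set and to infinity; in particular two characteristics in the same
  unbounded region eventually coincide.

  Up to the factor \<open>1 / t\<close>, \<open>f' u - f' w\<close> is the distance between the feet of the solution and of the
  N-wave, hence uniformly \<open>o(1) / t\<close>. Between two divides it vanishes off the gaps, whose total width
  does not depend on \<open>t\<close>. In the right unbounded region, let \<open>\<xi> = X t - t f' c\<close> with \<open>c\<close> the limiting
  slope. Comparing a minimizer \<open>v\<close> at \<open>(X t, t)\<close> with the competitor \<open>c\<close>, whose foot is \<open>\<xi>\<close>, bounds
  \<open>t\<close> times the Bregman distance of \<open>v\<close> from \<open>c\<close> by \<open>O(\<xi> powr (1 - 1 / p))\<close>. Solving for \<open>\<xi>\<close> gives
  the width \<open>O(t powr (p / (p + 1 + \<alpha>)))\<close>. If \<open>\<Phi>\<close> leaves \<open>a\<close> more steeply than its hull, then the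
  foot is eventually equal to \<open>a\<close>.
\<close>

section \<open>Supporting lines and the convex hull\<close>

text \<open>Two obstacles shape the proof. The speed \<open>f'\<close> need not be onto, so a point
  \<open>(x, t)\<close> cannot be joined to an arbitrary foot \<open>z\<close>: a state of speed
  \<open>(x - z) / t\<close> may not exist. The minimization therefore runs over states, and
  competitors are used only where the required speed is squeezed between two attained ones. Moreover
  there may be infinitely many gaps between two divides, so convergence of the feet must be made
  uniform over them: in a gap narrower than \<eta> any two feet differ by at most \<eta>, and only
  finitely many gaps are wider.

  Contact points are handled through their supporting slopes because these pass to limits; the hull
  enters only through its contact set and its derivatives at the extreme contact points.

  The width exponent is a balance of powers. Reaching \<xi> takes an excess speed of order
  \<open>\<xi> / t\<close>, that is \<open>(v - c) powr (1 + \<alpha>)\<close>, at the cost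
  \<open>t * (v - c) powr (2 + \<alpha>)\<close>; the datum pays at most
  \<open>\<xi> powr (1 - 1 / p)\<close>.\<close>

definition supports :: "(real \<Rightarrow> real) \<Rightarrow> real \<Rightarrow> real \<Rightarrow> bool" where
  "supports F c x \<longleftrightarrow> (\<forall>y. F x + c * (y - x) \<le> F y)"

lemma supports_mono:
  assumes "supports F c x" "supports F d y" "x < y"
  shows "c \<le> d"
proof -
  have "F x + c * (y - x) \<le> F y" "F y + d * (x - y) \<le> F x"
    using assms unfolding supports_def by auto
  then have "(c - d) * (y - x) \<le> 0" by (simp add: algebra_simps)
  with \<open>x < y\<close> show ?thesis by (simp add: mult_le_0_iff)
qed

lemma supports_limit:
  assumes F: "continuous_on UNIV F"
    and X: "X \<longlonglongrightarrow> x" and C: "C \<longlonglongrightarrow> c" and s: "\<And>n. supports F (C n) (X n)"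
  shows "supports F c x"
  unfolding supports_def
proof
  fix y
  have "isCont F x" using F continuous_on_eq_continuous_at by blast
  then have "(\<lambda>n. F (X n)) \<longlonglongrightarrow> F x" using X by (simp add: isCont_tendsto_compose)
  then have "(\<lambda>n. F (X n) + C n * (y - X n)) \<longlonglongrightarrow> F x + c * (y - x)"
    using X C by (intro tendsto_intros)
  moreover have "\<And>n. F (X n) + C n * (y - X n) \<le> F y" using s unfolding supports_def by auto
  ultimately show "F x + c * (y - x) \<le> F y" by (meson LIMSEQ_le_const2)
qed

lemma supports_slope_bound:
  assumes lip: "\<And>x y. \<bar>F x - F y\<bar> \<le> B * \<bar>x - y\<bar>" and "supports F c x"
  shows "\<bar>c\<bar> \<le> B"
proof -
  have "F x + c * ((x + 1) - x) \<le> F (x + 1)" "F x + c * ((x - 1) - x) \<le> F (x - 1)"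
    using assms(2) unfolding supports_def by blast+
  moreover have "\<bar>F (x + 1) - F x\<bar> \<le> B" "\<bar>F (x - 1) - F x\<bar> \<le> B"
    using lip[of "x + 1" x] lip[of "x - 1" x] by auto
  ultimately show ?thesis by simp
qed

lemma lipschitz_continuous:
  fixes F :: "real \<Rightarrow> real"
  assumes "\<And>x y. \<bar>F x - F y\<bar> \<le> B * \<bar>x - y\<bar>"
  shows "continuous_on UNIV F"
proof -
  have "B-lipschitz_on UNIV F"
    using assms[of 0 1] by (intro lipschitz_onI) (auto simp: dist_real_def assms)
  then show ?thesis by (rule lipschitz_on_continuous_on)
qed

text \<open>Supporting slopes are bounded by \<open>B\<close>, so along a subsequence they converge,
  and supporting lines pass to the limit. The set \<open>S\<close> allows a closed condition on foot
  and slope together, such as the side of a given point on which the ray passes at a fixed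
  time.\<close>

lemma supports_closed_restrict:
  assumes lip: "\<And>x y. \<bar>F x - F y\<bar> \<le> B * \<bar>x - y\<bar>" and S: "closed S"
  shows "closed {x. \<exists>c. supports F c x \<and> (x, c) \<in> S}"
  unfolding closed_sequential_limits
proof clarify
  fix X x assume X: "\<forall>n. X n \<in> {x. \<exists>c. supports F c x \<and> (x, c) \<in> S}" "X \<longlonglongrightarrow> x"
  then obtain C where C: "\<And>n. supports F (C n) (X n)" "\<And>n. (X n, C n) \<in> S" by (auto simp: choice_iff)
  have "\<And>n. C n \<in> {-B..B}" using supports_slope_bound[OF lip C(1)] by (auto simp: abs_le_iff minus_le_iff)
  then obtain c r where r: "strict_mono (r::nat\<Rightarrow>nat)" "(C \<circ> r) \<longlonglongrightarrow> c"
    using compact_imp_seq_compact[OF compact_Icc[of "-B" B]] unfolding seq_compact_def by metis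
  have Xr: "(X \<circ> r) \<longlonglongrightarrow> x" using X r LIMSEQ_subseq_LIMSEQ by blast
  have "supports F c x"
    by (rule supports_limit[OF lipschitz_continuous[OF lip] Xr r(2)]) (use C in auto)
  moreover have "(x, c) \<in> S"
    using closed_sequentially[OF S, of "\<lambda>n. ((X \<circ> r) n, (C \<circ> r) n)"] tendsto_Pair[OF Xr r(2)] C(2) by simp
  ultimately show "\<exists>c. supports F c x \<and> (x, c) \<in> S" by auto
qed

lemma supports_closed:
  assumes "\<And>x y. \<bar>F x - F y\<bar> \<le> B * \<bar>x - y\<bar>"
  shows "closed {x. \<exists>c. supports F c x}"
  using supports_closed_restrict[OF assms, of UNIV] by simp

lemma supports_convex:
  assumes "supports F c x" "supports F d x" "c \<le> m" "m \<le> d"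
  shows "supports F m x"
  unfolding supports_def
proof
  fix y
  have *: "F x + c * (y - x) \<le> F y" "F x + d * (y - x) \<le> F y" using assms unfolding supports_def by auto
  show "F x + m * (y - x) \<le> F y"
  proof (cases "x \<le> y")
    case True
    then have "m * (y - x) \<le> d * (y - x)" using assms by (intro mult_right_mono) auto
    with * show ?thesis by simp
  next
    case False
    then have "m * (y - x) \<le> c * (y - x)" using assms by (intro mult_right_mono_neg) auto
    with * show ?thesis by simp
  qed
qed

text \<open>The supremum of the slopes of chords ending at \<open>x\<close> separates them from
  those of chords starting at \<open>x\<close>, hence is a supporting slope.\<close>

lemma supports_of_three_slopes:
  assumes "\<And>y z. y < x \<Longrightarrow> x < z \<Longrightarrow> (F x - F y) / (x - y) \<le> (F z - F x) / (z - x)"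
  shows "\<exists>c. supports F c x"
proof -
  let ?S = "(\<lambda>y. (F x - F y) / (x - y)) ` {..<x}"
  have bdd: "bdd_above ?S" using assms[of _ "x + 1"] by (intro bdd_aboveI2) auto
  have "supports F (Sup ?S) x" unfolding supports_def
  proof
    fix y
    consider "y < x" | "y = x" | "x < y" by linarith
    then show "F x + Sup ?S * (y - x) \<le> F y"
    proof cases
      case 1
      then have "(F x - F y) / (x - y) \<le> Sup ?S" using bdd by (intro cSup_upper) auto
      then have "F x - F y \<le> Sup ?S * (x - y)" using 1 by (simp add: pos_divide_le_eq)
      then show ?thesis by (simp add: algebra_simps)
    next
      case 3
      have "Sup ?S \<le> (F y - F x) / (y - x)"
        using assms[OF _ 3] by (intro cSup_least) (auto intro: exI[of _ "x-1"])
      then show ?thesis using 3 by (simp add: pos_le_divide_eq)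
    qed simp
  qed
  then show ?thesis by blast
qed

section \<open>Hulls on bounded intervals, their limit and the contact points\<close>

lemma hull_on_le:
  assumes "continuous_on UNIV F" "\<bar>a\<bar> < N" "\<bar>y\<bar> < N" "\<bar>z\<bar> < N" "0 \<le> \<theta>" "\<theta> \<le> 1" "z = (1 - \<theta>) * a + \<theta> * y"
  shows "hull_on F N z \<le> (1 - \<theta>) * F a + \<theta> * F y"
proof -
  have "compact (F ` {-N..N})" using assms(1) by (meson compact_continuous_image compact_Icc continuous_on_subset subset_UNIV)
  then have "bdd_below (F ` {-N..N})" by (simp add: bounded_imp_bdd_below compact_imp_bounded)
  then obtain m where "\<forall>y\<in>{-N..N}. m \<le> F y" unfolding bdd_below_def by auto
  \<comment> \<open>A constant below \<open>F\<close> makes the set of minorants nonempty, so that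
    \<open>Sup\<close> is bounded by every common upper bound.\<close>
  then have "m \<in> {g z | g. convex_on {-N..N} g \<and> (\<forall>y\<in>{-N..N}. g y \<le> F y)}"
    by (auto intro!: exI[of _ "\<lambda>_. m"] simp: convex_on_const)
  moreover have "g z \<le> (1 - \<theta>) * F a + \<theta> * F y"
    if "convex_on {-N..N} g" "\<forall>y\<in>{-N..N}. g y \<le> F y" for g
  proof -
    have "g z \<le> (1 - \<theta>) * g a + \<theta> * g y"
      using convex_onD[OF that(1), of \<theta> a y] assms by (auto simp: abs_less_iff)
    also have "\<dots> \<le> (1 - \<theta>) * F a + \<theta> * F y"
      using that(2) assms by (intro add_mono mult_left_mono) (auto simp: abs_less_iff)
    finally show ?thesis .
  qed
  ultimately show ?thesis using assms(4) unfolding hull_on_def by (auto intro!: cSup_least)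
qed

lemma hull_on_ge:
  assumes "supports F c a" "\<bar>z\<bar> < N"
  shows "F a + c * (z - a) \<le> hull_on F N z"
proof -
  have "convex_on {-N..N} (\<lambda>x. F a + c * (x - a))"
    by (rule convex_onI) (auto simp: algebra_simps)
  then have "F a + c * (z - a) \<in> {g z | g. convex_on {-N..N} g \<and> (\<forall>y\<in>{-N..N}. g y \<le> F y)}"
    using assms unfolding supports_def mem_Collect_eq
    by (intro exI[of _ "\<lambda>x. F a + c * (x - a)"]) auto
  moreover have "bdd_above {g z | g. convex_on {-N..N} g \<and> (\<forall>y\<in>{-N..N}. g y \<le> F y)}"
    using assms by (intro bdd_aboveI[of _ "F z"]) (auto simp: abs_less_iff)
  ultimately show ?thesis using assms unfolding hull_on_def by (auto intro: cSup_upper)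
qed

lemma hull_on_antimono:
  assumes "continuous_on UNIV F" "\<bar>z\<bar> < N" "N \<le> N'"
  shows "hull_on F N' z \<le> hull_on F N z"
proof -
  have "compact (F ` {-N'..N'})" using assms(1) by (meson compact_continuous_image compact_Icc continuous_on_subset subset_UNIV)
  then have "bdd_below (F ` {-N'..N'})" by (simp add: bounded_imp_bdd_below compact_imp_bounded)
  then obtain m where "\<forall>y\<in>{-N'..N'}. m \<le> F y" unfolding bdd_below_def by auto
  then have "m \<in> {g z | g. convex_on {-N'..N'} g \<and> (\<forall>y\<in>{-N'..N'}. g y \<le> F y)}"
    by (auto intro!: exI[of _ "\<lambda>_. m"] simp: convex_on_const)
  moreover have "bdd_above {g z | g. convex_on {-N..N} g \<and> (\<forall>y\<in>{-N..N}. g y \<le> F y)}"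
    using assms by (intro bdd_aboveI[of _ "F z"]) (auto simp: abs_less_iff)
  moreover have "convex_on {-N..N} g" if "convex_on {-N'..N'} g" for g
    using that assms(3) by (auto intro: convex_on_subset)
  ultimately show ?thesis
    using assms unfolding hull_on_def
    by (auto intro!: cSup_subset_mono)
qed

text \<open>The supporting line bounds the hull from below, the chord from \<open>a\<close> to
  \<open>y\<close> from above, and at \<open>z\<close> the two differ by at most
  \<open>\<epsilon> * \<bar>z - a\<bar>\<close>. As \<open>y\<close> may depend on \<epsilon>, it
  may move off to infinity; this covers the rays beyond the extreme contact points as well as
  \<open>y = z = a\<close>.\<close>

lemma convex_env_eqI:
  assumes F: "continuous_on UNIV F" and c: "supports F c a"
    and y: "\<And>\<epsilon>. \<epsilon> > 0 \<Longrightarrow> \<exists>y. z \<in> closed_segment a y \<and> F y \<le> F a + c * (y - a) + \<epsilon> * \<bar>y - a\<bar>"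
  shows "convex_env F z = ereal (F a + c * (z - a))"
proof -
  have "((\<lambda>N. hull_on F N z) \<longlongrightarrow> F a + c * (z - a)) at_top"
  proof (rule tendstoI)
    fix e :: real assume "e > 0"
    define k where "k = \<bar>z - a\<bar> + 1"
    define \<epsilon> where "\<epsilon> = e / (2 * k)"
    have "k > 0" unfolding k_def by (simp add: add_nonneg_pos)
    with \<open>e > 0\<close> have "\<epsilon> > 0" unfolding \<epsilon>_def by simp
    have "\<epsilon> * \<bar>z - a\<bar> < e"
    proof -
      have "\<epsilon> * \<bar>z - a\<bar> \<le> \<epsilon> * k" using \<open>\<epsilon> > 0\<close> unfolding k_def by (intro mult_left_mono) auto
      also have "\<dots> = e / 2" using \<open>k > 0\<close> unfolding \<epsilon>_def by simp
      finally show ?thesis using \<open>e > 0\<close> by simp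
    qed
    obtain y where y: "z \<in> closed_segment a y" "F y \<le> F a + c * (y - a) + \<epsilon> * \<bar>y - a\<bar>"
      using y[OF \<open>\<epsilon> > 0\<close>] by blast
    then obtain \<theta> where \<theta>: "0 \<le> \<theta>" "\<theta> \<le> 1" "z = (1 - \<theta>) * a + \<theta> * y"
      by (auto simp: in_segment)
    have za: "z - a = \<theta> * (y - a)" using \<theta> by (simp add: algebra_simps)
    show "\<forall>\<^sub>F N in at_top. dist (hull_on F N z) (F a + c * (z - a)) < e"
      using eventually_gt_at_top[of "max (max \<bar>a\<bar> \<bar>y\<bar>) \<bar>z\<bar>"]
    proof eventually_elim
      case (elim N)
      have "hull_on F N z \<le> (1 - \<theta>) * F a + \<theta> * F y"
        using elim \<theta> by (intro hull_on_le[OF F]) auto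
      also have "\<dots> \<le> (1 - \<theta>) * F a + \<theta> * (F a + c * (y - a) + \<epsilon> * \<bar>y - a\<bar>)"
        using y \<theta> by (intro add_left_mono mult_left_mono) auto
      also have "\<dots> = F a + c * (z - a) + \<epsilon> * \<bar>z - a\<bar>"
        unfolding za using \<theta>(1) by (simp add: distrib_left left_diff_distrib abs_mult)
      finally have "hull_on F N z \<le> F a + c * (z - a) + \<epsilon> * \<bar>z - a\<bar>" .
      moreover have "F a + c * (z - a) \<le> hull_on F N z" using elim by (intro hull_on_ge[OF c]) auto
      ultimately show ?case using \<open>\<epsilon> * \<bar>z - a\<bar> < e\<close> by (simp add: dist_real_def)
    qed
  qed
  then have "((\<lambda>N. ereal (hull_on F N z)) \<longlongrightarrow> ereal (F a + c * (z - a))) at_top" by simp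
  then show ?thesis unfolding convex_env_def by (intro tendsto_Lim) auto
qed

text \<open>By antitonicity the limit is an infimum over \<open>N\<close>, so a single
  \<open>N0\<close> bounds it. The infimum is formed in \<open>ereal\<close> because it may be
  \<open>-\<infinity>\<close>.\<close>

lemma convex_env_le:
  assumes F: "continuous_on UNIV F" and N0: "\<bar>z\<bar> < N0" "hull_on F N0 z \<le> m"
  shows "convex_env F z \<le> ereal m"
proof -
  let ?h = "\<lambda>N. ereal (hull_on F N z)"
  let ?L = "INF N\<in>{\<bar>z\<bar><..}. ?h N"
  have "(?h \<longlongrightarrow> ?L) at_top"
  proof (rule order_tendstoI)
    fix a assume "a < ?L"
    show "\<forall>\<^sub>F N in at_top. a < ?h N"
      using eventually_gt_at_top[of "\<bar>z\<bar>"]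
    proof eventually_elim
      case (elim N)
      then have "?L \<le> ?h N" by (intro INF_lower) auto
      with \<open>a < ?L\<close> show ?case by (rule less_le_trans)
    qed
  next
    fix a assume "?L < a"
    then obtain N1 where N1: "N1 > \<bar>z\<bar>" "?h N1 < a" by (auto simp: INF_less_iff)
    show "\<forall>\<^sub>F N in at_top. ?h N < a"
      using eventually_ge_at_top[of N1]
    proof eventually_elim
      case (elim N)
      have "?h N \<le> ?h N1" using hull_on_antimono[OF F N1(1) elim] by simp
      then show ?case using N1(2) by (rule le_less_trans)
    qed
  qed
  then have "convex_env F z = ?L" unfolding convex_env_def by (intro tendsto_Lim) auto
  also have "\<dots> \<le> ?h N0" using N0 by (intro INF_lower) auto
  also have "\<dots> \<le> ereal m" using N0 by simp
  finally show ?thesis .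
qed

text \<open>The hull lies below every chord of \<open>F\<close>; where it touches \<open>F\<close>,
  chords over \<open>x\<close> lie above \<open>F x\<close>, which is the three-slope
  condition.\<close>

lemma convex_env_contact_iff:
  assumes F: "continuous_on UNIV F"
  shows "ereal (F x) = convex_env F x \<longleftrightarrow> (\<exists>c. supports F c x)"
proof
  assume "\<exists>c. supports F c x"
  then obtain c where c: "supports F c x" ..
  have "convex_env F x = ereal (F x + c * (x - x))"
    by (rule convex_env_eqI[OF F c]) (auto intro!: exI[of _ x])
  then show "ereal (F x) = convex_env F x" by simp
next
  assume eq: "ereal (F x) = convex_env F x"
  show "\<exists>c. supports F c x"
  proof (rule supports_of_three_slopes)
    fix y z assume yz: "y < x" "x < z"
    define \<theta> where "\<theta> = (x - y) / (z - y)"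
    define N where "N = max \<bar>y\<bar> \<bar>z\<bar> + 1"
    have \<theta>: "0 \<le> \<theta>" "\<theta> \<le> 1" using yz by (auto simp: \<theta>_def field_simps)
    have e: "\<theta> * (z - y) = x - y" using yz unfolding \<theta>_def by simp
    then have x: "x = (1 - \<theta>) * y + \<theta> * z" by (simp add: algebra_simps)
    have N: "\<bar>y\<bar> < N" "\<bar>z\<bar> < N" "\<bar>x\<bar> < N" using yz unfolding N_def by auto
    have "convex_env F x \<le> ereal ((1 - \<theta>) * F y + \<theta> * F z)"
      using N \<theta> x by (intro convex_env_le[OF F, of _ N] hull_on_le[OF F]) auto
    then have "F x \<le> (1 - \<theta>) * F y + \<theta> * F z" using eq by (metis ereal_less_eq(3))
    then have "(z - y) * F x \<le> (z - y) * ((1 - \<theta>) * F y + \<theta> * F z)" using yz by (intro mult_left_mono) auto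
    also have "\<dots> = (z - y) * F y + (\<theta> * (z - y)) * (F z - F y)" by (simp add: algebra_simps)
    finally have "(z - y) * F x \<le> (z - y) * F y + (x - y) * (F z - F y)" unfolding e .
    then have "(F x - F y) * (z - x) \<le> (F z - F x) * (x - y)" by (simp add: algebra_simps)
    then show "(F x - F y) / (x - y) \<le> (F z - F x) / (z - x)"
      using yz by (simp add: frac_le_eq divide_le_eq field_simps)
  qed
qed

section \<open>Minimizers of the Lax functional\<close>

text \<open>The convex conjugate of \<open>f\<close> at the speed \<open>f' u\<close>, expressed
  through the state \<open>u\<close> so that only attained speeds occur.\<close>

definition legendre :: "(real \<Rightarrow> real) \<Rightarrow> (real \<Rightarrow> real) \<Rightarrow> real \<Rightarrow> real" where
  "legendre f f' u = u * f' u - f u"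

definition lax :: "(real \<Rightarrow> real) \<Rightarrow> (real \<Rightarrow> real) \<Rightarrow> (real \<Rightarrow> real) \<Rightarrow> real \<Rightarrow> real \<Rightarrow> real \<Rightarrow> real" where
  "lax f f' F x t u = F (x - t * f' u) + t * legendre f f' u"

definition minimizers :: "(real \<Rightarrow> real) \<Rightarrow> (real \<Rightarrow> real) \<Rightarrow> (real \<Rightarrow> real) \<Rightarrow> real \<Rightarrow> real \<Rightarrow> real set" where
  "minimizers f f' F x t = {u. \<forall>v. lax f f' F x t u \<le> lax f f' F x t v}"

locale hopf_lax =
  fixes f f' F :: "real \<Rightarrow> real" and B :: real
  assumes deriv: "\<And>x. (f has_real_derivative f' x) (at x)"
    and cont: "continuous_on UNIV f'" and smono: "strict_mono f'"
    and lip: "\<And>x y. \<bar>F x - F y\<bar> \<le> B * \<bar>x - y\<bar>"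
begin

abbreviation "leg \<equiv> legendre f f'"
abbreviation "M \<equiv> minimizers f f' F"
abbreviation "supp \<equiv> supports F"

text \<open>Faster states come from further left, so the largest minimizer has the leftmost
  foot.\<close>

definition "foot_l x t = x - t * f' (Sup (M x t))"
definition "foot_r x t = x - t * f' (Inf (M x t))"

lemma B_nonneg: "0 \<le> B" using lip[of 1 0] by simp

lemma F_cont: "continuous_on UNIV F" using lipschitz_continuous[OF lip] .

lemma f'_less: "f' u < f' v \<longleftrightarrow> u < v" using smono by (simp add: strict_mono_less)
lemma f'_le: "f' u \<le> f' v \<longleftrightarrow> u \<le> v" using smono by (simp add: strict_mono_less_eq)
lemma f'_eq: "f' u = f' v \<longleftrightarrow> u = v" using smono by (simp add: strict_mono_eq)

lemma f'_ivt:
  assumes "f' a \<le> r" "r \<le> f' b"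
  obtains u where "a \<le> u" "u \<le> b" "f' u = r"
proof -
  have "a \<le> b" using assms f'_le[of a b] by linarith
  then show ?thesis
    using IVT'[of f' a r b] assms cont continuous_on_subset that by blast
qed

lemma f'_ivt_strict:
  assumes "f' a < r" "r < f' b"
  obtains u where "a < u" "u < b" "f' u = r"
  using f'_ivt[of a r b] assms f'_less by (metis less_imp_le)

text \<open>Strict convexity of the conjugate, whose slope at the speed \<open>f' u\<close> is
  \<open>u\<close>. After cancellation it is the tangent inequality for \<open>f\<close> at
  \<open>v\<close>.\<close>

lemma legendre_ineq:
  assumes "u \<noteq> v"
  shows "u * (f' v - f' u) < leg v - leg u"
proof -
  have "f v - f u < f' v * (v - u)"
  proof (cases "u < v")
    case True
    obtain z where "u < z" "z < v" "f v - f u = (v - u) * f' z"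
      using MVT2[OF True] deriv by blast
    moreover have "f' z < f' v" using \<open>z < v\<close> f'_less by blast
    ultimately show ?thesis using True by (simp add: mult.commute)
  next
    case False
    then have "v < u" using assms by simp
    obtain z where "v < z" "z < u" "f u - f v = (u - v) * f' z"
      using MVT2[OF \<open>v < u\<close>] deriv by blast
    moreover have "f' v < f' z" using \<open>v < z\<close> f'_less by blast
    ultimately have "(u - v) * f' v < f u - f v" using \<open>v < u\<close> by simp
    then show ?thesis by (simp add: algebra_simps)
  qed
  then show ?thesis unfolding legendre_def by (simp add: algebra_simps)
qed

lemma legendre_ineq': "u * (f' v - f' u) \<le> leg v - leg u"
  using legendre_ineq[of u v] by (cases "u = v") auto

lemma minimizersD: "u \<in> M x t \<Longrightarrow> lax f f' F x t u \<le> lax f f' F x t v"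
  unfolding minimizers_def by auto

text \<open>The state \<open>w\<close> is the one whose characteristic joins the foot
  \<open>z\<close> to \<open>(x, t)\<close>; its existence is a hypothesis because the speed needed
  may not be attained. The second inequality replaces the conjugate by its tangent at
  \<open>w\<close>, leaving a statement about \<open>F\<close> alone.\<close>

lemma minimizers_competitor:
  assumes "u \<in> M x t" "t > 0" "f' w = f' u + (x - t * f' u - z) / t"
  shows "F (x - t * f' u) + t * leg u \<le> F z + t * leg w"
    and "F (x - t * f' u) \<le> F z + w * (x - t * f' u - z)"
proof -
  have z: "x - t * f' w = z" using assms by (simp add: field_simps)
  show 1: "F (x - t * f' u) + t * leg u \<le> F z + t * leg w"
    using minimizersD[OF assms(1), of w] unfolding lax_def z .
  have "t * (w * (f' u - f' w)) \<le> t * (leg u - leg w)"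
    using legendre_ineq'[of w u] assms by (intro mult_left_mono) auto
  moreover have "t * (f' u - f' w) = - (x - t * f' u - z)" using assms by (simp add: field_simps)
  ultimately have "- (w * (x - t * f' u - z)) \<le> t * leg u - t * leg w"
    by (metis mult.left_commute mult_minus_right right_diff_distrib)
  with 1 show "F (x - t * f' u) \<le> F z + w * (x - t * f' u - z)" by linarith
qed

text \<open>Per unit displacement of the foot \<open>F\<close> changes by at most \<open>B\<close>,
  whereas beyond the states \<plusminus>\<open>B\<close> the Legendre term rises strictly
  faster.\<close>

lemma lax_outside:
  assumes "t > 0"
  shows "B < v \<Longrightarrow> lax f f' F x t B < lax f f' F x t v"
    and "v < - B \<Longrightarrow> lax f f' F x t (- B) < lax f f' F x t v"
proof -
  assume "B < v"
  have "F (x - t * f' B) - F (x - t * f' v) \<le> B * \<bar>(x - t * f' B) - (x - t * f' v)\<bar>"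
    using lip[of "x - t * f' B" "x - t * f' v"] by linarith
  also have "\<dots> = t * (B * (f' v - f' B))"
    using \<open>B < v\<close> f'_less[of B v] assms by (simp add: abs_if algebra_simps)
  also have "\<dots> < t * (leg v - leg B)"
    using legendre_ineq[of B v] \<open>B < v\<close> assms by (intro mult_strict_left_mono) auto
  finally show "lax f f' F x t B < lax f f' F x t v" unfolding lax_def by (simp add: algebra_simps)
next
  assume "v < - B"
  have "F (x - t * f' (-B)) - F (x - t * f' v) \<le> B * \<bar>(x - t * f' (-B)) - (x - t * f' v)\<bar>"
    using lip[of "x - t * f' (-B)" "x - t * f' v"] by linarith
  also have "\<dots> = t * ((-B) * (f' v - f' (-B)))"
    using \<open>v < -B\<close> f'_less[of v "-B"] assms by (simp add: abs_if algebra_simps)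
  also have "\<dots> < t * (leg v - leg (-B))"
    using legendre_ineq[of "-B" v] \<open>v < -B\<close> assms by (intro mult_strict_left_mono) auto
  finally show "lax f f' F x t (- B) < lax f f' F x t v" unfolding lax_def by (simp add: algebra_simps)
qed

lemma minimizers_bounded:
  assumes "t > 0" "u \<in> M x t"
  shows "- B \<le> u" "u \<le> B"
  using minimizersD[OF assms(2), of B] minimizersD[OF assms(2), of "- B"] lax_outside[OF assms(1), of u x]
  by linarith+

lemma lax_continuous: "continuous_on UNIV (lax f f' F x t)"
proof -
  have "continuous_on UNIV f" using deriv DERIV_continuous_on by (meson has_field_derivative_at_within)
  moreover have "continuous_on UNIV (\<lambda>u. F (x - t * f' u))"
    using F_cont by (rule continuous_on_compose2) (auto intro!: continuous_intros cont)
  ultimately show ?thesis unfolding lax_def legendre_def by (intro continuous_intros cont) auto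
qed

lemma minimizers_nonempty:
  assumes "t > 0"
  shows "M x t \<noteq> {}"
proof -
  let ?G = "lax f f' F x t"
  have "{-B..B} \<noteq> {}" using B_nonneg by simp
  then obtain u where u: "u \<in> {-B..B}" "\<And>v. v \<in> {-B..B} \<Longrightarrow> ?G u \<le> ?G v"
    using continuous_attains_inf[OF compact_Icc _ continuous_on_subset[OF lax_continuous subset_UNIV]]
    by blast
  have "?G B \<le> ?G v" if "B < v" for v using lax_outside(1)[OF assms that] by (rule less_imp_le)
  moreover have "?G (-B) \<le> ?G v" if "v < -B" for v using lax_outside(2)[OF assms that] by (rule less_imp_le)
  ultimately have "?G u \<le> ?G v" for v
    using u(2)[of v] u(2)[of B] u(2)[of "-B"] B_nonneg
    by (cases "v < -B"; cases "B < v") (auto intro: order_trans)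
  then show ?thesis unfolding minimizers_def by blast
qed

lemma minimizers_closed: "closed (M x t)"
proof -
  have "M x t = (\<Inter>v. {u. lax f f' F x t u \<le> lax f f' F x t v})" unfolding minimizers_def by auto
  then show ?thesis by (simp add: closed_INT closed_Collect_le lax_continuous)
qed

lemma minimizers_bdd:
  assumes "t > 0" shows "bdd_above (M x t)" "bdd_below (M x t)"
  by (meson assms minimizers_bounded bdd_aboveI bdd_belowI)+

lemma Inf_minimizers:
  assumes "t > 0" shows "Inf (M x t) \<in> M x t" "Sup (M x t) \<in> M x t"
  using closed_contains_Inf closed_contains_Sup minimizers_bdd[OF assms] minimizers_nonempty[OF assms]
    minimizers_closed by auto

lemma foot_bounds:
  assumes "t > 0" "u \<in> M x t"
  shows "foot_l x t \<le> x - t * f' u" "x - t * f' u \<le> foot_r x t"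
proof -
  have "u \<le> Sup (M x t)" "Inf (M x t) \<le> u"
    using assms minimizers_bdd by (auto intro: cSup_upper cInf_lower)
  then show "foot_l x t \<le> x - t * f' u" "x - t * f' u \<le> foot_r x t"
    using assms f'_le unfolding foot_l_def foot_r_def by auto
qed

text \<open>Exchange argument: if the two characteristics crossed, exchanging their feet would give
  two competitors with the same sum of \<open>F\<close>-values and the same total speed, but with
  speeds strictly between the original ones. Strict convexity of the conjugate makes their total
  strictly smaller.\<close>

lemma foot_mono:
  assumes t: "t > 0" and u1: "u1 \<in> M x1 t" and u2: "u2 \<in> M x2 t" and x: "x1 < x2"
  shows "x1 - t * f' u1 \<le> x2 - t * f' u2"
proof (rule ccontr)
  define y1 where "y1 = x1 - t * f' u1"
  define y2 where "y2 = x2 - t * f' u2"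
  assume "\<not> ?thesis"
  then have y: "y2 < y1" unfolding y1_def y2_def by simp
  have f1: "f' u1 = (x1 - y1) / t" and f2: "f' u2 = (x2 - y2) / t"
    using t unfolding y1_def y2_def by auto
  have "f' u1 < (x1 - y2) / t" "(x1 - y2) / t < f' u2" "f' u1 < (x2 - y1) / t" "(x2 - y1) / t < f' u2"
    unfolding f1 f2 using t x y by (auto intro!: divide_strict_right_mono)
  \<comment> \<open>The exchanged states: \<open>a\<close> leads from \<open>y2\<close> to
    \<open>x1\<close> and \<open>b\<close> from \<open>y1\<close> to \<open>x2\<close>.\<close>
  then obtain a b where a: "u1 < a" "a < u2" "f' a = (x1 - y2) / t"
    and b: "u1 < b" "b < u2" "f' b = (x2 - y1) / t"
    by (metis f'_ivt_strict)
  have "F y1 + t * leg u1 \<le> F y2 + t * leg a" "F y2 + t * leg u2 \<le> F y1 + t * leg b"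
    unfolding y1_def y2_def
    by (rule minimizers_competitor(1)[OF u1 t], use a t in \<open>simp add: y2_def field_simps\<close>)
       (rule minimizers_competitor(1)[OF u2 t], use b t in \<open>simp add: y1_def field_simps\<close>)
  then have "t * (leg u1 + leg u2) \<le> t * (leg a + leg b)" by (simp add: algebra_simps)
  then have le: "leg u1 + leg u2 \<le> leg a + leg b" using t by simp
  have e: "f' u1 + f' u2 = f' a + f' b" unfolding f1 f2 a(3) b(3) by (simp add: add_divide_distrib[symmetric] del: add_divide_distrib)
  show False
  proof (cases "a \<le> b")
    case True
    have "a * (f' u1 - f' a) < leg u1 - leg a" "b * (f' u2 - f' b) < leg u2 - leg b"
      using legendre_ineq[of a u1] legendre_ineq[of b u2] a(1,2) b(1,2) by auto
    moreover have "f' u1 - f' a = - (f' u2 - f' b)" using e by simp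
    moreover have "0 \<le> (b - a) * (f' u2 - f' b)" using True b f'_less[of b u2] by auto
    ultimately show False using le by (simp add: algebra_simps)
  next
    case False
    have "b * (f' u1 - f' b) < leg u1 - leg b" "a * (f' u2 - f' a) < leg u2 - leg a"
      using legendre_ineq[of b u1] legendre_ineq[of a u2] a(1,2) b(1,2) by auto
    moreover have "f' u1 - f' b = - (f' u2 - f' a)" using e by simp
    moreover have "0 \<le> (a - b) * (f' u2 - f' a)" using False a f'_less[of a u2] by auto
    ultimately show False using le by (simp add: algebra_simps)
  qed
qed

text \<open>Along the ray the supporting line of \<open>F\<close> and the tangent of the conjugate
  at \<open>c\<close> have opposite linear parts, which cancel; the strictness of the second bound
  gives uniqueness.\<close>

lemma minimizers_supports:
  assumes "t > 0" "supp c y"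
  shows "M (y + t * f' c) t = {c}"
proof -
  have "lax f f' F (y + t * f' c) t c < lax f f' F (y + t * f' c) t v" if "v \<noteq> c" for v
  proof -
    have "F y + c * (t * (f' c - f' v)) \<le> F (y + t * f' c - t * f' v)"
      using assms(2)[unfolded supports_def, rule_format, of "y + t * f' c - t * f' v"]
      by (simp add: algebra_simps)
    moreover have "t * (c * (f' v - f' c)) < t * (leg v - leg c)"
      using legendre_ineq[of c v] that assms by (intro mult_strict_left_mono) auto
    ultimately show ?thesis unfolding lax_def by (simp add: algebra_simps)
  qed
  then show ?thesis unfolding minimizers_def
    by (auto simp: order_less_imp_le) (metis less_eq_real_def linorder_not_less)+
qed

text \<open>A ray with a supporting slope is a barrier: its only foot is \<open>y\<close>, and feet
  are ordered like the points they belong to.\<close>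

lemma feet_right_of_supports:
  assumes "t > 0" "supp c y" "y + t * f' c < x" "u \<in> M x t"
  shows "y \<le> x - t * f' u"
  using foot_mono[of t c "y + t * f' c" u x] minimizers_supports[OF assms(1,2)] assms by simp

lemma feet_left_of_supports:
  assumes "t > 0" "supp c y" "x < y + t * f' c" "u \<in> M x t"
  shows "x - t * f' u \<le> y"
  using foot_mono[of t u x c "y + t * f' c"] minimizers_supports[OF assms(1,2)] assms by simp

text \<open>For fixed \<open>z\<close>, the state joining foot \<open>z\<close> to
  \<open>(x n, t n)\<close> has a speed differing from that of \<open>u n\<close> by
  \<open>(y n - z) / t n\<close>, which tends to 0. That state is therefore close to
  \<open>c\<close>, and comparison with it becomes the supporting inequality in the limit.\<close>

lemma foot_limit_supports:
  assumes u: "\<And>n. u n \<in> M (x n) (t n)" and t: "\<And>n. t n > 0" "filterlim t at_top sequentially"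
    and Y: "(\<lambda>n. x n - t n * f' (u n)) \<longlonglongrightarrow> Y" and c: "u \<longlonglongrightarrow> c"
  shows "supp c Y"
  unfolding supports_def
proof
  fix z
  define y where "y n = x n - t n * f' (u n)" for n
  have y: "y \<longlonglongrightarrow> Y" using Y unfolding y_def .
  have "isCont f' c" "isCont F Y" using cont F_cont continuous_on_eq_continuous_at by blast+
  then have f'u: "(\<lambda>n. f' (u n)) \<longlonglongrightarrow> f' c" and Fy: "(\<lambda>n. F (y n)) \<longlonglongrightarrow> F Y"
    using c y by (auto simp: isCont_tendsto_compose)
  have "(\<lambda>n. (y n - z) / t n) \<longlonglongrightarrow> 0"
    by (rule tendsto_divide_0[of _ "Y - z"]) (use y t(2) in \<open>auto intro!: tendsto_intros filterlim_at_top_imp_at_infinity\<close>)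
  then have lim: "(\<lambda>n. f' (u n) + (y n - z) / t n) \<longlonglongrightarrow> f' c"
    using tendsto_add[OF f'u] by fastforce
  have "F Y + c * (z - Y) - \<epsilon> * \<bar>z - Y\<bar> \<le> F z" if "\<epsilon> > 0" for \<epsilon>
  proof (rule tendsto_upperbound)
    show "(\<lambda>n. F (y n) + c * (z - y n) - \<epsilon> * \<bar>z - y n\<bar>) \<longlonglongrightarrow> F Y + c * (z - Y) - \<epsilon> * \<bar>z - Y\<bar>"
      by (intro tendsto_intros Fy y)
    \<comment> \<open>Squeezing the required speed between these two values yields the competitor
      \<open>w\<close> and places it within \<epsilon> of \<open>c\<close>.\<close>
    have "f' (c - \<epsilon>) < f' c" "f' c < f' (c + \<epsilon>)" using that f'_less by auto
    then have "\<forall>\<^sub>F n in sequentially. f' (c - \<epsilon>) < f' (u n) + (y n - z) / t n"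
      "\<forall>\<^sub>F n in sequentially. f' (u n) + (y n - z) / t n < f' (c + \<epsilon>)"
      using lim order_tendstoD by blast+
    then show "\<forall>\<^sub>F n in sequentially. F (y n) + c * (z - y n) - \<epsilon> * \<bar>z - y n\<bar> \<le> F z"
    proof eventually_elim
      case (elim n)
      then obtain w where w: "c - \<epsilon> < w" "w < c + \<epsilon>" "f' w = f' (u n) + (y n - z) / t n"
        by (meson f'_ivt_strict)
      have "F (y n) \<le> F z + w * (y n - z)"
        unfolding y_def by (rule minimizers_competitor(2)[OF u t(1)]) (use w in \<open>simp add: y_def\<close>)
      moreover have "(w - c) * (y n - z) \<le> \<epsilon> * \<bar>z - y n\<bar>"
      proof -
        have "(w - c) * (y n - z) \<le> \<bar>w - c\<bar> * \<bar>y n - z\<bar>" by (metis abs_ge_self abs_mult)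
        also have "\<dots> \<le> \<epsilon> * \<bar>y n - z\<bar>" using w by (intro mult_right_mono) auto
        finally show ?thesis by (simp add: abs_minus_commute)
      qed
      ultimately show ?case by (simp add: algebra_simps)
    qed
  qed auto
  then have "F Y + c * (z - Y) \<le> F z + \<epsilon>" if "\<epsilon> > 0" for \<epsilon>
  proof (cases "z = Y")
    case False
    then show ?thesis using \<open>\<And>\<epsilon>. \<epsilon> > 0 \<Longrightarrow> _ \<epsilon>\<close>[of "\<epsilon> / \<bar>z - Y\<bar>"] that by simp
  qed (use that in auto)
  then show "F Y + c * (z - Y) \<le> F z" by (rule field_le_epsilon)
qed

lemma foot_limit_supports_ex:
  assumes u: "\<And>n. u n \<in> M (x n) (t n)" and t: "\<And>n. t n > 0" "filterlim t at_top sequentially"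
    and Y: "(\<lambda>n. x n - t n * f' (u n)) \<longlonglongrightarrow> Y"
  shows "\<exists>c. supp c Y"
proof -
  have "\<And>n. u n \<in> {-B..B}" using minimizers_bounded[OF t(1) u] by auto
  then obtain c r where r: "strict_mono (r::nat\<Rightarrow>nat)" "(u \<circ> r) \<longlonglongrightarrow> c"
    using compact_imp_seq_compact[OF compact_Icc[of "-B" B]] unfolding seq_compact_def by metis
  have "supp c Y"
  proof (rule foot_limit_supports)
    show "(u \<circ> r) n \<in> M ((x \<circ> r) n) ((t \<circ> r) n)" "(t \<circ> r) n > 0" for n using u t by auto
    show "filterlim (t \<circ> r) at_top sequentially"
      unfolding comp_def using filterlim_compose[OF t(2) filterlim_subseq[OF r(1)]] .
    show "(\<lambda>n. (x \<circ> r) n - (t \<circ> r) n * f' ((u \<circ> r) n)) \<longlonglongrightarrow> Y"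
      using LIMSEQ_subseq_LIMSEQ[OF Y r(1)] by (simp add: comp_def)
  qed (fact r)
  then show ?thesis ..
qed

lemma supports_of_minimizers:
  assumes "\<And>t. t > 0 \<Longrightarrow> c \<in> M (y + t * f' c) t"
  shows "supp c y"
  by (rule foot_limit_supports[of "\<lambda>_. c" "\<lambda>n. y + real (Suc n) * f' c" "\<lambda>n. real (Suc n)"])
     (auto simp del: of_nat_Suc intro!: assms filterlim_compose[OF filterlim_real_sequentially filterlim_Suc])

end

section \<open>Forward characteristics\<close>

lemma antimono_limit:
  fixes g :: "real \<Rightarrow> real"
  assumes anti: "\<And>s t. T \<le> s \<Longrightarrow> s \<le> t \<Longrightarrow> g t \<le> g s" and m: "\<And>t. T \<le> t \<Longrightarrow> m \<le> g t"
  obtains Y where "(g \<longlongrightarrow> Y) at_top" "\<And>t. T \<le> t \<Longrightarrow> Y \<le> g t"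
proof
  have bdd: "bdd_below (g ` {T..})" using m by (intro bdd_belowI2) auto
  then show le: "Inf (g ` {T..}) \<le> g t" if "T \<le> t" for t using that by (intro cInf_lower) auto
  show "(g \<longlongrightarrow> Inf (g ` {T..})) at_top"
  proof (rule order_tendstoI)
    fix a assume "a < Inf (g ` {T..})"
    show "\<forall>\<^sub>F t in at_top. a < g t"
      using eventually_ge_at_top[of T] by eventually_elim (use \<open>a < _\<close> le in force)
  next
    fix a assume "Inf (g ` {T..}) < a"
    then obtain s where s: "T \<le> s" "g s < a" using cInf_less_iff[OF _ bdd] by auto
    show "\<forall>\<^sub>F t in at_top. g t < a"
      using eventually_ge_at_top[of s] by eventually_elim (use s anti in force)
  qed
qed

context hopf_lax
begin

text \<open>
  In terms of the two edges of the backward cones; \<open>\<tau> = 0\<close> expresses that the foot intervals are nested.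
\<close>
definition char_from :: "real \<Rightarrow> (real \<Rightarrow> real) \<Rightarrow> bool" where
  "char_from T X \<longleftrightarrow> 0 < T \<and> (\<forall>s t \<tau>. T \<le> s \<and> s < t \<and> 0 \<le> \<tau> \<and> \<tau> \<le> s \<longrightarrow>
     X t + (\<tau> - t) * f' (Sup (M (X t) t)) \<le> X s + (\<tau> - s) * f' (Sup (M (X s) s)) \<and>
     X s + (\<tau> - s) * f' (Inf (M (X s) s)) \<le> X t + (\<tau> - t) * f' (Inf (M (X t) t)))"

lemma char_from_pos: "char_from T X \<Longrightarrow> T \<le> t \<Longrightarrow> 0 < t"
  unfolding char_from_def by auto

lemma char_foot_mono:
  assumes "char_from T X" "T \<le> s" "s \<le> t"
  shows "foot_l (X t) t \<le> foot_l (X s) s" "foot_r (X s) s \<le> foot_r (X t) t"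
proof -
  have "foot_l (X t) t \<le> foot_l (X s) s \<and> foot_r (X s) s \<le> foot_r (X t) t"
  proof (cases "s = t")
    case False
    have *: "0 < T" "\<And>s t \<tau>. T \<le> s \<Longrightarrow> s < t \<Longrightarrow> 0 \<le> \<tau> \<Longrightarrow> \<tau> \<le> s \<Longrightarrow>
     X t + (\<tau> - t) * f' (Sup (M (X t) t)) \<le> X s + (\<tau> - s) * f' (Sup (M (X s) s)) \<and>
     X s + (\<tau> - s) * f' (Inf (M (X s) s)) \<le> X t + (\<tau> - t) * f' (Inf (M (X t) t))"
      using assms(1) unfolding char_from_def by blast+
    show ?thesis using *(2)[of s t 0] *(1) assms False unfolding foot_l_def foot_r_def by auto
  qed auto
  then show "foot_l (X t) t \<le> foot_l (X s) s" "foot_r (X s) s \<le> foot_r (X t) t" by auto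
qed

lemma char_limit_supports:
  assumes X: "char_from T X" and u: "\<And>t. T \<le> t \<Longrightarrow> u t \<in> M (X t) t"
    and lim: "((\<lambda>t. X t - t * f' (u t)) \<longlongrightarrow> Y) at_top"
  shows "\<exists>c. supp c Y"
proof (rule foot_limit_supports_ex)
  have tn: "filterlim (\<lambda>n. T + real n) at_top sequentially"
    by (rule filterlim_tendsto_add_at_top[OF tendsto_const filterlim_real_sequentially])
  then show "filterlim (\<lambda>n. T + real n) at_top sequentially" .
  show "(\<lambda>n. X (T + real n) - (T + real n) * f' (u (T + real n))) \<longlonglongrightarrow> Y"
    using filterlim_compose[OF lim tn] .
  show "u (T + real n) \<in> M (X (T + real n)) (T + real n)" "0 < T + real n" for n
    using u char_from_pos[OF X] by auto
qed

lemma foot_l_limit: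
  assumes X: "char_from T X" and m: "\<And>t. T \<le> t \<Longrightarrow> m \<le> foot_l (X t) t"
  obtains Y c where "supp c Y" "((\<lambda>t. foot_l (X t) t) \<longlongrightarrow> Y) at_top" "\<And>t. T \<le> t \<Longrightarrow> Y \<le> foot_l (X t) t"
proof -
  obtain Y where Y: "((\<lambda>t. foot_l (X t) t) \<longlongrightarrow> Y) at_top" "\<And>t. T \<le> t \<Longrightarrow> Y \<le> foot_l (X t) t"
    by (rule antimono_limit[of T "\<lambda>t. foot_l (X t) t" m]) (auto intro: char_foot_mono(1)[OF X] m)
  have "\<exists>c. supp c Y"
    by (rule char_limit_supports[OF X Inf_minimizers(2) Y(1)[unfolded foot_l_def]]) (rule char_from_pos[OF X])
  then show ?thesis by (elim exE) (rule that[OF _ Y])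
qed

lemma foot_r_limit:
  assumes X: "char_from T X" and m: "\<And>t. T \<le> t \<Longrightarrow> foot_r (X t) t \<le> m"
  obtains Y c where "supp c Y" "((\<lambda>t. foot_r (X t) t) \<longlongrightarrow> Y) at_top" "\<And>t. T \<le> t \<Longrightarrow> foot_r (X t) t \<le> Y"
proof -
  obtain Y where Y: "((\<lambda>t. - foot_r (X t) t) \<longlongrightarrow> Y) at_top" "\<And>t. T \<le> t \<Longrightarrow> Y \<le> - foot_r (X t) t"
    by (rule antimono_limit[of T "\<lambda>t. - foot_r (X t) t" "- m"]) (auto intro: char_foot_mono(2)[OF X] m)
  have lim: "((\<lambda>t. foot_r (X t) t) \<longlongrightarrow> - Y) at_top" using tendsto_minus[OF Y(1)] by simp
  have "\<exists>c. supp c (- Y)"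
    by (rule char_limit_supports[OF X Inf_minimizers(1) lim[unfolded foot_r_def]]) (rule char_from_pos[OF X])
  then show ?thesis by (elim exE) (rule that[OF _ lim], use Y(2) in \<open>auto simp: le_minus_iff\<close>)
qed

text \<open>Cones with a single foot are segments, and nested segments issuing from the same foot
  lie on one ray. So the curve is that ray, with a constant state, and the limit of feet makes the
  state a supporting slope. This case is what has to be excluded when feet might converge to the
  wrong end of a gap.\<close>

lemma char_degenerate:
  assumes X: "char_from T X" and z: "\<And>t. T \<le> t \<Longrightarrow> foot_l (X t) t = z" "\<And>t. T \<le> t \<Longrightarrow> foot_r (X t) t = z"
  shows "\<exists>v. supp v z \<and> (\<forall>t\<ge>T. X t = z + t * f' v)"
proof -
  have T: "0 < T" using X unfolding char_from_def by simp
  define v where "v = Sup (M (X T) T)"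
  have S: "X t = z + t * f' (Sup (M (X t) t))" and I: "X t = z + t * f' (Inf (M (X t) t))" if "T \<le> t" for t
    using z[OF that] unfolding foot_l_def foot_r_def by auto
  have eq: "Sup (M (X t) t) = v" if "T \<le> t" for t
  proof (cases "t = T")
    case False
    define S' where "S' r = f' (Sup (M (X r) r))" for r
    have IS: "f' (Inf (M (X r) r)) = S' r" if "T \<le> r" for r
    proof -
      have "r * f' (Inf (M (X r) r)) = r * f' (Sup (M (X r) r))" using S[OF that] I[OF that] by linarith
      then show ?thesis using that T unfolding S'_def by simp
    qed
    \<comment> \<open>Nestedness at \<open>\<tau> = T\<close> puts \<open>X T\<close> between the
      two edges of the cone of \<open>(X t, t)\<close>, and these coincide by
      \<open>IS\<close>.\<close>
    have "X t + (T - t) * S' t \<le> X T + (T - T) * S' T \<and> X T + (T - T) * f' (Inf (M (X T) T)) \<le> X t + (T - t) * f' (Inf (M (X t) t))"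
      using X that False T unfolding char_from_def S'_def by (metis less_eq_real_def order_refl)
    then have "X t + (T - t) * S' t = X T" using IS[OF that] by simp
    moreover have "X t = z + t * S' t" "X T = z + T * S' T" using S that unfolding S'_def by auto
    ultimately have "T * S' t = T * S' T" by (simp add: algebra_simps)
    then show ?thesis using T f'_eq unfolding S'_def v_def by simp
  qed (simp add: v_def)
  have "supp v z"
  proof (rule foot_limit_supports)
    show "v \<in> M (X (T + real n)) (T + real n)" for n
      using eq[of "T + real n"] Inf_minimizers(2)[of "T + real n" "X (T + real n)"] T by auto
    show "filterlim (\<lambda>n. T + real n) at_top sequentially"
      by (rule filterlim_tendsto_add_at_top[OF tendsto_const filterlim_real_sequentially])
    have "X (T + real n) - (T + real n) * f' v = z" for n
      using S[of "T + real n"] eq[of "T + real n"] by auto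
    then show "(\<lambda>n. X (T + real n) - (T + real n) * f' v) \<longlonglongrightarrow> z" by simp
  qed (use T in auto)
  with S eq show ?thesis by metis
qed

lemma foot_l_le_foot_r: "t > 0 \<Longrightarrow> foot_l x t \<le> foot_r x t"
  using foot_bounds[OF _ Inf_minimizers(1)] by (meson order_trans)

text \<open>If one curve were to the left of the other, its right foot would not exceed the left
  foot of the other, which contradicts that \<open>m\<close> lies strictly inside both foot
  intervals.\<close>

lemma char_eventually_eq:
  assumes "\<forall>\<^sub>F t in at_top. foot_l (X t) t < m" "\<forall>\<^sub>F t in at_top. m < foot_r (X t) t"
    and "\<forall>\<^sub>F t in at_top. foot_l (X' t) t < m" "\<forall>\<^sub>F t in at_top. m < foot_r (X' t) t"
  shows "\<forall>\<^sub>F t in at_top. X t = X' t"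
  using assms eventually_gt_at_top[of 0]
proof eventually_elim
  case (elim t)
  have *: "foot_r x t \<le> foot_l x' t" if "x < x'" for x x'
    using foot_mono[OF elim(5) Inf_minimizers(1)[OF elim(5)] Inf_minimizers(2)[OF elim(5)] that]
    unfolding foot_l_def foot_r_def .
  show ?case using *[of "X t" "X' t"] *[of "X' t" "X t"] elim by linarith
qed

text \<open>The divides at both ends confine the feet to \<open>{e..h}\<close>, and their limits are
  contact points, hence \<open>e\<close> or \<open>h\<close>. If the left feet tended to
  \<open>h\<close>, the foot interval would always be the point \<open>h\<close> and the curve a ray
  from \<open>h\<close> with a supporting slope at least \<open>c\<close>, which does not enter the
  gap region. The other end is symmetric.\<close>

lemma gap_feet:
  assumes X: "char_from T X"
    and e: "supp c e" and h: "supp c h" and no: "\<And>y d. e < y \<Longrightarrow> y < h \<Longrightarrow> \<not> supp d y"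
    and reg: "\<And>t. T \<le> t \<Longrightarrow> e + t * f' c < X t \<and> X t < h + t * f' c"
  shows "((\<lambda>t. foot_l (X t) t) \<longlongrightarrow> e) at_top" "((\<lambda>t. foot_r (X t) t) \<longlongrightarrow> h) at_top"
proof -
  have T: "0 < t" if "T \<le> t" for t using char_from_pos[OF X that] .
  have feet: "e \<le> foot_l (X t) t" "foot_l (X t) t \<le> foot_r (X t) t" "foot_r (X t) t \<le> h" if "T \<le> t" for t
    using feet_right_of_supports[OF T[OF that] e _ Inf_minimizers(2)[OF T[OF that]]]
      feet_left_of_supports[OF T[OF that] h _ Inf_minimizers(1)[OF T[OF that]]] reg[OF that]
      foot_l_le_foot_r[OF T[OF that]]
    unfolding foot_l_def foot_r_def by auto
  have lt: "0 < h - e" using reg[of T] by simp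
  obtain Y d where Y: "supp d Y" "((\<lambda>t. foot_l (X t) t) \<longlongrightarrow> Y) at_top" "\<And>t. T \<le> t \<Longrightarrow> Y \<le> foot_l (X t) t"
    using foot_l_limit[OF X feet(1)] by blast
  obtain Z d' where Z: "supp d' Z" "((\<lambda>t. foot_r (X t) t) \<longlongrightarrow> Z) at_top" "\<And>t. T \<le> t \<Longrightarrow> foot_r (X t) t \<le> Z"
    using foot_r_limit[OF X feet(3)] by blast
  have "e \<le> Y" using feet(1) by (intro tendsto_lowerbound[OF Y(2)]) (auto simp: eventually_at_top_linorder)
  have "Z \<le> h" using feet(3) by (intro tendsto_upperbound[OF Z(2)]) (auto simp: eventually_at_top_linorder)
  have "Y \<le> h" using Y(3)[of T] feet[of T] by simp
  have "e \<le> Z" using Z(3)[of T] feet[of T] by simp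
  have "Y = e"
  proof (rule ccontr)
    assume "Y \<noteq> e"
    then have "Y = h" using no[of Y] Y(1) \<open>e \<le> Y\<close> \<open>Y \<le> h\<close> by force
    have deg: "foot_l (X t) t = h" "foot_r (X t) t = h" if "T \<le> t" for t
      using Y(3)[OF that] feet[OF that] \<open>Y = h\<close> by auto
    obtain v where v: "supp v h" "\<forall>t\<ge>T. X t = h + t * f' v"
      using char_degenerate[OF X deg] by blast
    have "F h + v * (e - h) \<le> F e" "F e + c * (h - e) \<le> F h" using v e unfolding supports_def by auto
    then have "0 \<le> (v - c) * (h - e)" by (simp add: algebra_simps)
    then have "c \<le> v" using lt by (simp add: zero_le_mult_iff)
    then show False using v(2)[rule_format, of T] reg[of T] T[of T] f'_le[of c v] by simp
  qed
  with Y show "((\<lambda>t. foot_l (X t) t) \<longlongrightarrow> e) at_top" by simp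
  have "Z = h"
  proof (rule ccontr)
    assume "Z \<noteq> h"
    then have "Z = e" using no[of Z] Z(1) \<open>e \<le> Z\<close> \<open>Z \<le> h\<close> by force
    have deg: "foot_l (X t) t = e" "foot_r (X t) t = e" if "T \<le> t" for t
      using Z(3)[OF that] feet[OF that] \<open>Z = e\<close> by auto
    obtain v where v: "supp v e" "\<forall>t\<ge>T. X t = e + t * f' v"
      using char_degenerate[OF X deg] by blast
    have "F e + v * (h - e) \<le> F h" "F h + c * (e - h) \<le> F e" using v h unfolding supports_def by auto
    then have "0 \<le> (c - v) * (h - e)" by (simp add: algebra_simps)
    then have "v \<le> c" using lt by (simp add: zero_le_mult_iff)
    then show False using v(2)[rule_format, of T] reg[of T] T[of T] f'_le[of v c] by simp
  qed
  with Z show "((\<lambda>t. foot_r (X t) t) \<longlongrightarrow> h) at_top" by simp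
qed

end

text \<open>\<open>a\<close> plays the role of the supremum of the contact set and \<open>c\<close> that of the limiting slope of \<open>F\<close>.\<close>
locale hopf_lax_right = hopf_lax +
  fixes c a :: real
  assumes supp_a: "supports F c a" and no_supp: "\<And>y d. a < y \<Longrightarrow> \<not> supports F d y"
    and max_slope: "\<And>v. supports F v a \<Longrightarrow> v \<le> c"
begin

definition char_right where
  "char_right T X \<longleftrightarrow> char_from T X \<and> (\<forall>t\<ge>T. a + t * f' c < X t)"

lemma char_right_mono: "char_right T X \<Longrightarrow> T \<le> t \<Longrightarrow> a \<le> foot_l (X t) t"
  using feet_right_of_supports[OF char_from_pos supp_a _ Inf_minimizers(2)[OF char_from_pos]]
  unfolding char_right_def foot_l_def by blast

text \<open>If the right feet stayed bounded, they would converge to a contact point, hence all feet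
  would equal \<open>a\<close>. The curve would then be a ray from \<open>a\<close> with slope at
  most \<open>c\<close>, which does not enter the region.\<close>

lemma right_feet:
  assumes X: "char_right T X"
  shows "((\<lambda>t. foot_l (X t) t) \<longlongrightarrow> a) at_top" "\<forall>\<^sub>F t in at_top. Z < foot_r (X t) t"
proof -
  have X': "char_from T X" using X unfolding char_right_def by simp
  have reg: "a + t * f' c < X t" if "T \<le> t" for t using X that unfolding char_right_def by simp
  have T: "0 < t" if "T \<le> t" for t using char_from_pos[OF X' that] .
  obtain Y d where Y: "supp d Y" "((\<lambda>t. foot_l (X t) t) \<longlongrightarrow> Y) at_top" "\<And>t. T \<le> t \<Longrightarrow> Y \<le> foot_l (X t) t"
    using foot_l_limit[OF X' char_right_mono[OF X]] by blast
  have "a \<le> Y" using char_right_mono[OF X] by (intro tendsto_lowerbound[OF Y(2)]) (auto simp: eventually_at_top_linorder)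
  with Y no_supp[of Y] have "Y = a" by force
  with Y show "((\<lambda>t. foot_l (X t) t) \<longlongrightarrow> a) at_top" by simp
  have "\<exists>s\<ge>T. Z < foot_r (X s) s"
  proof (rule ccontr)
    assume "\<not> ?thesis"
    then have le: "foot_r (X t) t \<le> Z" if "T \<le> t" for t using that by force
    obtain Y d where Y: "supp d Y" "\<And>t. T \<le> t \<Longrightarrow> foot_r (X t) t \<le> Y"
      using foot_r_limit[OF X' le] by blast
    then have "Y \<le> a" using no_supp[of Y] by force
    have deg: "foot_l (X t) t = a" "foot_r (X t) t = a" if "T \<le> t" for t
      using Y(2)[OF that] \<open>Y \<le> a\<close> char_right_mono[OF X that] foot_l_le_foot_r[OF T[OF that], of "X t"] by auto
    obtain v where v: "supp v a" "\<forall>t\<ge>T. X t = a + t * f' v"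
      using char_degenerate[OF X' deg] by blast
    then show False using max_slope[OF v(1)] f'_le[of v c] v(2)[rule_format, of T] reg[of T] T[of T] by simp
  qed
  then obtain s where s: "T \<le> s" "Z < foot_r (X s) s" by blast
  show "\<forall>\<^sub>F t in at_top. Z < foot_r (X t) t"
    using eventually_ge_at_top[of s]
  proof eventually_elim
    case (elim t)
    then show ?case using s char_foot_mono(2)[OF X' s(1) elim] by simp
  qed
qed

lemma right_char_unique:
  assumes "char_right T X" "char_right T' X'"
  shows "\<forall>\<^sub>F t in at_top. X t = X' t"
  by (rule char_eventually_eq[where m = "a + 1"])
     (auto intro: order_tendstoD right_feet[OF assms(1)] right_feet[OF assms(2)])

lemma right_feet_close:
  assumes X: "char_right T X" and "\<eta> > 0"
  shows "\<forall>\<^sub>F t in at_top. \<forall>x. a + t * f' c < x \<and> x < X t \<longrightarrow> (\<forall>u\<in>M x t. a \<le> x - t * f' u \<and> x - t * f' u \<le> a + \<eta>)"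
proof -
  have "\<forall>\<^sub>F t in at_top. foot_l (X t) t < a + \<eta>"
    using right_feet(1)[OF X] assms by (intro order_tendstoD(2)) auto
  then show ?thesis using eventually_gt_at_top[of 0]
  proof eventually_elim
    case (elim t)
    show ?case
    proof (intro allI impI ballI conjI)
      fix x u assume x: "a + t * f' c < x \<and> x < X t" and u: "u \<in> M x t"
      show "a \<le> x - t * f' u" using feet_right_of_supports[OF elim(2) supp_a _ u] x by simp
      show "x - t * f' u \<le> a + \<eta>"
        using foot_mono[OF elim(2) u Inf_minimizers(2)[OF elim(2)], of "X t"] x elim(1)
        unfolding foot_l_def by simp
    qed
  qed
qed

text \<open>Equals \<open>f c - f v - f' v * (c - v)\<close>. Written through the conjugate it
  combines directly with the Lax functional.\<close>

definition breg where "breg v = leg v - leg c - c * (f' v - f' c)"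

text \<open>Two tangent inequalities are chained through the midpoint \<open>m\<close>; the gain is
  the difference of the tangent slopes, \<open>m - c\<close>, times the speed gained after
  \<open>m\<close>.\<close>

lemma breg_mono_bound:
  assumes "0 < \<delta>"
  obtains \<kappa> where "0 < \<kappa>" "\<And>v. c + \<delta> \<le> v \<Longrightarrow> \<kappa> \<le> breg v"
proof
  define m where "m = c + \<delta> / 2"
  define \<kappa> where "\<kappa> = \<delta> / 2 * (f' (c + \<delta>) - f' m)"
  show "0 < \<kappa>" using assms f'_less[of m "c + \<delta>"] unfolding \<kappa>_def m_def by auto
  fix v assume v: "c + \<delta> \<le> v"
  have "m * (f' v - f' m) \<le> leg v - leg m" "c * (f' m - f' c) \<le> leg m - leg c"
    by (rule legendre_ineq')+
  then have "(m - c) * (f' v - f' m) \<le> breg v" unfolding breg_def by (simp add: algebra_simps)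
  moreover have "\<kappa> \<le> \<delta> / 2 * (f' v - f' m)"
    using f'_le[of "c + \<delta>" v] v assms unfolding \<kappa>_def by (intro mult_left_mono) auto
  ultimately show "\<kappa> \<le> breg v" unfolding m_def by simp
qed

text \<open>The competitor is \<open>c\<close>, whose foot is \<open>x - t * f' c\<close>. At the
  foot of the minimizer \<open>F\<close> is replaced by its supporting line at \<open>a\<close>, and
  the linear terms combine with the Legendre terms to \<open>breg u\<close>.\<close>

lemma right_energy:
  assumes "t > 0" "a + t * f' c < x" "u \<in> M x t"
  shows "t * breg u \<le> F (x - t * f' c) - F a - c * (x - t * f' c - a)"
proof -
  define \<xi> where "\<xi> = x - t * f' c"
  define y where "y = x - t * f' u"
  have "F y + t * leg u \<le> F \<xi> + t * leg c"
    using minimizersD[OF assms(3), of c] unfolding lax_def \<xi>_def y_def .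
  moreover have "F a + c * (y - a) \<le> F y" using supp_a unfolding supports_def by simp
  moreover have "t * (c * (f' u - f' c)) = c * (\<xi> - y)" unfolding \<xi>_def y_def by (simp add: algebra_simps)
  ultimately have "t * breg u \<le> F \<xi> - F a - c * (\<xi> - a)"
    unfolding breg_def by (simp add: algebra_simps)
  then show ?thesis unfolding \<xi>_def .
qed

end

text \<open>Leaving \<epsilon> free lets one bound serve twice: a fixed small \<epsilon> says that
  \<open>F x - c * x\<close> is sublinear up to a constant, and an \<epsilon> depending on
  \<open>x\<close> gives the power of \<open>x\<close>.\<close>

locale hopf_lax_growth = hopf_lax_right +
  fixes p K :: real
  assumes p: "1 \<le> p" and K: "0 \<le> K"
    and growth: "\<And>\<epsilon> x. \<epsilon> > 0 \<Longrightarrow> 0 \<le> x \<Longrightarrow> \<bar>F x - c * x\<bar> \<le> \<epsilon> * x + K * \<epsilon> powr (1 - p)"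
begin

text \<open>A state above \<open>c + \<delta>\<close> costs at least \<open>\<kappa> * t\<close>,
  while \<xi> grows at most linearly in \<open>t\<close> and the datum provides only an arbitrarily
  small multiple of \<xi>.\<close>

lemma right_speed:
  assumes X: "char_right T X" and \<delta>: "0 < \<delta>"
  shows "\<forall>\<^sub>F t in at_top. Sup (M (X t) t) < c + \<delta>"
proof -
  have X': "char_from T X" and reg: "\<And>t. T \<le> t \<Longrightarrow> a + t * f' c < X t"
    using X unfolding char_right_def by auto
  obtain \<kappa> where \<kappa>: "0 < \<kappa>" "\<And>v. c + \<delta> \<le> v \<Longrightarrow> \<kappa> \<le> breg v" using breg_mono_bound[OF \<delta>] by blast
  \<comment> \<open>\<open>R\<close> bounds the excess speed of every minimizer, since minimizers
    are at most \<open>B\<close>; \<epsilon> is then fitted so that the linear error consumes only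
    half of \<open>\<kappa> * t\<close>.\<close>
  define R where "R = \<bar>f' B - f' c\<bar> + 1"
  define \<epsilon> where "\<epsilon> = \<kappa> / (2 * R)"
  define y0 where "y0 = foot_l (X T) T"
  define C where "C = K * \<epsilon> powr (1 - p) + \<bar>F a - c * a\<bar> + \<epsilon> * \<bar>y0\<bar>"
  define r where "r = f' (c + \<delta>) - f' c"
  have "R > 0" unfolding R_def by simp
  then have "\<epsilon> > 0" unfolding \<epsilon>_def using \<kappa> by simp
  have \<epsilon>R: "\<epsilon> * R = \<kappa> / 2" using \<open>R > 0\<close> unfolding \<epsilon>_def by simp
  have "r > 0" using \<delta> f'_less unfolding r_def by simp
  show ?thesis
    using eventually_ge_at_top[of T] eventually_gt_at_top[of "2 * C / \<kappa>"] eventually_gt_at_top[of "\<bar>a\<bar> / r"]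
  proof eventually_elim
    case (elim t)
    define v where "v = Sup (M (X t) t)"
    define \<xi> where "\<xi> = X t - t * f' c"
    have t: "t > 0" using char_from_pos[OF X' elim(1)] .
    have v: "v \<in> M (X t) t" unfolding v_def by (rule Inf_minimizers(2)[OF t])
    have y: "a \<le> X t - t * f' v" "X t - t * f' v \<le> y0"
      using char_right_mono[OF X elim(1)] char_foot_mono(1)[OF X' _ elim(1)]
      unfolding y0_def v_def foot_l_def by auto
    show "Sup (M (X t) t) < c + \<delta>"
    proof (rule ccontr)
      assume "\<not> ?thesis"
      then have cv: "c + \<delta> \<le> v" unfolding v_def by simp
      have \<xi>: "\<xi> = X t - t * f' v + t * (f' v - f' c)" unfolding \<xi>_def by (simp add: algebra_simps)
      have "t * r \<le> t * (f' v - f' c)" using t cv f'_le unfolding r_def by simp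
      moreover have "\<bar>a\<bar> \<le> t * r" using elim(3) \<open>r > 0\<close> by (simp add: pos_divide_less_eq)
      ultimately have "0 \<le> \<xi>" unfolding \<xi> using y by linarith
      have "f' v - f' c \<le> R" using minimizers_bounded(2)[OF t v] f'_le[of v B] unfolding R_def by linarith
      then have "\<xi> \<le> \<bar>y0\<bar> + t * R" unfolding \<xi> using y t by (intro add_mono mult_left_mono) auto
      then have "\<epsilon> * \<xi> \<le> \<epsilon> * \<bar>y0\<bar> + t * (\<epsilon> * R)"
        using mult_left_mono[of \<xi> "\<bar>y0\<bar> + t * R" \<epsilon>] \<open>\<epsilon> > 0\<close> by (simp add: algebra_simps)
      moreover have "t * \<kappa> \<le> t * breg v" using \<kappa>(2)[OF cv] t by simp
      moreover have "t * breg v \<le> F \<xi> - F a - c * (\<xi> - a)"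
        using right_energy[OF t reg[OF elim(1)] v] unfolding \<xi>_def .
      moreover have "\<bar>F \<xi> - c * \<xi>\<bar> \<le> \<epsilon> * \<xi> + K * \<epsilon> powr (1 - p)" using growth[OF \<open>\<epsilon> > 0\<close> \<open>0 \<le> \<xi>\<close>] .
      ultimately have "t * \<kappa> \<le> t * (\<kappa> / 2) + C"
        unfolding \<epsilon>R C_def by (simp add: algebra_simps abs_le_iff) (smt (verit) abs_ge_self abs_ge_minus_self)
      then have "t * \<kappa> \<le> 2 * C" by simp
      then show False using elim(2) \<kappa>(1) by (simp add: pos_divide_less_eq)
    qed
  qed
qed

text \<open>Suppose a foot \<open>y\<close> lies to the right of \<open>a\<close>. The competitor
  with foot \<open>a\<close> is a state \<open>w\<close> below \<open>c + \<eta>\<close>, because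
  the left edge at \<open>X t\<close> is already slower than \<open>f' (c + \<eta> / 2)\<close>.
  Comparison with \<open>w\<close> contradicts the steepness of \<open>F\<close> to the right of
  \<open>a\<close>.\<close>

lemma right_feet_exact:
  assumes X: "char_right T X" and "\<eta> > 0" "\<delta> > 0"
    and steep: "\<And>y. a < y \<Longrightarrow> y < a + \<delta> \<Longrightarrow> F a + (c + \<eta>) * (y - a) \<le> F y"
  shows "\<forall>\<^sub>F t in at_top. \<forall>x. a + t * f' c < x \<and> x < X t \<longrightarrow> (\<forall>u\<in>M x t. x - t * f' u = a)"
proof -
  have X': "char_from T X" using X unfolding char_right_def by auto
  define y0 where "y0 = foot_l (X T) T"
  \<comment> \<open>The spare speed \<open>r\<close> absorbs the bounded offset
    \<open>y0 - a\<close> once \<open>t > (y0 - a) / r\<close>.\<close>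
  define r where "r = f' (c + \<eta>) - f' (c + \<eta> / 2)"
  have "r > 0" using \<open>\<eta> > 0\<close> f'_less unfolding r_def by simp
  have "\<forall>\<^sub>F t in at_top. Sup (M (X t) t) < c + \<eta> / 2" using right_speed[OF X, of "\<eta> / 2"] assms by simp
  moreover have "\<forall>\<^sub>F t in at_top. \<forall>x. a + t * f' c < x \<and> x < X t \<longrightarrow> (\<forall>u\<in>M x t. a \<le> x - t * f' u \<and> x - t * f' u \<le> a + \<delta> / 2)"
    using right_feet_close[OF X, of "\<delta> / 2"] assms by simp
  ultimately show ?thesis
    using eventually_ge_at_top[of T] eventually_gt_at_top[of "(y0 - a) / r"]
  proof eventually_elim
    case (elim t)
    have t: "t > 0" using char_from_pos[OF X' elim(3)] .
    show ?case
    proof (intro allI impI ballI)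
      fix x u assume x: "a + t * f' c < x \<and> x < X t" and u: "u \<in> M x t"
      define y where "y = x - t * f' u"
      have y: "a \<le> y" "y \<le> a + \<delta> / 2" using elim(2) x u unfolding y_def by auto
      show "x - t * f' u = a"
      proof (rule ccontr)
        assume "x - t * f' u \<noteq> a"
        then have "a < y" using y unfolding y_def by simp
        have xa: "f' u + (y - a) / t = (x - a) / t" using t unfolding y_def by (simp add: field_simps)
        have "X t - t * f' (Sup (M (X t) t)) \<le> y0"
          using char_foot_mono(1)[OF X' _ elim(3)] unfolding y0_def foot_l_def by auto
        moreover have "t * f' (Sup (M (X t) t)) \<le> t * f' (c + \<eta> / 2)"
          using elim(1) t f'_le by (intro mult_left_mono) auto
        moreover have "y0 - a < t * r" using elim(4) \<open>r > 0\<close> by (simp add: pos_divide_less_eq)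
        ultimately have "x - a < t * f' (c + \<eta>)" using x unfolding r_def by (simp add: algebra_simps)
        then have "(x - a) / t < f' (c + \<eta>)" using t by (simp add: pos_divide_less_eq mult.commute)
        moreover have "f' u \<le> (x - a) / t" using y t unfolding xa[symmetric] by simp
        ultimately obtain w where w: "f' w = (x - a) / t" by (meson f'_ivt less_imp_le)
        then have "w < c + \<eta>" using \<open>(x - a) / t < f' (c + \<eta>)\<close> f'_less by metis
        have "F y \<le> F a + w * (y - a)"
          unfolding y_def by (rule minimizers_competitor(2)[OF u t]) (use w xa in \<open>simp add: y_def\<close>)
        also have "\<dots> < F a + (c + \<eta>) * (y - a)" using \<open>w < c + \<eta>\<close> \<open>a < y\<close> by simp
        also have "\<dots> \<le> F y" using steep[of y] \<open>a < y\<close> y \<open>\<delta> > 0\<close> by simp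
        finally show False by simp
      qed
    qed
  qed
qed

end

section \<open>Width of the right unbounded region\<close>

text \<open>After taking logarithms the inequality is linear in \<open>ln \<xi>\<close>, with the
  coefficient \<open>\<beta> - 1 + 1 / p\<close>, of which \<sigma> is the reciprocal. The exponent
  \<beta> is that of the Bregman distance as a power of the excess speed.\<close>

lemma power_balance:
  fixes \<xi> t A \<kappa> C \<alpha> p :: real
  assumes pos: "\<xi> > 0" "t > 0" "A > 0" "\<kappa> > 0" "C > 0" and \<alpha>: "0 \<le> \<alpha>" and p: "1 \<le> p"
    and le: "t * (\<kappa> * (\<xi> / (A * t)) powr ((2 + \<alpha>) / (1 + \<alpha>))) \<le> C * \<xi> powr (1 - 1 / p)"
  shows "\<xi> \<le> (C / \<kappa> * A powr ((2 + \<alpha>) / (1 + \<alpha>))) powr (p * (1 + \<alpha>) / (p + 1 + \<alpha>)) * t powr (p / (p + 1 + \<alpha>))"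
proof -
  define \<beta> where "\<beta> = (2 + \<alpha>) / (1 + \<alpha>)"
  define \<sigma> where "\<sigma> = p * (1 + \<alpha>) / (p + 1 + \<alpha>)"
  have "\<sigma> \<ge> 0" unfolding \<sigma>_def using \<alpha> p by simp
  have \<sigma>1: "\<sigma> * (\<beta> - 1) = p / (p + 1 + \<alpha>)"
  proof -
    have "\<beta> - 1 = 1 / (1 + \<alpha>)" unfolding \<beta>_def using \<alpha> by (simp add: field_simps)
    then show ?thesis unfolding \<sigma>_def using \<alpha> by simp
  qed
  have \<sigma>2: "\<sigma> * (\<beta> - 1 + 1 / p) = 1"
  proof -
    have "\<sigma> * (1 / p) = (1 + \<alpha>) / (p + 1 + \<alpha>)" unfolding \<sigma>_def using p by simp
    then have "\<sigma> * (\<beta> - 1 + 1 / p) = (p + (1 + \<alpha>)) / (p + 1 + \<alpha>)"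
      unfolding distrib_left \<sigma>1 by (simp add: add_divide_distrib)
    also have "\<dots> = 1" using \<alpha> p by simp
    finally show ?thesis .
  qed
  have "ln (t * (\<kappa> * (\<xi> / (A * t)) powr \<beta>)) \<le> ln (C * \<xi> powr (1 - 1 / p))"
    using le pos unfolding \<beta>_def by (subst ln_le_cancel_iff) auto
  moreover have "ln (t * (\<kappa> * (\<xi> / (A * t)) powr \<beta>)) = ln t + (ln \<kappa> + \<beta> * (ln \<xi> - (ln A + ln t)))"
    using pos by (simp add: ln_mult ln_div ln_powr)
  moreover have "ln (C * \<xi> powr (1 - 1 / p)) = ln C + (1 - 1 / p) * ln \<xi>"
    using pos by (simp add: ln_mult ln_powr)
  ultimately have "(\<beta> - 1 + 1 / p) * ln \<xi> \<le> ln C - ln \<kappa> + \<beta> * ln A + (\<beta> - 1) * ln t"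
    by (simp add: algebra_simps)
  then have "\<sigma> * ((\<beta> - 1 + 1 / p) * ln \<xi>) \<le> \<sigma> * (ln C - ln \<kappa> + \<beta> * ln A + (\<beta> - 1) * ln t)"
    using \<open>\<sigma> \<ge> 0\<close> by (rule mult_left_mono)
  then have "ln \<xi> \<le> \<sigma> * (ln C - ln \<kappa> + \<beta> * ln A) + p / (p + 1 + \<alpha>) * ln t"
    unfolding mult.assoc[symmetric] \<sigma>2 distrib_left[of \<sigma> _ "(\<beta> - 1) * ln t"] \<sigma>1 by simp
  also have "\<dots> = ln ((C / \<kappa> * A powr \<beta>) powr \<sigma> * t powr (p / (p + 1 + \<alpha>)))"
    using pos by (simp add: ln_mult ln_div ln_powr)
  finally show ?thesis using pos unfolding \<beta>_def \<sigma>_def by (subst (asm) ln_le_cancel_iff) auto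
qed

context hopf_lax_right
begin

text \<open>Near \<open>c\<close> the second derivative lies between \<open>N / 2\<close> and
  \<open>2 * N\<close> times \<open>(u - c) powr \<alpha>\<close>. Both bounds follow by
  integration; the derivative of \<open>breg\<close> is \<open>(u - c) * f'' u\<close>.\<close>

lemma degenerate_bounds:
  assumes f'': "\<And>x. (f' has_real_derivative f'' x) (at x)" and \<alpha>: "0 \<le> \<alpha>" and N: "0 < N"
    and lim: "((\<lambda>u. f'' u / \<bar>u - c\<bar> powr \<alpha>) \<longlongrightarrow> N) (at_right c)"
  obtains \<delta> where "0 < \<delta>"
    "\<And>v. c < v \<Longrightarrow> v < c + \<delta> \<Longrightarrow> f' v - f' c \<le> 2 * N * (v - c) powr (1 + \<alpha>)"
    "\<And>v. c < v \<Longrightarrow> v < c + \<delta> \<Longrightarrow> N / (2 * (2 + \<alpha>)) * (v - c) powr (2 + \<alpha>) \<le> breg v"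
proof -
  have "\<forall>\<^sub>F u in at_right c. N / 2 < f'' u / \<bar>u - c\<bar> powr \<alpha> \<and> f'' u / \<bar>u - c\<bar> powr \<alpha> < 2 * N"
    using order_tendstoD(1)[OF lim, of "N / 2"] order_tendstoD(2)[OF lim, of "2 * N"] N
    by (auto intro: eventually_conj)
  then obtain b where b: "c < b" "\<And>u. c < u \<Longrightarrow> u < b \<Longrightarrow> N / 2 < f'' u / \<bar>u - c\<bar> powr \<alpha> \<and> f'' u / \<bar>u - c\<bar> powr \<alpha> < 2 * N"
    unfolding eventually_at_right_field by auto
  have bd: "N / 2 * (u - c) powr \<alpha> < f'' u" "f'' u < 2 * N * (u - c) powr \<alpha>" if "c < u" "u < b" for u
    using b(2)[OF that] that by (auto simp: pos_less_divide_eq pos_divide_less_eq)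
  have dpow: "((\<lambda>u. (u - c) powr r) has_real_derivative r * (u - c) powr (r - 1)) (at u)" if "c < u" for u r
    using that by (auto intro!: derivative_eq_intros)
  have cpow: "continuous_on {c..v} (\<lambda>u. (u - c) powr r)" if "r > 0" for r v
    using that by (intro continuous_on_powr' continuous_intros) auto
  have cf: "continuous_on {c..v} f'" for v using cont continuous_on_subset by blast
  have cff: "continuous_on {c..v} f" for v
    using deriv by (meson DERIV_continuous_on has_field_derivative_at_within)
  show ?thesis
  proof
    show "0 < b - c" using b by simp
    fix v assume v: "c < v" "v < c + (b - c)"
    define h where "h u = 2 * N / (1 + \<alpha>) * (u - c) powr (1 + \<alpha>) - f' u" for u
    have "h c < h v"
    proof (rule DERIV_pos_imp_increasing_open[OF v(1)])
      show "continuous_on {c..v} h" unfolding h_def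
        using \<alpha> by (intro continuous_intros cpow cf) auto
      fix u assume u: "c < u" "u < v"
      have "(h has_real_derivative 2 * N / (1 + \<alpha>) * ((1 + \<alpha>) * (u - c) powr (1 + \<alpha> - 1)) - f'' u) (at u)"
        unfolding h_def by (intro DERIV_diff DERIV_cmult dpow f'' u)
      moreover have "2 * N / (1 + \<alpha>) * ((1 + \<alpha>) * (u - c) powr (1 + \<alpha> - 1)) - f'' u > 0"
        using bd(2)[of u] u v \<alpha> by simp
      ultimately show "\<exists>y. (h has_real_derivative y) (at u) \<and> 0 < y" by blast
    qed
    then have "f' v - f' c \<le> 2 * N / (1 + \<alpha>) * (v - c) powr (1 + \<alpha>)" unfolding h_def using \<alpha> by simp
    also have "\<dots> \<le> 2 * N * (v - c) powr (1 + \<alpha>)"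
      using N \<alpha> by (intro mult_right_mono) (auto simp: divide_le_eq)
    finally show "f' v - f' c \<le> 2 * N * (v - c) powr (1 + \<alpha>)" .
    define g where "g u = breg u - N / (2 * (2 + \<alpha>)) * (u - c) powr (2 + \<alpha>)" for u
    have "g c < g v"
    proof (rule DERIV_pos_imp_increasing_open[OF v(1)])
      show "continuous_on {c..v} g" unfolding g_def breg_def legendre_def
        using \<alpha> by (intro continuous_intros cpow cf cff) auto
      fix u assume u: "c < u" "u < v"
      have "(breg has_real_derivative (u - c) * f'' u) (at u)"
        unfolding breg_def legendre_def
        by (auto intro!: derivative_eq_intros deriv f'' simp: algebra_simps)
      then have "(g has_real_derivative (u - c) * f'' u - N / (2 * (2 + \<alpha>)) * ((2 + \<alpha>) * (u - c) powr (2 + \<alpha> - 1))) (at u)"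
        unfolding g_def by (intro DERIV_diff DERIV_cmult dpow u) 
      moreover have "N / (2 * (2 + \<alpha>)) * ((2 + \<alpha>) * (u - c) powr (2 + \<alpha> - 1)) = (u - c) * (N / 2 * (u - c) powr \<alpha>)"
      proof -
        have "(u - c) powr (2 + \<alpha> - 1) = (u - c) * (u - c) powr \<alpha>"
          using u powr_add[of "u - c" 1 \<alpha>] by simp
        moreover have "N / (2 * (2 + \<alpha>)) * (2 + \<alpha>) = N / 2" using \<alpha> by (simp add: field_simps)
        ultimately show ?thesis by (metis mult.assoc mult.commute)
      qed
      moreover have "(u - c) * (N / 2 * (u - c) powr \<alpha>) < (u - c) * f'' u"
        using bd(1)[of u] u v by (intro mult_strict_left_mono) auto
      ultimately show "\<exists>y. (g has_real_derivative y) (at u) \<and> 0 < y"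
        by (metis diff_gt_0_iff_gt)
    qed
    then show "N / (2 * (2 + \<alpha>)) * (v - c) powr (2 + \<alpha>) \<le> breg v"
      unfolding g_def using \<alpha> by (simp add: breg_def)
  qed
qed

end

context hopf_lax_growth
begin

text \<open>The choice \<open>\<epsilon> = x powr (- 1 / p)\<close> makes both terms of the growth
  bound the same power of \<open>x\<close>.\<close>

lemma growth_power:
  assumes "1 \<le> x"
  shows "\<bar>F x - c * x\<bar> \<le> (1 + K) * x powr (1 - 1 / p)"
proof -
  have "\<bar>F x - c * x\<bar> \<le> x powr (- 1 / p) * x + K * (x powr (- 1 / p)) powr (1 - p)"
    using assms by (intro growth) auto
  also have "x powr (- 1 / p) * x = x powr (1 - 1 / p)"
    using powr_add[of x "- 1 / p" 1] assms by simp
  also have "(x powr (- 1 / p)) powr (1 - p) = x powr (1 - 1 / p)"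
  proof -
    have "(- 1 / p) * (1 - p) = 1 - 1 / p" using p by (simp add: field_simps)
    then show ?thesis by (simp add: powr_powr)
  qed
  finally show ?thesis by (simp add: algebra_simps)
qed

text \<open>For large \<xi> the state \<open>v\<close> at the left edge satisfies
  \<open>\<xi> / 2 \<le> t * (f' v - f' c)\<close>, hence
  \<open>\<xi> / (4 * N * t) \<le> (v - c) powr (1 + \<alpha>)\<close>. This bounds
  \<open>breg v\<close> from below, the energy estimate bounds it from above, and the two powers are
  balanced.\<close>

lemma right_width:
  assumes X: "char_right T X"
    and f'': "\<And>x. (f' has_real_derivative f'' x) (at x)" and \<alpha>: "0 \<le> \<alpha>" and N: "0 < N"
    and lim: "((\<lambda>u. f'' u / \<bar>u - c\<bar> powr \<alpha>) \<longlongrightarrow> N) (at_right c)"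
  shows "\<exists>C\<ge>0. \<forall>\<^sub>F t in at_top. X t - (a + t * f' c) \<le> C * t powr (p / (p + 1 + \<alpha>))"
proof -
  have X': "char_from T X" and reg: "\<And>t. T \<le> t \<Longrightarrow> a + t * f' c < X t"
    using X unfolding char_right_def by auto
  obtain \<delta> where \<delta>: "0 < \<delta>"
    "\<And>v. c < v \<Longrightarrow> v < c + \<delta> \<Longrightarrow> f' v - f' c \<le> 2 * N * (v - c) powr (1 + \<alpha>)"
    "\<And>v. c < v \<Longrightarrow> v < c + \<delta> \<Longrightarrow> N / (2 * (2 + \<alpha>)) * (v - c) powr (2 + \<alpha>) \<le> breg v"
    using degenerate_bounds[OF f'' \<alpha> N lim] by blast
  define y0 where "y0 = foot_l (X T) T"
  define \<kappa> where "\<kappa> = N / (2 * (2 + \<alpha>))"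
  define C1 where "C1 = 1 + K + \<bar>F a - c * a\<bar>"
  define \<beta> where "\<beta> = (2 + \<alpha>) / (1 + \<alpha>)"
  define C2 where "C2 = (C1 / \<kappa> * (4 * N) powr \<beta>) powr (p * (1 + \<alpha>) / (p + 1 + \<alpha>))"
  define C where "C = 2 * \<bar>y0\<bar> + 1 + \<bar>a\<bar> + C2"
  define e where "e = p / (p + 1 + \<alpha>)"
  have e: "0 \<le> e" unfolding e_def using p \<alpha> by simp
  have \<kappa>: "\<kappa> > 0" unfolding \<kappa>_def using N \<alpha> by simp
  have C1: "C1 > 0" unfolding C1_def using K by simp
  have C2: "C2 \<ge> 0" unfolding C2_def by simp
  have "\<forall>\<^sub>F t in at_top. X t - (a + t * f' c) \<le> C * t powr e"
    using eventually_ge_at_top[of T] eventually_ge_at_top[of 1] right_speed[OF X \<delta>(1)]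
  proof eventually_elim
    case (elim t)
    define v where "v = Sup (M (X t) t)"
    define \<xi> where "\<xi> = X t - t * f' c"
    have t: "t > 0" using char_from_pos[OF X' elim(1)] .
    have te: "1 \<le> t powr e" using elim(2) e by (simp add: ge_one_powr_ge_zero)
    have v: "v \<in> M (X t) t" unfolding v_def by (rule Inf_minimizers(2)[OF t])
    have y: "X t - t * f' v \<le> y0"
      using char_foot_mono(1)[OF X' _ elim(1)] unfolding y0_def v_def foot_l_def by auto
    have "\<xi> \<le> (2 * \<bar>y0\<bar> + 1 + C2) * t powr e"
    \<comment> \<open>Beyond this threshold \<open>y0\<close> takes at most half of \<xi>, and
      \<open>1 \<le> \<xi>\<close> makes the power bound on the growth available.\<close>
    proof (cases "\<xi> \<le> 2 * \<bar>y0\<bar> + 1")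
      case True
      then have "\<xi> \<le> (2 * \<bar>y0\<bar> + 1) * t powr e" using mult_left_mono[OF te, of "2 * \<bar>y0\<bar> + 1"] by simp
      also have "\<dots> \<le> (2 * \<bar>y0\<bar> + 1 + C2) * t powr e" using C2 by (intro mult_right_mono) auto
      finally show ?thesis .
    next
      case False
      then have \<xi>: "1 \<le> \<xi>" "\<xi> / 2 \<le> \<xi> - y0" by linarith+
      then have tv: "\<xi> / 2 \<le> t * (f' v - f' c)" using y unfolding \<xi>_def by (simp add: algebra_simps)
      then have "0 < t * (f' v - f' c)" using \<xi> by linarith
      then have "c < v" using t f'_less by (simp add: zero_less_mult_iff)
      have vd: "v < c + \<delta>" using elim(3) unfolding v_def .
      have "t * (f' v - f' c) \<le> t * (2 * N * (v - c) powr (1 + \<alpha>))"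
        using \<delta>(2)[OF \<open>c < v\<close> vd] t by (intro mult_left_mono) auto
      with tv have "\<xi> / (4 * N * t) \<le> (v - c) powr (1 + \<alpha>)" using N t by (simp add: field_simps)
      then have "(\<xi> / (4 * N * t)) powr \<beta> \<le> ((v - c) powr (1 + \<alpha>)) powr \<beta>"
        using \<xi> N t \<alpha> unfolding \<beta>_def by (intro powr_mono2) auto
      also have "\<dots> = (v - c) powr (2 + \<alpha>)" unfolding powr_powr \<beta>_def using \<alpha> by simp
      finally have "\<kappa> * (\<xi> / (4 * N * t)) powr \<beta> \<le> \<kappa> * (v - c) powr (2 + \<alpha>)"
        using \<kappa> by (intro mult_left_mono) auto
      also have "\<dots> \<le> breg v" unfolding \<kappa>_def by (rule \<delta>(3)[OF \<open>c < v\<close> vd])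
      finally have "t * (\<kappa> * (\<xi> / (4 * N * t)) powr \<beta>) \<le> t * breg v" using t by simp
      also have "\<dots> \<le> F \<xi> - F a - c * (\<xi> - a)"
        using right_energy[OF t reg[OF elim(1)] v] unfolding \<xi>_def .
      also have "\<dots> \<le> \<bar>F \<xi> - c * \<xi>\<bar> + \<bar>F a - c * a\<bar> * 1" by (simp add: algebra_simps abs_if)
      also have "\<dots> \<le> (1 + K) * \<xi> powr (1 - 1 / p) + \<bar>F a - c * a\<bar> * \<xi> powr (1 - 1 / p)"
        using growth_power[OF \<xi>(1)] \<xi> p by (intro add_mono mult_left_mono) (auto simp: ge_one_powr_ge_zero)
      also have "\<dots> = C1 * \<xi> powr (1 - 1 / p)" unfolding C1_def by (simp add: algebra_simps)
      finally have "\<xi> \<le> C2 * t powr e"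
        unfolding C2_def e_def \<beta>_def
        by (intro power_balance[where p = p]) (use \<xi> t N \<kappa> C1 \<alpha> p in auto)
      also have "\<dots> \<le> (2 * \<bar>y0\<bar> + 1 + C2) * t powr e" by (intro mult_right_mono) auto
      finally show ?thesis .
    qed
    moreover have "\<bar>a\<bar> \<le> \<bar>a\<bar> * t powr e" using mult_left_mono[OF te, of "\<bar>a\<bar>"] by simp
    ultimately show ?case unfolding C_def \<xi>_def by (simp add: algebra_simps)
  qed
  moreover have "C \<ge> 0" unfolding C_def using C2 by simp
  ultimately show ?thesis unfolding e_def by blast
qed

end

section \<open>Existence of supporting lines, and covering a strip by divides and gaps\<close>

context hopf_lax
begin

text \<open>A supporting line of slope \<open>c\<close> sits exactly at the global minima of
  \<open>F y - c * y\<close>; the hypothesis \<open>out\<close> reduces their existence to a compact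
  interval.\<close>

lemma supports_of_min:
  assumes "l \<le> r" and out: "\<And>y. y < l \<or> r < y \<Longrightarrow> \<exists>z\<in>{l..r}. F z - c * z \<le> F y - c * y"
  shows "\<exists>z\<in>{l..r}. supp c z"
proof -
  have "continuous_on {l..r} (\<lambda>y. F y - c * y)"
    using F_cont by (intro continuous_intros) (auto intro: continuous_on_subset)
  moreover have "{l..r} \<noteq> {}" using assms(1) by simp
  ultimately obtain z where z: "z \<in> {l..r}" "\<And>y. y \<in> {l..r} \<Longrightarrow> F z - c * z \<le> F y - c * y"
    using continuous_attains_inf[OF compact_Icc, of l r "\<lambda>y. F y - c * y"] by blast
  have "F z - c * z \<le> F y - c * y" for y
  proof (cases "y \<in> {l..r}")
    case False
    then obtain z' where "z' \<in> {l..r}" "F z' - c * z' \<le> F y - c * y" using out[of y] by auto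
    with z(2) show ?thesis by fastforce
  qed (rule z)
  then have "supp c z" unfolding supports_def by (simp add: algebra_simps)
  with z(1) show ?thesis by blast
qed

text \<open>The chord slope \<open>c\<close> lies between \<open>s\<close> and \<open>r\<close>, so
  \<open>F y - c * y\<close> attains its minimum on \<open>{e..h}\<close>. The minimum point carries
  a supporting line, hence is \<open>e\<close> or \<open>h\<close>, and there the values
  agree.\<close>

lemma gap_slope_supports:
  assumes "e < h" and e: "supp s e" and h: "supp r h" and no: "\<And>y d. e < y \<Longrightarrow> y < h \<Longrightarrow> \<not> supp d y"
  defines "c \<equiv> (F h - F e) / (h - e)"
  shows "supp c e" "supp c h"
proof -
  have ch: "c * (h - e) = F h - F e" using assms(1) unfolding c_def by simp
  have "F e + s * (h - e) \<le> F h" using e unfolding supports_def by simp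
  then have "s * (h - e) \<le> c * (h - e)" using ch by simp
  then have "s \<le> c" using \<open>e < h\<close> by simp
  have "F h + r * (e - h) \<le> F e" using h unfolding supports_def by simp
  then have "c * (h - e) \<le> r * (h - e)" using ch by (simp add: algebra_simps)
  then have "c \<le> r" using \<open>e < h\<close> by simp
  have out: "\<exists>z\<in>{e..h}. F z - c * z \<le> F y - c * y" if "y < e \<or> h < y" for y
  proof (cases "y < e")
    case True
    then have "c * (y - e) \<le> s * (y - e)" using \<open>s \<le> c\<close> by (intro mult_right_mono_neg) auto
    moreover have "F e + s * (y - e) \<le> F y" using e unfolding supports_def by simp
    ultimately show ?thesis using \<open>e < h\<close> by (intro bexI[of _ e]) (auto simp: algebra_simps)
  next
    case False
    then have "c * (y - h) \<le> r * (y - h)" using \<open>c \<le> r\<close> that by (intro mult_right_mono) auto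
    moreover have "F h + r * (y - h) \<le> F y" using h unfolding supports_def by simp
    ultimately show ?thesis using \<open>e < h\<close> by (intro bexI[of _ h]) (auto simp: algebra_simps)
  qed
  obtain z where z: "z \<in> {e..h}" "supp c z" using supports_of_min[OF less_imp_le[OF \<open>e < h\<close>] out] by blast
  then have "z = e \<or> z = h" using no[of z c] z by force
  then have Fz: "F z - c * z = F e - c * e" "F z - c * z = F h - c * h" using ch by (auto simp: algebra_simps)
  have "F z - c * z \<le> F y - c * y" for y
    using z(2)[unfolded supports_def, rule_format, of y] by (simp add: algebra_simps)
  then have "F e - c * e \<le> F y - c * y" "F h - c * h \<le> F y - c * y" for y using Fz by auto
  then show "supp c e" "supp c h" unfolding supports_def by (auto simp: algebra_simps)
qed

lemma max_slope_of_growth: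
  assumes growth: "\<And>\<epsilon> x. \<epsilon> > 0 \<Longrightarrow> 0 \<le> x \<Longrightarrow> \<bar>F x - c * x\<bar> \<le> \<epsilon> * x + K * \<epsilon> powr (1 - p)"
    and v: "supp v a"
  shows "v \<le> c"
proof (rule field_le_epsilon)
  fix \<epsilon> :: real assume "\<epsilon> > 0"
  define C where "C = K * (\<epsilon>/2) powr (1 - p) - F a + v * a"
  have *: "(v - c - \<epsilon> / 2) * y \<le> C" if "0 \<le> y" for y
  proof -
    have "F a + v * (y - a) \<le> F y" using v unfolding supports_def by simp
    moreover have "F y - c * y \<le> \<epsilon> / 2 * y + K * (\<epsilon>/2) powr (1 - p)"
      using growth[of "\<epsilon>/2" y] \<open>\<epsilon> > 0\<close> that by (simp add: abs_le_iff)
    ultimately show ?thesis unfolding C_def by (simp add: algebra_simps)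
  qed
  show "v \<le> c + \<epsilon>"
  proof (rule ccontr)
    assume "\<not> ?thesis"
    then have k: "v - c - \<epsilon> / 2 > 0" using \<open>\<epsilon> > 0\<close> by simp
    then show False using *[of "(\<bar>C\<bar> + 1) / (v - c - \<epsilon> / 2)"] by (simp add: abs_if split: if_splits)
  qed
qed

text \<open>For \<open>s \<le> d < c\<close> the function \<open>F y - d * y\<close> tends to
  infinity on the right and is bounded below by its value at \<open>a\<close> on the left. Its
  minimum is a contact point not left of \<open>a\<close>, so it is \<open>a\<close> itself. Letting
  \<open>d\<close> tend to \<open>c\<close> keeps the supporting property.\<close>

lemma extreme_slope_supports:
  assumes growth: "\<And>\<epsilon> x. \<epsilon> > 0 \<Longrightarrow> 0 \<le> x \<Longrightarrow> \<bar>F x - c * x\<bar> \<le> \<epsilon> * x + K * \<epsilon> powr (1 - p)"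
    and s: "supp s a" and no: "\<And>y d. a < y \<Longrightarrow> \<not> supp d y"
  shows "supp c a"
proof (cases "s = c")
  case False
  then have "s < c" using max_slope_of_growth[OF growth s] by simp
  have below: "supp d a" if d: "s \<le> d" "d < c" for d
  proof -
    define \<epsilon> where "\<epsilon> = (c - d) / 2"
    have \<epsilon>: "\<epsilon> > 0" using d unfolding \<epsilon>_def by simp
    define C where "C = K * \<epsilon> powr (1 - p)"
    define R where "R = \<bar>a\<bar> + \<bar>C + F a - d * a\<bar> / \<epsilon>"
    have aR: "a \<le> R" "0 \<le> R" unfolding R_def using \<epsilon> by (auto intro!: add_increasing2)
    have far: "F a - d * a \<le> F y - d * y" if "R \<le> y" for y
    proof -
      have y: "0 \<le> y" using that aR by simp
      have "c * y - \<epsilon> * y - C \<le> F y" using growth[OF \<epsilon> y] unfolding C_def by (simp add: abs_le_iff)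
      then have "\<epsilon> * y - C \<le> F y - d * y" unfolding \<epsilon>_def by (simp add: field_simps)
      moreover have "\<epsilon> * (\<bar>C + F a - d * a\<bar> / \<epsilon>) \<le> \<epsilon> * y"
        using that \<epsilon> unfolding R_def by (intro mult_left_mono) auto
      ultimately show ?thesis using \<epsilon> by simp
    qed
    have out: "\<exists>z\<in>{a..R}. F z - d * z \<le> F y - d * y" if "y < a \<or> R < y" for y
    proof (rule bexI[of _ a])
      show "F a - d * a \<le> F y - d * y"
      proof (cases "y < a")
        case True
        then have "d * (y - a) \<le> s * (y - a)" using d by (intro mult_right_mono_neg) auto
        moreover have "F a + s * (y - a) \<le> F y" using s unfolding supports_def by simp
        ultimately show ?thesis by (simp add: algebra_simps)
      qed (use far that in auto)
    qed (use aR in simp)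
    obtain z where z: "z \<in> {a..R}" "supp d z" using supports_of_min[OF aR(1) out] by blast
    then have "z = a" using no[of z d] by force
    with z show ?thesis by simp
  qed
  show ?thesis
  proof (rule supports_limit[OF F_cont, of "\<lambda>_. a" a "\<lambda>n. c - (c - s) * inverse (real (Suc n))"])
    have "(\<lambda>n. c - (c - s) * inverse (real (Suc n))) \<longlonglongrightarrow> c - (c - s) * 0"
      by (intro tendsto_intros LIMSEQ_inverse_real_of_nat)
    then show "(\<lambda>n. c - (c - s) * inverse (real (Suc n))) \<longlonglongrightarrow> c" by simp
    fix n
    have "inverse (real (Suc n)) \<le> 1" "0 < inverse (real (Suc n))" by (auto simp: field_simps)
    then have "(c - s) * inverse (real (Suc n)) \<le> (c - s) * 1" "0 < (c - s) * inverse (real (Suc n))"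
      using \<open>s < c\<close> by (intro mult_left_mono mult_pos_pos; linarith)+
    then have "s \<le> c - (c - s) * inverse (real (Suc n))" "c - (c - s) * inverse (real (Suc n)) < c"
      unfolding mult_1_right by linarith+
    then show "supp (c - (c - s) * inverse (real (Suc n))) a" by (rule below)
  qed simp
qed (use s in auto)

text \<open>Subtracting the line of the mean slope \<open>m\<close> makes \<open>F\<close> coercive
  in both directions. The mean differs from either limiting slope by \<open>2 * \<delta>\<close>:
  one \<delta> pays for the growth error, the other is left for coercivity.\<close>

lemma supports_exists:
  assumes gr: "\<And>\<epsilon> x. \<epsilon> > 0 \<Longrightarrow> 0 \<le> x \<Longrightarrow> \<bar>F x - cr * x\<bar> \<le> \<epsilon> * x + K * \<epsilon> powr (1 - p)"
    and gl: "\<And>\<epsilon> x. \<epsilon> > 0 \<Longrightarrow> x \<le> 0 \<Longrightarrow> \<bar>F x - cl * x\<bar> \<le> \<epsilon> * \<bar>x\<bar> + K * \<epsilon> powr (1 - p)"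
    and "cl < cr"
  shows "\<exists>c y. supp c y"
proof -
  define \<delta> where "\<delta> = (cr - cl) / 4"
  define m where "m = (cr + cl) / 2"
  define C where "C = K * \<delta> powr (1 - p)"
  have \<delta>: "\<delta> > 0" using assms(3) unfolding \<delta>_def by simp
  have lower: "\<delta> * \<bar>y\<bar> - C \<le> F y - m * y" for y
  proof (cases "0 \<le> y")
    case True
    have "cr * y - \<delta> * y - C \<le> F y" using gr[OF \<delta> True] unfolding C_def by (simp add: abs_le_iff)
    moreover have "cr = m + 2 * \<delta>" unfolding m_def \<delta>_def by (simp add: field_simps)
    ultimately show ?thesis using True by (simp add: algebra_simps)
  next
    case False
    then have "cl * y + \<delta> * y - C \<le> F y" using gl[OF \<delta>, of y] unfolding C_def by (simp add: abs_le_iff)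
    moreover have "cl = m - 2 * \<delta>" unfolding m_def \<delta>_def by (simp add: field_simps)
    ultimately show ?thesis using False by (simp add: algebra_simps)
  qed
  define R where "R = \<bar>C + F 0\<bar> / \<delta>"
  have R: "0 \<le> R" unfolding R_def using \<delta> by simp
  have out: "\<exists>z\<in>{-R..R}. F z - m * z \<le> F y - m * y" if "y < - R \<or> R < y" for y
  proof -
    have "\<delta> * R \<le> \<delta> * \<bar>y\<bar>" using that \<delta> R by (intro mult_left_mono) (auto simp: abs_if)
    moreover have "\<delta> * R = \<bar>C + F 0\<bar>" using \<delta> unfolding R_def by simp
    ultimately show ?thesis using lower[of y] R by (intro bexI[of _ 0]) auto
  qed
  have "- R \<le> R" using R by simp
  from supports_of_min[OF this out] show ?thesis by blast
qed

text \<open>Take the last contact point \<open>a\<close> with a ray not beyond \<open>x\<close> and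
  the first one \<open>b\<close> with a ray not before \<open>x\<close>. Monotonicity of slopes
  gives \<open>a \<le> b\<close>. If they agree, an intermediate supporting slope hits
  \<open>x\<close>. Otherwise \<open>(a, b)\<close> is a gap, and \<open>x\<close> lies in its
  region or in the fan of rays from one of its ends.\<close>

lemma strip_cover:
  assumes s1: "supp c1 y1" and s2: "supp c2 y2" and "y1 \<le> y2" and t: "t > 0"
    and x: "y1 + t * f' c1 \<le> x" "x \<le> y2 + t * f' c2"
  shows "(\<exists>c y. supp c y \<and> x = y + t * f' c) \<or>
    (\<exists>e h. y1 \<le> e \<and> e < h \<and> h \<le> y2 \<and> (\<exists>c. supp c e) \<and> (\<exists>c. supp c h) \<and> (\<forall>y d. e < y \<and> y < h \<longrightarrow> \<not> supp d y) \<and>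
      e + t * f' ((F h - F e) / (h - e)) < x \<and> x < h + t * f' ((F h - F e) / (h - e)))"
proof -
  define A where "A = {y1..y2} \<inter> {y. \<exists>c. supp c y \<and> (y, c) \<in> {(y, c). y + t * f' c \<le> x}}"
  define D where "D = {y1..y2} \<inter> {y. \<exists>c. supp c y \<and> (y, c) \<in> {(y, c). x \<le> y + t * f' c}}"
  have cts: "continuous_on UNIV (\<lambda>(y, c). y + t * f' c)"
    unfolding case_prod_unfold
    by (intro continuous_intros continuous_on_compose2[OF cont]) auto
  have "closed A" "closed D" unfolding A_def D_def case_prod_unfold
    by (intro closed_Int closed_atLeastAtMost supports_closed_restrict[OF lip] closed_Collect_le
         continuous_intros cts[unfolded case_prod_unfold])+
  have "y1 \<in> A" "y2 \<in> D" using s1 s2 x \<open>y1 \<le> y2\<close> unfolding A_def D_def by auto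
  have bdd: "bdd_above A" "bdd_below D" unfolding A_def D_def by auto
  define a where "a = Sup A"
  define b where "b = Inf D"
  have "a \<in> A" unfolding a_def using \<open>closed A\<close> bdd \<open>y1 \<in> A\<close> by (intro closed_contains_Sup) auto
  have "b \<in> D" unfolding b_def using \<open>closed D\<close> bdd \<open>y2 \<in> D\<close> by (intro closed_contains_Inf) auto
  obtain ca where ca: "supp ca a" "a + t * f' ca \<le> x" using \<open>a \<in> A\<close> unfolding A_def by auto
  obtain cb where cb: "supp cb b" "x \<le> b + t * f' cb" using \<open>b \<in> D\<close> unfolding D_def by auto
  have ab: "y1 \<le> a" "b \<le> y2" using \<open>a \<in> A\<close> \<open>b \<in> D\<close> unfolding A_def D_def by auto
  have Aa: "y \<le> a" if "y \<in> A" for y using that bdd unfolding a_def by (intro cSup_upper)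
  have Db: "b \<le> y" if "y \<in> D" for y using that bdd unfolding b_def by (intro cInf_lower)
  \<comment> \<open>The supporting slopes at one point form an interval, so their rays sweep out
    everything between two of them.\<close>
  have hit: "\<exists>c y. supp c y \<and> x = y + t * f' c"
    if "supp c y" "supp d y" "y + t * f' c \<le> x" "x \<le> y + t * f' d" for c d y
  proof -
    have "f' c \<le> (x - y) / t" "(x - y) / t \<le> f' d" using that t by (auto simp: field_simps)
    then obtain u where "c \<le> u" "u \<le> d" "f' u = (x - y) / t" by (rule f'_ivt)
    then have "supp u y" "x = y + t * f' u" using supports_convex[OF that(1,2)] t by auto
    then show ?thesis by blast
  qed
  have "a \<le> b"
  proof (rule ccontr)
    assume "\<not> a \<le> b"
    then have "cb \<le> ca" using supports_mono[OF cb(1) ca(1)] by simp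
    then have "t * f' cb \<le> t * f' ca" using t f'_le by (intro mult_left_mono) auto
    then show False using ca cb \<open>\<not> a \<le> b\<close> by linarith
  qed
  show ?thesis
  proof (cases "a = b")
    case True
    then show ?thesis using hit[OF ca(1) _ ca(2)] cb by auto
  next
    case False
    then have "a < b" using \<open>a \<le> b\<close> by simp
    have no: "\<not> supp d y" if "a < y" "y < b" for y d
    proof
      assume "supp d y"
      moreover have "y + t * f' d \<le> x \<or> x \<le> y + t * f' d" by linarith
      moreover have "y \<in> {y1..y2}" using that ab by simp
      ultimately have "y \<in> A \<or> y \<in> D" unfolding A_def D_def by blast
      then show False using Aa[of y] Db[of y] that by auto
    qed
    define c where "c = (F b - F a) / (b - a)"
    have c: "supp c a" "supp c b" using gap_slope_supports[OF \<open>a < b\<close> ca(1) cb(1) no] unfolding c_def by auto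
    show ?thesis
    proof (cases "a + t * f' c < x \<and> x < b + t * f' c")
      case True
      then show ?thesis using ab \<open>a < b\<close> ca cb no unfolding c_def by blast
    next
      case False
      then show ?thesis using hit[OF ca(1) c(1) ca(2)] hit[OF c(2) cb(1) _ cb(2)] by force
    qed
  qed
qed

end

text \<open>
  The left unbounded region is the right one of the problem reflected by \<open>x \<mapsto> - x\<close>, \<open>u \<mapsto> - u\<close>.
\<close>
lemma minimizers_reflect:
  "minimizers (\<lambda>u. f (- u)) (\<lambda>u. - f' (- u)) (\<lambda>x. F (- x)) (- x) t = uminus ` minimizers f f' F x t"
proof -
  have *: "lax (\<lambda>u. f (- u)) (\<lambda>u. - f' (- u)) (\<lambda>x. F (- x)) (- x) t u = lax f f' F x t (- u)" for u
    unfolding lax_def legendre_def by simp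
  have "u \<in> minimizers (\<lambda>u. f (- u)) (\<lambda>u. - f' (- u)) (\<lambda>x. F (- x)) (- x) t \<longleftrightarrow> - u \<in> minimizers f f' F x t" for u
    unfolding minimizers_def * by (simp, metis minus_minus)
  then show ?thesis by (force simp: image_iff)
qed

lemma supports_reflect: "supports (\<lambda>x. F (- x)) (- c) (- y) \<longleftrightarrow> supports F c y"
proof -
  have "(\<forall>z. F y + - c * (z + y) \<le> F (- z)) \<longleftrightarrow> (\<forall>z. F y + c * (z - y) \<le> F z)"
    by (rule iffI; rule allI; drule_tac x = "- z" in spec) (simp_all add: algebra_simps)
  then show ?thesis unfolding supports_def by simp
qed

lemma hopf_lax_reflect:
  assumes "hopf_lax f f' F B"
  shows "hopf_lax (\<lambda>u. f (- u)) (\<lambda>u. - f' (- u)) (\<lambda>x. F (- x)) B"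
proof -
  interpret hopf_lax f f' F B by fact
  show ?thesis
  proof
    show "((\<lambda>u. f (- u)) has_real_derivative - f' (- x)) (at x)" for x
    proof -
      have "((\<lambda>u. f (- u)) has_real_derivative f' (- x) * - 1) (at x)"
        by (rule DERIV_chain2[OF deriv]) (auto intro!: derivative_eq_intros)
      then show ?thesis by simp
    qed
    show "continuous_on UNIV (\<lambda>u. - f' (- u))"
      by (intro continuous_intros continuous_on_compose2[OF cont]) auto
    show "strict_mono (\<lambda>u. - f' (- u))" by (auto simp: strict_mono_def f'_less)
    show "\<bar>F (- x) - F (- y)\<bar> \<le> B * \<bar>x - y\<bar>" for x y
      using lip[of "- x" "- y"] by (simp add: abs_minus_commute)
  qed
qed

lemma char_from_reflect:
  assumes "hopf_lax f f' F B" "hopf_lax.char_from f f' F T X"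
  shows "hopf_lax.char_from (\<lambda>u. f (- u)) (\<lambda>u. - f' (- u)) (\<lambda>x. F (- x)) T (\<lambda>t. - X t)"
proof -
  interpret hopf_lax f f' F B by fact
  interpret R: hopf_lax "\<lambda>u. f (- u)" "\<lambda>u. - f' (- u)" "\<lambda>x. F (- x)" B by (rule hopf_lax_reflect[OF assms(1)])
  have S: "Sup (uminus ` A) = - Inf A" "Inf (uminus ` A) = - Sup A" for A :: "real set"
    by (simp_all add: Inf_real_def image_image)
  show ?thesis
    using assms(2) unfolding R.char_from_def char_from_def minimizers_reflect S
    by (auto simp: algebra_simps) 
qed

section \<open>The energy and the primitive of the datum\<close>

lemma interval_lebesgue_integral_lebesgue:
  fixes g :: "real \<Rightarrow> real"
  assumes "a \<le> b" "g absolutely_integrable_on {a..b}"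
  shows "interval_lebesgue_integral lebesgue (ereal a) (ereal b) g = integral {a..b} g"
    and "interval_lebesgue_integral lebesgue (ereal b) (ereal a) g = - integral {a..b} g"
proof -
  have int: "set_integrable lebesgue {a<..<b} g"
    by (rule set_integrable_subset[OF assms(2)]) auto
  have "(LINT x:{a<..<b}|lebesgue. g x) = integral {a..b} g"
    using set_lebesgue_integral_eq_integral(2)[OF int] by (simp add: integral_open_interval_real)
  then show "interval_lebesgue_integral lebesgue (ereal a) (ereal b) g = integral {a..b} g"
    and "interval_lebesgue_integral lebesgue (ereal b) (ereal a) g = - integral {a..b} g"
    using assms(1) by (auto simp: interval_lebesgue_integral_def set_lebesgue_integral_def)
qed

locale essentially_bounded =
  fixes \<phi> :: "real \<Rightarrow> real" and B :: real
  assumes meas: "\<phi> \<in> borel_measurable lebesgue" and bounded: "AE x in lebesgue. \<bar>\<phi> x\<bar> \<le> B"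
begin

lemma B_ge_0: "0 \<le> B"
proof (rule ccontr)
  assume "\<not> 0 \<le> B"
  then have "AE x in (lebesgue :: real measure). False" using bounded by (auto elim: eventually_mono)
  then show False by (simp add: eventually_False ae_filter_eq_bot_iff)
qed

lemma absolutely_integrable: "\<phi> absolutely_integrable_on {a..b}"
  unfolding set_integrable_def
  by (rule integrableI_bounded_set_indicator[where B = B]) (use meas bounded in \<open>auto elim: eventually_mono simp: emeasure_lborel_Icc_eq\<close>)

lemma primitive_diff: "a \<le> b \<Longrightarrow> primitive \<phi> b - primitive \<phi> a = integral {a..b} \<phi>"
proof -
  have int: "\<phi> integrable_on {a..b}" for a b
    using absolutely_integrable set_lebesgue_integral_eq_integral(1) by blast
  have p: "primitive \<phi> x = (if 0 \<le> x then integral {0..x} \<phi> else - integral {x..0} \<phi>)" for x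
    using interval_lebesgue_integral_lebesgue[of 0 x \<phi>] interval_lebesgue_integral_lebesgue[of x 0 \<phi>]
      absolutely_integrable unfolding primitive_def by auto
  assume "a \<le> b"
  then consider "0 \<le> a" | "a < 0" "0 \<le> b" | "b < 0" by linarith
  then show ?thesis
  proof cases
    case 1
    then show ?thesis using \<open>a \<le> b\<close> Henstock_Kurzweil_Integration.integral_combine[of 0 a b \<phi>] int p by auto
  next
    case 2
    then show ?thesis using \<open>a \<le> b\<close> Henstock_Kurzweil_Integration.integral_combine[of a 0 b \<phi>] int p by auto
  next
    case 3
    then show ?thesis using \<open>a \<le> b\<close> Henstock_Kurzweil_Integration.integral_combine[of a b 0 \<phi>] int p by auto
  qed
qed

lemma primitive_lipschitz: "\<bar>primitive \<phi> x - primitive \<phi> y\<bar> \<le> B * \<bar>x - y\<bar>"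
proof -
  have le: "\<bar>primitive \<phi> b - primitive \<phi> a\<bar> \<le> B * (b - a)" if "a \<le> b" for a b
  proof -
    \<comment> \<open>The bound on \<phi> holds only almost everywhere; \<psi> satisfies it
      everywhere and has the same integrals.\<close>
    define \<psi> where "\<psi> x = (if \<bar>\<phi> x\<bar> \<le> B then \<phi> x else 0)" for x
    have m: "{x \<in> space lebesgue. \<not> \<bar>\<phi> x\<bar> \<le> B} \<in> sets lebesgue"
      using meas by measurable
    have "{x. \<not> \<bar>\<phi> x\<bar> \<le> B} \<in> null_sets lebesgue"
      using iffD1[OF AE_iff_null[OF m] bounded] by simp
    then have neg: "negligible {x. \<not> \<bar>\<phi> x\<bar> \<le> B}" by (simp add: negligible_iff_null_sets)
    have "integral {a..b} \<phi> = integral {a..b} \<psi>"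
      by (rule integral_spike[OF neg]) (auto simp: \<psi>_def)
    moreover have "\<psi> integrable_on {a..b}"
      by (rule integrable_spike[OF set_lebesgue_integral_eq_integral(1)[OF absolutely_integrable] neg]) (auto simp: \<psi>_def)
    then have "norm (integral {a..b} \<psi>) \<le> B * (b - a)"
      using has_integral_bound_real[OF B_ge_0 finite.emptyI integrable_integral, of \<psi> a b] that B_ge_0
      by (auto simp: \<psi>_def)
    ultimately show ?thesis using primitive_diff[OF that] by simp
  qed
  show ?thesis
    using le[of x y] le[of y x] by (cases "x \<le> y") (auto simp: abs_minus_commute)
qed

text \<open>
  Instead of Hoelder's inequality we integrate \<open>s \<le> \<epsilon> + s powr p * \<epsilon> powr (1 - p)\<close>;
  the optimal \<open>\<epsilon>\<close> then gives the growth exponent \<open>1 - 1 / p\<close>.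
\<close>
lemma primitive_growth:
  assumes p: "1 \<le> p" and int: "set_integrable lebesgue S (\<lambda>x. \<bar>\<phi> x - c\<bar> powr p)" and S: "{a..b} \<subseteq> S"
    and "a \<le> b" "\<epsilon> > 0"
  shows "\<bar>primitive \<phi> b - primitive \<phi> a - c * (b - a)\<bar> \<le> \<epsilon> * (b - a) + integral S (\<lambda>x. \<bar>\<phi> x - c\<bar> powr p) * \<epsilon> powr (1 - p)"
proof -
  let ?g = "\<lambda>x. \<bar>\<phi> x - c\<bar> powr p"
  have iS: "?g integrable_on S" using set_lebesgue_integral_eq_integral(1)[OF int] .
  have gab: "?g integrable_on {a..b}"
    by (rule set_lebesgue_integral_eq_integral(1), rule set_integrable_subset[OF int]) (use S in auto)
  have iphi: "\<phi> integrable_on {a..b}" using absolutely_integrable set_lebesgue_integral_eq_integral(1) by blast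
  have "primitive \<phi> b - primitive \<phi> a - c * (b - a) = integral {a..b} (\<lambda>x. \<phi> x - c)"
    using primitive_diff[OF \<open>a \<le> b\<close>] integral_diff[OF iphi integrable_const_ivl, of c] \<open>a \<le> b\<close> by (simp add: mult.commute)
  moreover have "norm (integral {a..b} (\<lambda>x. \<phi> x - c)) \<le> integral {a..b} (\<lambda>x. \<epsilon> + ?g x * \<epsilon> powr (1 - p))"
  proof (rule integral_norm_bound_integral)
    show "(\<lambda>x. \<phi> x - c) integrable_on {a..b}" by (intro integrable_diff iphi) auto
    show "(\<lambda>x. \<epsilon> + ?g x * \<epsilon> powr (1 - p)) integrable_on {a..b}"
      by (intro integrable_add integrable_on_mult_left gab) auto
    fix x
    define s where "s = \<bar>\<phi> x - c\<bar>"
    have "s \<le> \<epsilon> + s powr p * \<epsilon> powr (1 - p)"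
    proof (cases "s \<le> \<epsilon>")
      case True
      then show ?thesis by (simp add: add_increasing2)
    next
      case False
      then have "s = s powr p * s powr (1 - p)" using \<open>\<epsilon> > 0\<close> by (simp add: powr_add[symmetric])
      also have "\<dots> \<le> s powr p * \<epsilon> powr (1 - p)"
        using False p \<open>\<epsilon> > 0\<close> by (intro mult_left_mono powr_mono2') auto
      finally show ?thesis using \<open>\<epsilon> > 0\<close> by simp
    qed
    then show "norm (\<phi> x - c) \<le> \<epsilon> + ?g x * \<epsilon> powr (1 - p)" unfolding s_def by simp
  qed
  moreover have "integral {a..b} (\<lambda>x. \<epsilon> + ?g x * \<epsilon> powr (1 - p)) = \<epsilon> * (b - a) + integral {a..b} ?g * \<epsilon> powr (1 - p)"
    using \<open>a \<le> b\<close> by (subst integral_add[OF integrable_const_ivl integrable_on_mult_left[OF gab]]) simp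
  moreover have "integral {a..b} ?g * \<epsilon> powr (1 - p) \<le> integral S ?g * \<epsilon> powr (1 - p)"
    using S gab iS by (intro mult_right_mono integral_subset_le) auto
  ultimately show ?thesis by simp
qed

end

section \<open>From the energy to the Lax functional, and from the given notions to supporting
  lines\<close>

locale conservation_law = essentially_bounded +
  fixes f f' f'' :: "real \<Rightarrow> real"
  assumes f_deriv: "\<And>x. (f has_real_derivative f' x) (at x)"
    and f'_deriv: "\<And>x. (f' has_real_derivative f'' x) (at x)"
    and f''_cont: "continuous_on UNIV f''"
    and f''_nonneg: "\<And>x. 0 \<le> f'' x"
    and f''_null: "{x. f'' x = 0} \<in> null_sets lebesgue"
begin

text \<open>A plateau of the nondecreasing \<open>f'\<close> would make \<open>f''\<close> vanish on
  an interval, which has positive measure.\<close>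

lemma strict_mono_f': "strict_mono f'"
proof (rule strict_monoI)
  fix a b :: real assume "a < b"
  have mono: "f' u \<le> f' v" if "u \<le> v" for u v
    using DERIV_nonneg_imp_nondecreasing[OF that, of f'] f'_deriv f''_nonneg by blast
  show "f' a < f' b"
  proof (rule ccontr)
    assume "\<not> f' a < f' b"
    have eq: "f' x = f' a" if "x \<in> {a..b}" for x
    proof -
      have "f' a \<le> f' x" "f' x \<le> f' b" using that by (auto intro!: mono)
      then show ?thesis using \<open>\<not> f' a < f' b\<close> by linarith
    qed
    have "f'' x = 0" if x: "x \<in> {a<..<b}" for x
    proof -
      have "((\<lambda>_. f' a) has_real_derivative f'' x) (at x)"
      proof (rule has_field_derivative_transform_within_open)
        show "(f' has_real_derivative f'' x) (at x)" by (rule f'_deriv)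
        show "open {a<..<b}" by simp
        show "x \<in> {a<..<b}" by (rule x)
        show "f' y = f' a" if "y \<in> {a<..<b}" for y using that by (intro eq) simp
      qed
      then show ?thesis by (rule DERIV_unique) (rule DERIV_const)
    qed
    then have "{a<..<b} \<subseteq> {x. f'' x = 0}" by auto
    then have "negligible {a<..<b}" by (rule negligible_subset[rotated]) (simp add: negligible_iff_null_sets f''_null)
    then show False using \<open>a < b\<close> by (simp add: negligible_iff_null_sets null_sets_def)
  qed
qed

sublocale hopf_lax f f' "primitive \<phi>" B
proof
  show "continuous_on UNIV f'"
    using f'_deriv by (meson DERIV_continuous_on has_field_derivative_at_within)
qed (use f_deriv strict_mono_f' primitive_lipschitz in auto)

abbreviation "\<Phi> \<equiv> primitive \<phi>"

text \<open>Substitute the foot \<open>\<gamma> s = x - t * f' s\<close>, which is injective and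
  decreasing with \<open>\<bar>\<gamma>'\<bar> = t * f''\<close>, in the term containing \<phi>. The
  remaining term \<open>f'' s * s\<close> is the derivative of the Legendre term.\<close>

lemma energy_segment:
  assumes "a \<le> b" "t > 0"
  shows "(\<lambda>s. f'' s * (\<phi> (x - t * f' s) - s)) absolutely_integrable_on {a..b}"
    and "t * integral {a..b} (\<lambda>s. f'' s * (\<phi> (x - t * f' s) - s)) = lax f f' \<Phi> x t a - lax f f' \<Phi> x t b"
proof -
  define \<gamma> where "\<gamma> s = x - t * f' s" for s
  have d: "(\<gamma> has_field_derivative - t * f'' s) (at s within {a..b})" for s
    unfolding \<gamma>_def by (auto intro!: derivative_eq_intros f'_deriv[THEN has_field_derivative_at_within])
  have inj: "inj_on \<gamma> {a..b}" using assms f'_eq unfolding \<gamma>_def inj_on_def by simp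
  have im: "\<gamma> ` {a..b} = {\<gamma> b..\<gamma> a}"
  proof (intro equalityI subsetI)
    fix y assume "y \<in> \<gamma> ` {a..b}"
    then show "y \<in> {\<gamma> b..\<gamma> a}" using assms f'_le unfolding \<gamma>_def by auto
  next
    fix y assume "y \<in> {\<gamma> b..\<gamma> a}"
    then have "f' a \<le> (x - y) / t" "(x - y) / t \<le> f' b" using assms unfolding \<gamma>_def by (auto simp: field_simps)
    then obtain u where "a \<le> u" "u \<le> b" "f' u = (x - y) / t" by (rule f'_ivt)
    then show "y \<in> \<gamma> ` {a..b}" using assms unfolding \<gamma>_def by (intro image_eqI[of _ _ u]) (auto simp: field_simps)
  qed
  have \<gamma>le: "\<gamma> b \<le> \<gamma> a" using assms f'_le unfolding \<gamma>_def by simp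
  have cv: "(\<lambda>s. \<bar>- t * f'' s\<bar> * \<phi> (\<gamma> s)) absolutely_integrable_on {a..b} \<and>
      integral {a..b} (\<lambda>s. \<bar>- t * f'' s\<bar> * \<phi> (\<gamma> s)) = integral {\<gamma> b..\<gamma> a} \<phi>"
    using has_absolute_integral_change_of_variables_1'[of "{a..b}" \<gamma> "\<lambda>s. - t * f'' s" \<phi> "integral {\<gamma> b..\<gamma> a} \<phi>"]
      d inj absolutely_integrable unfolding im by auto
  have abs: "\<bar>- t * f'' s\<bar> * \<phi> (\<gamma> s) = t * (f'' s * \<phi> (\<gamma> s))" for s
    using assms f''_nonneg[of s] by (simp add: abs_mult)
  have i1: "(\<lambda>s. f'' s * \<phi> (\<gamma> s)) absolutely_integrable_on {a..b}"
    and e1: "t * integral {a..b} (\<lambda>s. f'' s * \<phi> (\<gamma> s)) = \<Phi> (\<gamma> a) - \<Phi> (\<gamma> b)"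
  proof -
    have "(\<lambda>s. t * (f'' s * \<phi> (\<gamma> s))) absolutely_integrable_on {a..b}" using cv unfolding abs by simp
    then show "(\<lambda>s. f'' s * \<phi> (\<gamma> s)) absolutely_integrable_on {a..b}" using assms by simp
    have "integral {a..b} (\<lambda>s. t * (f'' s * \<phi> (\<gamma> s))) = integral {\<gamma> b..\<gamma> a} \<phi>" using cv unfolding abs by simp
    then show "t * integral {a..b} (\<lambda>s. f'' s * \<phi> (\<gamma> s)) = \<Phi> (\<gamma> a) - \<Phi> (\<gamma> b)"
      using primitive_diff[OF \<gamma>le] by simp
  qed
  have c2: "continuous_on {a..b} (\<lambda>s. f'' s * s)"
    using f''_cont by (intro continuous_intros) (auto intro: continuous_on_subset)
  have i2: "(\<lambda>s. f'' s * s) absolutely_integrable_on {a..b}"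
    using absolutely_integrable_continuous_real[OF c2] .
  have "(leg has_vector_derivative f'' s * s) (at s within {a..b})" for s
    unfolding legendre_def has_real_derivative_iff_has_vector_derivative[symmetric]
    by (rule DERIV_subset[of _ _ _ UNIV]) (auto intro!: derivative_eq_intros f_deriv f'_deriv)
  then have e2: "integral {a..b} (\<lambda>s. f'' s * s) = leg b - leg a"
    using fundamental_theorem_of_calculus[OF assms(1), of leg "\<lambda>s. f'' s * s"] by (simp add: integral_unique)
  have eq: "(\<lambda>s. f'' s * (\<phi> (x - t * f' s) - s)) = (\<lambda>s. f'' s * \<phi> (\<gamma> s) - f'' s * s)"
    unfolding \<gamma>_def by (auto simp: algebra_simps)
  show "(\<lambda>s. f'' s * (\<phi> (x - t * f' s) - s)) absolutely_integrable_on {a..b}"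
    unfolding eq using i1 i2 by (rule set_integral_diff(1))
  have "integral {a..b} (\<lambda>s. f'' s * (\<phi> (x - t * f' s) - s)) = integral {a..b} (\<lambda>s. f'' s * \<phi> (\<gamma> s)) - (leg b - leg a)"
    unfolding eq e2[symmetric] using i1 i2 by (intro integral_diff set_lebesgue_integral_eq_integral(1))
  then show "t * integral {a..b} (\<lambda>s. f'' s * (\<phi> (x - t * f' s) - s)) = lax f f' \<Phi> x t a - lax f f' \<Phi> x t b"
    using e1 unfolding lax_def \<gamma>_def by (simp add: right_diff_distrib)
qed

lemma energy_eq_lax:
  assumes "t > 0"
  shows "energy f' f'' \<phi> u x t = lax f f' \<Phi> x t 0 - lax f f' \<Phi> x t u"
proof (cases "0 \<le> u")
  case True
  show ?thesis unfolding energy_def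
    using interval_lebesgue_integral_lebesgue(1)[OF True energy_segment(1)[OF True assms]] energy_segment(2)[OF True assms]
    by simp
next
  case False
  then have u: "u \<le> 0" by simp
  show ?thesis unfolding energy_def
    using interval_lebesgue_integral_lebesgue(2)[OF u energy_segment(1)[OF u assms]] energy_segment(2)[OF u assms]
    by simp
qed

lemma maximizers_eq: "t > 0 \<Longrightarrow> maximizers f' f'' \<phi> x t = M x t"
  unfolding maximizers_def minimizers_def by (auto simp: energy_eq_lax)

text \<open>A divide has the constant foot \<open>y\<close> at all times, so letting
  \<open>t\<close> tend to infinity yields the supporting line.\<close>

lemma is_divide_iff: "is_divide f' f'' \<phi> c y \<longleftrightarrow> supp c y"
proof
  assume "is_divide f' f'' \<phi> c y"
  then have "maximizers f' f'' \<phi> (y + t * f' c) t = {c}" if "t > 0" for t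
    using that unfolding is_divide_def ray_def by auto
  then show "supp c y" by (intro supports_of_minimizers) (simp add: maximizers_eq)
next
  assume "supp c y"
  then show "is_divide f' f'' \<phi> c y"
    unfolding is_divide_def ray_def using minimizers_supports maximizers_eq by auto
qed

lemma contact_set_eq: "contact_set \<phi> = {y. \<exists>c. supp c y}"
  unfolding contact_set_def using convex_env_contact_iff[OF F_cont] by auto

lemma contact_set_closed: "closed (contact_set \<phi>)"
  unfolding contact_set_eq using supports_closed[OF primitive_lipschitz] .

lemma entropy_sol_in: "t > 0 \<Longrightarrow> entropy_sol f' f'' \<phi> x t \<in> M x t"
  unfolding entropy_sol_def using Inf_minimizers(1) maximizers_eq by simp

text \<open>Nested cones have nested time slices, and the ends of a slice are the edges belonging to
  the largest and the smallest maximizer. Starting at \<open>t1 + 1\<close> treats curves from time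
  0 and from positive times alike and does not affect limits.\<close>

lemma fwd_char_imp_char_from:
  assumes "fwd_char f' f'' \<phi> t1 X"
  shows "0 \<le> t1" "char_from (t1 + 1) X"
proof -
  have from_t1: "fwd_char_from f' f'' \<phi> (X t1) t1 X" if "t1 \<noteq> 0" using assms that unfolding fwd_char_def by simp
  then show t1: "0 \<le> t1" unfolding fwd_char_from_def by (cases "t1 = 0") auto
  \<comment> \<open>There is no cone at time 0, so a curve starting there is entered at time
    \<open>1/2\<close>.\<close>
  obtain t0 where t0: "t0 < t1 + 1" "fwd_char_from f' f'' \<phi> (X t0) t0 X"
  proof (cases "t1 = 0")
    case True
    then have "fwd_char_from f' f'' \<phi> (X (1/2)) (1/2) X" using assms unfolding fwd_char_def by simp
    with True show ?thesis by (intro that[of "1/2"]) auto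
  next
    case False
    then show ?thesis using from_t1 that[of t1] by simp
  qed
  have "0 < t0" using t0(2) unfolding fwd_char_from_def by simp
  have *: "X t + (\<tau> - t) * f' (Sup (M (X t) t)) \<le> X s + (\<tau> - s) * f' (Sup (M (X s) s)) \<and>
     X s + (\<tau> - s) * f' (Inf (M (X s) s)) \<le> X t + (\<tau> - t) * f' (Inf (M (X t) t))"
    if s: "t0 < s" "s < t" and \<tau>: "0 \<le> \<tau>" "\<tau> \<le> s" for s t \<tau>
  proof -
    have pos: "0 < s" "0 < t" using s \<open>0 < t0\<close> by auto
    have cone: "backward_cone f' f'' \<phi> (X r) r = {(\<xi>, \<tau>). 0 < \<tau> \<and> \<tau> < r \<and> (\<exists>v \<in> {Inf (M (X r) r)..Sup (M (X r) r)}. \<xi> = X r + (\<tau> - r) * f' v)}"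
      if "r > 0" for r
      using maximizers_eq[OF that] unfolding backward_cone_def entropy_sol_def entropy_sol_left_def by simp
    have sub: "backward_cone f' f'' \<phi> (X s) s \<subseteq> backward_cone f' f'' \<phi> (X t) t"
      using t0(2) s unfolding fwd_char_from_def by blast
    have le: "Inf (M (X s) s) \<le> Sup (M (X s) s)"
      using cInf_lower[OF Inf_minimizers(2)[OF pos(1)] minimizers_bdd(2)[OF pos(1)]] .
    have inner: "X s + (\<tau> - s) * f' v \<in> {X t + (\<tau> - t) * f' (Sup (M (X t) t))..X t + (\<tau> - t) * f' (Inf (M (X t) t))}"
      if "\<tau> \<in> {0<..<s}" "v \<in> {Inf (M (X s) s)..Sup (M (X s) s)}" for \<tau> v
    proof -
      have "(X s + (\<tau> - s) * f' v, \<tau>) \<in> backward_cone f' f'' \<phi> (X s) s" using that unfolding cone[OF pos(1)] by auto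
      then obtain v' where v': "v' \<in> {Inf (M (X t) t)..Sup (M (X t) t)}" "X s + (\<tau> - s) * f' v = X t + (\<tau> - t) * f' v'"
        using sub unfolding cone[OF pos(2)] by blast
      have "(\<tau> - t) * f' (Sup (M (X t) t)) \<le> (\<tau> - t) * f' v'" "(\<tau> - t) * f' v' \<le> (\<tau> - t) * f' (Inf (M (X t) t))"
        using v'(1) that(1) s f'_le by (auto intro!: mult_left_mono_neg)
      then show ?thesis unfolding v'(2) by auto
    qed
    \<comment> \<open>Cones contain only times strictly between 0 and \<open>s\<close>; the foot at
      \<open>\<tau> = 0\<close> and the apex at \<open>\<tau> = s\<close> are reached by continuity
      in \<tau>.\<close>
    have \<tau>c: "\<tau> \<in> closure {0<..<s}" using \<tau> pos by simp
    have "0 \<le> (X s + (\<tau> - s) * f' (Sup (M (X s) s))) - (X t + (\<tau> - t) * f' (Sup (M (X t) t)))"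
      by (rule continuous_ge_on_closure[OF _ \<tau>c, where f = "\<lambda>\<tau>. (X s + (\<tau> - s) * f' (Sup (M (X s) s))) - (X t + (\<tau> - t) * f' (Sup (M (X t) t)))"])
         (use inner[of _ "Sup (M (X s) s)"] le in \<open>auto intro!: continuous_intros\<close>)
    moreover have "0 \<le> (X t + (\<tau> - t) * f' (Inf (M (X t) t))) - (X s + (\<tau> - s) * f' (Inf (M (X s) s)))"
      by (rule continuous_ge_on_closure[OF _ \<tau>c, where f = "\<lambda>\<tau>. (X t + (\<tau> - t) * f' (Inf (M (X t) t))) - (X s + (\<tau> - s) * f' (Inf (M (X s) s)))"])
         (use inner[of _ "Inf (M (X s) s)"] le in \<open>auto intro!: continuous_intros\<close>)
    ultimately show ?thesis by simp
  qed
  show "char_from (t1 + 1) X"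
    unfolding char_from_def
  proof (intro conjI allI impI)
    fix s t \<tau> assume "t1 + 1 \<le> s \<and> s < t \<and> 0 \<le> \<tau> \<and> \<tau> \<le> s"
    then show "X t + (\<tau> - t) * f' (Sup (M (X t) t)) \<le> X s + (\<tau> - s) * f' (Sup (M (X s) s))"
      "X s + (\<tau> - s) * f' (Inf (M (X s) s)) \<le> X t + (\<tau> - t) * f' (Inf (M (X t) t))"
      using *[of s t \<tau>] t0(1) by simp_all
  qed (use t1 in simp)
qed

text \<open>Maximality of a component puts its ends into the contact set. Conversely, a larger
  connected set would contain one of the ends.\<close>

lemma bounded_gap_iff:
  "bounded_gap \<phi> e h \<longleftrightarrow> e < h \<and> (\<exists>c. supp c e) \<and> (\<exists>c. supp c h) \<and> (\<forall>y d. e < y \<and> y < h \<longrightarrow> \<not> supp d y)"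
proof -
  have "{e<..<h} \<in> components (- contact_set \<phi>) \<longleftrightarrow> e \<in> contact_set \<phi> \<and> h \<in> contact_set \<phi> \<and> {e<..<h} \<inter> contact_set \<phi> = {}"
    if eh: "e < h"
  proof
    assume *: "{e<..<h} \<in> components (- contact_set \<phi>)"
    then have max: "\<And>D. D \<noteq> {} \<Longrightarrow> {e<..<h} \<subseteq> D \<Longrightarrow> D \<subseteq> - contact_set \<phi> \<Longrightarrow> connected D \<Longrightarrow> D = {e<..<h}"
      and sub: "{e<..<h} \<subseteq> - contact_set \<phi>"
      unfolding in_components_maximal by auto
    have "e \<in> contact_set \<phi>"
    proof (rule ccontr)
      assume "e \<notin> contact_set \<phi>"
      then have "{e..<h} \<subseteq> - contact_set \<phi>" using sub by (auto simp: less_le)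
      then have "{e..<h} = {e<..<h}" using eh by (intro max) auto
      then show False using eh by auto
    qed
    moreover have "h \<in> contact_set \<phi>"
    proof (rule ccontr)
      assume "h \<notin> contact_set \<phi>"
      then have "{e<..h} \<subseteq> - contact_set \<phi>" using sub by (auto simp: less_le)
      then have "{e<..h} = {e<..<h}" using eh by (intro max) auto
      then show False using eh by auto
    qed
    ultimately show "e \<in> contact_set \<phi> \<and> h \<in> contact_set \<phi> \<and> {e<..<h} \<inter> contact_set \<phi> = {}" using sub by auto
  next
    assume *: "e \<in> contact_set \<phi> \<and> h \<in> contact_set \<phi> \<and> {e<..<h} \<inter> contact_set \<phi> = {}"
    show "{e<..<h} \<in> components (- contact_set \<phi>)"
      unfolding in_components_maximal
    proof (intro conjI allI impI)
      fix D assume D: "D \<noteq> {} \<and> {e<..<h} \<subseteq> D \<and> D \<subseteq> - contact_set \<phi> \<and> connected D"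
      obtain m where m: "e < m" "m < h" using dense[OF eh] by blast
      then have "m \<in> D" using D by auto
      have "z \<in> {e<..<h}" if "z \<in> D" for z
      proof (rule ccontr)
        assume "z \<notin> {e<..<h}"
        then consider "z \<le> e" | "h \<le> z" by fastforce
        then show False
        proof cases
          case 1
          then have "e \<in> {z..m}" using m by simp
          then have "e \<in> D" using connected_contains_Icc[of D z m] D \<open>m \<in> D\<close> that by auto
          then show False using D * by auto
        next
          case 2
          then have "h \<in> {m..z}" using m by simp
          then have "h \<in> D" using connected_contains_Icc[of D m z] D \<open>m \<in> D\<close> that by auto
          then show False using D * by auto
        qed
      qed
      then show "D = {e<..<h}" using D by auto
    qed (use eh * in auto)
  qed
  moreover have "{e<..<h} \<inter> contact_set \<phi> = {} \<longleftrightarrow> (\<forall>y d. e < y \<and> y < h \<longrightarrow> \<not> supp d y)"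
    unfolding contact_set_eq by (force simp: disjoint_iff)
  ultimately show ?thesis unfolding bounded_gap_def contact_set_eq by blast
qed

end

section \<open>Rates\<close>

text \<open>
  \<open>g\<close> is at most \<open>\<eta>\<close> on a set of measure \<open>m\<close> and vanishes almost everywhere on the rest of \<open>A\<close>;
  the null set accounts for the characteristics on which an N-wave is left unspecified.
\<close>
definition concentrated :: "real set \<Rightarrow> (real \<Rightarrow> real) \<Rightarrow> real \<Rightarrow> real \<Rightarrow> bool" where
  "concentrated A g m \<eta> \<longleftrightarrow> (\<exists>Z\<in>sets lebesgue. emeasure lebesgue Z \<le> ennreal m \<and>
     (AE x in lebesgue. x \<in> A \<longrightarrow> \<bar>g x\<bar> \<le> (if x \<in> Z then \<eta> else 0)))"

text \<open>Free of \<open>q\<close>, so that one statement yields the rates for all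
  \<open>q > 0\<close>, and pieces can be joined by unions even for \<open>q < 1\<close>, where
  \<open>Lq_norm\<close> satisfies no triangle inequality. The constant \<open>C\<close> precedes
  \<eta>, so letting \<eta> tend to 0 produces the \<open>o(1)\<close>.\<close>

definition decays_on :: "(real \<Rightarrow> real set) \<Rightarrow> (real \<Rightarrow> real \<Rightarrow> real) \<Rightarrow> real \<Rightarrow> bool" where
  "decays_on A g \<kappa> \<longleftrightarrow>
     (\<forall>\<^sub>F t in at_top. A t \<in> sets lebesgue \<and> set_borel_measurable lebesgue (A t) (\<lambda>x. g x t)) \<and>
     (\<exists>C\<ge>0. \<forall>\<eta>>0. \<forall>\<^sub>F t in at_top. concentrated (A t) (\<lambda>x. g x t) (C * t powr \<kappa>) (\<eta> / t))"

lemma concentrated_subset: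
  assumes "concentrated A g m \<eta>" "A' \<subseteq> A" "m \<le> m'"
  shows "concentrated A' g m' \<eta>"
proof -
  obtain Z where Z: "Z\<in>sets lebesgue" "emeasure lebesgue Z \<le> ennreal m"
    "AE x in lebesgue. x \<in> A \<longrightarrow> \<bar>g x\<bar> \<le> (if x \<in> Z then \<eta> else 0)"
    using assms(1) unfolding concentrated_def by blast
  have "AE x in lebesgue. x \<in> A' \<longrightarrow> \<bar>g x\<bar> \<le> (if x \<in> Z then \<eta> else 0)"
    using Z(3) by eventually_elim (use assms(2) in auto)
  then show ?thesis using Z(1,2) ennreal_leI[OF assms(3)] unfolding concentrated_def by (meson order_trans)
qed

lemma concentrated_Un:
  assumes "concentrated A g m \<eta>" "concentrated A' g m' \<eta>" "0 \<le> m" "0 \<le> m'" "0 \<le> \<eta>"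
  shows "concentrated (A \<union> A') g (m + m') \<eta>"
proof -
  obtain Z where Z: "Z\<in>sets lebesgue" "emeasure lebesgue Z \<le> ennreal m"
    "AE x in lebesgue. x \<in> A \<longrightarrow> \<bar>g x\<bar> \<le> (if x \<in> Z then \<eta> else 0)"
    using assms(1) unfolding concentrated_def by blast
  obtain Z' where Z': "Z'\<in>sets lebesgue" "emeasure lebesgue Z' \<le> ennreal m'"
    "AE x in lebesgue. x \<in> A' \<longrightarrow> \<bar>g x\<bar> \<le> (if x \<in> Z' then \<eta> else 0)"
    using assms(2) unfolding concentrated_def by blast
  have "AE x in lebesgue. x \<in> A \<union> A' \<longrightarrow> \<bar>g x\<bar> \<le> (if x \<in> Z \<union> Z' then \<eta> else 0)"
    using Z(3) Z'(3) by eventually_elim (use assms(5) in \<open>auto split: if_splits\<close>)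
  moreover have "emeasure lebesgue (Z \<union> Z') \<le> ennreal (m + m')"
  proof -
    have "emeasure lebesgue (Z \<union> Z') \<le> emeasure lebesgue Z + emeasure lebesgue Z'"
      by (rule emeasure_subadditive[OF Z(1) Z'(1)])
    also have "\<dots> \<le> ennreal m + ennreal m'" using Z Z' by (intro add_mono)
    finally show ?thesis using assms(3,4) by simp
  qed
  ultimately show ?thesis using Z(1) Z'(1) unfolding concentrated_def by blast
qed

lemma set_borel_measurable_Un:
  fixes g :: "real \<Rightarrow> real"
  assumes "set_borel_measurable M A g" "set_borel_measurable M B g" "A \<in> sets M" "B \<in> sets M"
  shows "set_borel_measurable M (A \<union> B) g"
proof -
  have "(\<lambda>x. indicator (A \<union> B) x *\<^sub>R g x) = (\<lambda>x. if x \<in> A then indicator A x *\<^sub>R g x else indicator B x *\<^sub>R g x)"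
    by (auto simp: indicator_def)
  then show ?thesis using assms unfolding set_borel_measurable_def by (simp only: measurable_If_set sets.Int_space_eq2)
qed

lemma decays_on_measurable:
  "decays_on A g \<kappa> \<Longrightarrow>
    \<forall>\<^sub>F t in at_top. A t \<in> sets lebesgue \<and> set_borel_measurable lebesgue (A t) (\<lambda>x. g x t)"
  unfolding decays_on_def by blast

lemma decays_onE:
  assumes "decays_on A g \<kappa>"
  obtains C where "0 \<le> C"
    "\<And>\<eta>. \<eta> > 0 \<Longrightarrow> \<forall>\<^sub>F t in at_top. concentrated (A t) (\<lambda>x. g x t) (C * t powr \<kappa>) (\<eta> / t)"
  using assms unfolding decays_on_def by blast

lemma decays_on_subset:
  assumes "decays_on A g \<kappa>" "\<forall>\<^sub>F t in at_top. A' t \<subseteq> A t" "\<And>t. A' t \<in> sets lebesgue"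
  shows "decays_on A' g \<kappa>"
proof -
  have 1: "\<forall>\<^sub>F t in at_top. A' t \<in> sets lebesgue \<and> set_borel_measurable lebesgue (A' t) (\<lambda>x. g x t)"
    using decays_on_measurable[OF assms(1)] assms(2)
    by eventually_elim (use assms(3) set_borel_measurable_subset in blast)
  obtain C where C: "0 \<le> C"
    "\<And>\<eta>. \<eta> > 0 \<Longrightarrow> \<forall>\<^sub>F t in at_top. concentrated (A t) (\<lambda>x. g x t) (C * t powr \<kappa>) (\<eta> / t)"
    using decays_onE[OF assms(1)] by blast
  have "\<forall>\<^sub>F t in at_top. concentrated (A' t) (\<lambda>x. g x t) (C * t powr \<kappa>) (\<eta> / t)" if "\<eta> > 0" for \<eta>
    using C(2)[OF that] assms(2) by eventually_elim (rule concentrated_subset[OF _ _ order_refl])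
  with 1 C(1) show ?thesis unfolding decays_on_def by blast
qed

lemma decays_on_Un:
  assumes "decays_on A g \<kappa>" "decays_on A' g \<kappa>"
  shows "decays_on (\<lambda>t. A t \<union> A' t) g \<kappa>"
proof -
  have 1: "\<forall>\<^sub>F t in at_top. A t \<union> A' t \<in> sets lebesgue \<and> set_borel_measurable lebesgue (A t \<union> A' t) (\<lambda>x. g x t)"
    using decays_on_measurable[OF assms(1)] decays_on_measurable[OF assms(2)]
    by eventually_elim (auto intro: set_borel_measurable_Un)
  obtain C where C: "0 \<le> C"
    "\<And>\<eta>. \<eta> > 0 \<Longrightarrow> \<forall>\<^sub>F t in at_top. concentrated (A t) (\<lambda>x. g x t) (C * t powr \<kappa>) (\<eta> / t)"
    using decays_onE[OF assms(1)] by blast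
  obtain C' where C': "0 \<le> C'"
    "\<And>\<eta>. \<eta> > 0 \<Longrightarrow> \<forall>\<^sub>F t in at_top. concentrated (A' t) (\<lambda>x. g x t) (C' * t powr \<kappa>) (\<eta> / t)"
    using decays_onE[OF assms(2)] by blast
  have "\<forall>\<^sub>F t in at_top. concentrated (A t \<union> A' t) (\<lambda>x. g x t) ((C + C') * t powr \<kappa>) (\<eta> / t)" if "\<eta> > 0" for \<eta>
    using C(2)[OF that] C'(2)[OF that] eventually_gt_at_top[of 0]
  proof eventually_elim
    case (elim t)
    then show ?case
      using concentrated_Un[OF elim(1,2)] C(1) C'(1) that by (simp add: distrib_right)
  qed
  moreover have "C + C' \<ge> 0" using C C' by simp
  ultimately show ?thesis using 1 unfolding decays_on_def by blast
qed

lemma decays_on_mono: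
  assumes "decays_on A g \<kappa>" "\<kappa> \<le> \<kappa>'"
  shows "decays_on A g \<kappa>'"
proof -
  obtain C where C: "0 \<le> C"
    "\<And>\<eta>. \<eta> > 0 \<Longrightarrow> \<forall>\<^sub>F t in at_top. concentrated (A t) (\<lambda>x. g x t) (C * t powr \<kappa>) (\<eta> / t)"
    using decays_onE[OF assms(1)] by blast
  have "\<forall>\<^sub>F t in at_top. concentrated (A t) (\<lambda>x. g x t) (C * t powr \<kappa>') (\<eta> / t)" if "\<eta> > 0" for \<eta>
    using C(2)[OF that] eventually_ge_at_top[of 1]
  proof eventually_elim
    case (elim t)
    have "C * t powr \<kappa> \<le> C * t powr \<kappa>'" using C(1) elim(2) assms(2) by (intro mult_left_mono powr_mono) auto
    then show ?case using concentrated_subset[OF elim(1)] by simp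
  qed
  then show ?thesis using decays_on_measurable[OF assms(1)] C(1) unfolding decays_on_def by blast
qed

text \<open>The integral of the \<open>q\<close>-th power is at most
  \<open>(\<eta> / t) powr q * (C * t powr \<kappa>)\<close>; its \<open>q\<close>-th root is \<eta>
  times a constant times the desired rate.\<close>

lemma Lq_rate_of_decays_on:
  assumes d: "decays_on (\<lambda>t. {a t..b t}) g \<kappa>" and q: "q > 0"
  shows "Lq_rate q a b g (- 1 + \<kappa> / q)"
proof -
  let ?A = "\<lambda>t. {a t..b t}"
  have meas: "\<forall>\<^sub>F t in at_top. set_borel_measurable lebesgue (?A t) (\<lambda>x. g x t)"
    using decays_on_measurable[OF d] by (auto elim: eventually_mono)
  obtain C where C: "0 \<le> C"
    "\<And>\<eta>. \<eta> > 0 \<Longrightarrow> \<forall>\<^sub>F t in at_top. concentrated (?A t) (\<lambda>x. g x t) (C * t powr \<kappa>) (\<eta> / t)"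
    using decays_onE[OF d] by blast
  have key: "\<forall>\<^sub>F t in at_top. set_integrable lebesgue (?A t) (\<lambda>x. \<bar>g x t\<bar> powr q) \<and>
      Lq_norm q (?A t) (\<lambda>x. g x t) \<le> \<eta> * C powr (1 / q) * t powr (- 1 + \<kappa> / q)" if "\<eta> > 0" for \<eta>
    using C(2)[OF that] meas eventually_gt_at_top[of 0]
  proof eventually_elim
    case (elim t)
    then obtain Z where Z: "Z\<in>sets lebesgue" "emeasure lebesgue Z \<le> ennreal (C * t powr \<kappa>)"
      "AE x in lebesgue. x \<in> ?A t \<longrightarrow> \<bar>g x t\<bar> \<le> (if x \<in> Z then \<eta> / t else 0)"
      unfolding concentrated_def by blast
    have fin: "emeasure lebesgue Z < \<infinity>" using Z(2) by (metis ennreal_less_top infinity_ennreal_def le_less_trans)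
    have mZ: "measure lebesgue Z \<le> C * t powr \<kappa>"
      using Z(2) C(1) by (simp add: measure_def enn2real_leI)
    let ?G = "\<lambda>x. indicator (?A t) x *\<^sub>R (\<bar>g x t\<bar> powr q)"
    let ?H = "\<lambda>x. (\<eta> / t) powr q * indicator Z x"
    have eqG: "?G = (\<lambda>x. \<bar>indicator (?A t) x *\<^sub>R g x t\<bar> powr q)" using q by (auto simp: indicator_def)
    have mG: "?G \<in> borel_measurable lebesgue"
      unfolding eqG using elim(2) unfolding set_borel_measurable_def by measurable
    have iH: "integrable lebesgue ?H"
      using Z(1) fin by (intro integrable_mult_right) (simp add: integrable_indicator_iff less_top)
    have le: "AE x in lebesgue. ?G x \<le> ?H x"
      using Z(3)
    proof eventually_elim
      case (elim x)
      show ?case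
      proof (cases "x \<in> ?A t")
        case True
        then have "\<bar>g x t\<bar> powr q \<le> (if x \<in> Z then \<eta> / t else 0) powr q"
          using elim q by (intro powr_mono2) auto
        then show ?thesis using True q by (auto simp: indicator_def)
      qed auto
    qed
    have "AE x in lebesgue. norm (?G x) \<le> norm (?H x)" using le by eventually_elim (auto simp: indicator_def)
    then have iG: "integrable lebesgue ?G" by (rule Bochner_Integration.integrable_bound[OF iH mG])
    have "(LINT x:?A t|lebesgue. \<bar>g x t\<bar> powr q) \<le> (\<integral>x. ?H x \<partial>lebesgue)"
      unfolding set_lebesgue_integral_def by (rule integral_mono_AE[OF iG iH le])
    also have "\<dots> = (\<eta> / t) powr q * measure lebesgue Z" using Z(1) by simp
    also have "\<dots> \<le> (\<eta> / t) powr q * (C * t powr \<kappa>)" using mZ by (intro mult_left_mono) auto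
    finally have I: "(LINT x:?A t|lebesgue. \<bar>g x t\<bar> powr q) \<le> (\<eta> / t) powr q * (C * t powr \<kappa>)" .
    have "0 \<le> (LINT x:?A t|lebesgue. \<bar>g x t\<bar> powr q)"
      unfolding set_lebesgue_integral_def by (intro Bochner_Integration.integral_nonneg) auto
    then have "Lq_norm q (?A t) (\<lambda>x. g x t) \<le> ((\<eta> / t) powr q * (C * t powr \<kappa>)) powr (1 / q)"
      unfolding Lq_norm_def using I q by (intro powr_mono2) auto
    also have "\<dots> = (\<eta> / t) * (C powr (1 / q) * t powr (\<kappa> / q))"
      using q that elim(3) C(1) by (simp add: powr_mult powr_powr)
    also have "\<dots> = \<eta> * C powr (1 / q) * t powr (- 1 + \<kappa> / q)"
    proof -
      have "t powr (- 1 + \<kappa> / q) = t powr (\<kappa> / q) / t"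
        using powr_add[of t "- 1" "\<kappa> / q"] elim(3) by (simp add: powr_minus field_simps)
      then show ?thesis by simp
    qed
    finally show ?case using iG unfolding set_integrable_def by blast
  qed
  have "(\<lambda>t. Lq_norm q (?A t) (\<lambda>x. g x t)) \<in> o(\<lambda>t. t powr (- 1 + \<kappa> / q))"
  proof (rule landau_o.smallI)
    fix c :: real assume "c > 0"
    \<comment> \<open>The summand 1 keeps the denominator positive when
      \<open>C = 0\<close>.\<close>
    define \<eta> where "\<eta> = c / (C powr (1 / q) + 1)"
    have "C powr (1 / q) + 1 > 0" by (simp add: add_nonneg_pos)
    then have \<eta>: "\<eta> > 0" unfolding \<eta>_def using \<open>c > 0\<close> by simp
    have \<eta>c: "\<eta> * C powr (1 / q) \<le> c"
    proof -
      have "\<eta> * C powr (1 / q) \<le> \<eta> * (C powr (1 / q) + 1)" using \<eta> by (intro mult_left_mono) auto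
      then show ?thesis unfolding \<eta>_def using \<open>C powr (1 / q) + 1 > 0\<close> by simp
    qed
    show "\<forall>\<^sub>F t in at_top. norm (Lq_norm q (?A t) (\<lambda>x. g x t)) \<le> c * norm (t powr (- 1 + \<kappa> / q))"
      using key[OF \<eta>]
    proof eventually_elim
      case (elim t)
      then have "Lq_norm q (?A t) (\<lambda>x. g x t) \<le> \<eta> * C powr (1 / q) * t powr (- 1 + \<kappa> / q)" by simp
      also have "\<dots> \<le> c * t powr (- 1 + \<kappa> / q)" using \<eta>c by (intro mult_right_mono) auto
      finally show ?case unfolding Lq_norm_def by simp
    qed
  qed
  then show ?thesis unfolding Lq_rate_def using key[of 1] by (auto elim: eventually_mono)
qed

text \<open>An N-wave is an arbitrary function where it is left unspecified, so measurability can
  only be assembled from pieces on which the deviation is known or which are single points.\<close>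

lemma set_borel_measurable_countable_pieces:
  fixes g :: "real \<Rightarrow> real"
  assumes "countable P" and sets: "\<And>S. S \<in> P \<Longrightarrow> S \<in> sets lebesgue"
    and h: "\<And>S. S \<in> P \<Longrightarrow> \<exists>h\<in>borel_measurable lebesgue. \<forall>x\<in>S. g x = h x"
  shows "set_borel_measurable lebesgue (\<Union>P) g"
  unfolding set_borel_measurable_def
proof (rule measurable_piecewise_restrict2)
  let ?Q = "insert (- \<Union>P) P"
  have UP: "\<Union>P \<in> sets lebesgue" using assms by (intro sets.countable_Union) auto
  then have "- \<Union>P \<in> sets lebesgue" using sets.compl_sets[OF UP] by (simp add: Compl_eq_Diff_UNIV)
  then have Q: "S \<in> sets lebesgue" if "S \<in> ?Q" for S using that sets by auto
  have cQ: "countable ?Q" "?Q \<noteq> {}" using assms(1) by auto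
  have n: "from_nat_into ?Q n \<in> ?Q" for n using from_nat_into[OF cQ(2)] .
  show "from_nat_into ?Q n \<in> sets lebesgue" for n using Q n by blast
  show "space lebesgue = (\<Union>n. from_nat_into ?Q n)"
    using range_from_nat_into[OF cQ(2,1)] by auto
  show "\<exists>h\<in>borel_measurable lebesgue. \<forall>x\<in>from_nat_into ?Q n. indicat_real (\<Union>P) x *\<^sub>R g x = h x" for n
  proof (cases "from_nat_into ?Q n \<in> P")
    case True
    then obtain h where h: "h \<in> borel_measurable lebesgue" "\<forall>x\<in>from_nat_into ?Q n. g x = h x" using h by blast
    have "x \<in> \<Union>P" if "x \<in> from_nat_into ?Q n" for x using that True by blast
    then have "indicat_real (\<Union>P) x = 1" if "x \<in> from_nat_into ?Q n" for x using that by (metis indicator_simps(1))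
    with h show ?thesis by (intro bexI[of _ h]) auto
  next
    case False
    then have "from_nat_into ?Q n = - \<Union>P" using n[of n] by blast
    then show ?thesis by (intro bexI[of _ "\<lambda>_. 0"]) auto
  qed
qed

lemma set_borel_measurable_Icc:
  fixes g :: "real \<Rightarrow> real"
  assumes "h \<in> borel_measurable lebesgue" "\<And>x. a < x \<Longrightarrow> x < b \<Longrightarrow> g x = h x"
  shows "set_borel_measurable lebesgue {a..b} g"
proof -
  have "set_borel_measurable lebesgue (\<Union>{{a<..<b}, {a}, {b}}) g"
    by (rule set_borel_measurable_countable_pieces) (use assms in \<open>auto intro: bexI[of _ h] bexI[of _ "\<lambda>_. g a"] bexI[of _ "\<lambda>_. g b"]\<close>)
  then show ?thesis by (rule set_borel_measurable_subset) auto
qed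

section \<open>Gaps between divides\<close>

lemma ident_measurable_lebesgue: "(\<lambda>x::real. x) \<in> borel_measurable lebesgue"
  by (intro measurable_completion) simp

context hopf_lax
begin

text \<open>Minimizers stay within \<plusminus>\<open>B\<close>, and the states up to
  \<open>B + 1\<close> and down to \<open>- B - 1\<close> provide a margin \<open>r\<close> of
  attained speeds. Once \<open>t > L / r\<close> the perturbed speed is attained, so
  \<open>inv f'\<close> in the N-wave is a true inverse.\<close>

lemma speed_range:
  shows "\<forall>\<^sub>F t in at_top. \<forall>u y. - B \<le> u \<and> u \<le> B \<and> \<bar>y\<bar> \<le> L \<longrightarrow> f' u + y / t \<in> range f'"
proof -
  define r where "r = min (f' (B + 1) - f' B) (f' (- B) - f' (- B - 1))"
  have r: "r > 0" using f'_less[of B "B + 1"] f'_less[of "- B - 1" "- B"] unfolding r_def by simp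
  show ?thesis
    using eventually_gt_at_top[of 0] eventually_gt_at_top[of "L / r"]
  proof eventually_elim
    case (elim t)
    show ?case
    proof (intro allI impI)
      fix u y assume *: "- B \<le> u \<and> u \<le> B \<and> \<bar>y\<bar> \<le> L"
      have "\<bar>y / t\<bar> \<le> r" using elim r * by (simp add: field_simps)
      moreover have "f' (- B) \<le> f' u" "f' u \<le> f' B" using * f'_le by auto
      ultimately have "f' (- B - 1) \<le> f' u + y / t" "f' u + y / t \<le> f' (B + 1)" unfolding r_def by linarith+
      then obtain v where "f' v = f' u + y / t" by (rule f'_ivt)
      then show "f' u + y / t \<in> range f'" by (metis rangeI)
    qed
  qed
qed

lemma inv_f': "inv f' (f' v) = v"
  using smono by (simp add: strict_mono_imp_inj_on)

lemma gap_close: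
  assumes X: "char_from T X"
    and e: "supp c e" and h: "supp c h" and no: "\<And>y d. e < y \<Longrightarrow> y < h \<Longrightarrow> \<not> supp d y"
    and reg: "\<And>t. T \<le> t \<Longrightarrow> e + t * f' c < X t \<and> X t < h + t * f' c"
    and "\<eta> > 0"
  shows "\<forall>\<^sub>F t in at_top. \<forall>x. e + t * f' c < x \<and> x < h + t * f' c \<and> x \<noteq> X t \<longrightarrow>
    (\<forall>u\<in>M x t. \<bar>x - t * f' u - (if x < X t then e else h)\<bar> \<le> \<eta>)"
proof -
  have "\<forall>\<^sub>F t in at_top. foot_l (X t) t < e + \<eta>" "\<forall>\<^sub>F t in at_top. h - \<eta> < foot_r (X t) t"
    using order_tendstoD(2)[OF gap_feet(1)[OF X e h no reg], of "e + \<eta>"]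
      order_tendstoD(1)[OF gap_feet(2)[OF X e h no reg], of "h - \<eta>"] \<open>\<eta> > 0\<close> by auto
  then show ?thesis using eventually_gt_at_top[of 0]
  proof eventually_elim
    case (elim t)
    show ?case
    proof (intro allI impI ballI)
      fix x u assume x: "e + t * f' c < x \<and> x < h + t * f' c \<and> x \<noteq> X t" and u: "u \<in> M x t"
      have "e \<le> x - t * f' u" "x - t * f' u \<le> h"
        using feet_right_of_supports[OF elim(3) e _ u] feet_left_of_supports[OF elim(3) h _ u] x by auto
      moreover have "x - t * f' u \<le> foot_l (X t) t" if "x < X t"
        using foot_mono[OF elim(3) u Inf_minimizers(2)[OF elim(3)] that] unfolding foot_l_def .
      moreover have "foot_r (X t) t \<le> x - t * f' u" if "X t < x"
        using foot_mono[OF elim(3) Inf_minimizers(1)[OF elim(3)] u that] unfolding foot_r_def .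
      ultimately show "\<bar>x - t * f' u - (if x < X t then e else h)\<bar> \<le> \<eta>"
        using elim(1,2) x by (cases "x < X t") (auto simp: abs_le_iff)
    qed
  qed
qed

end

context conservation_law
begin

abbreviation "sol \<equiv> entropy_sol f' f'' \<phi>"
abbreviation "deviation w \<equiv> \<lambda>x t. f' (sol x t) - f' (w x t)"

text \<open>The foot is a nondecreasing function of \<open>x\<close>, hence Borel, and the speed is
  recovered from it.\<close>

lemma sol_measurable:
  assumes t: "t > 0"
  shows "(\<lambda>x. f' (sol x t)) \<in> borel_measurable lebesgue"
proof -
  have "mono (\<lambda>x. x - t * f' (sol x t))"
  proof (rule monoI)
    fix x y :: real assume "x \<le> y"
    then show "x - t * f' (sol x t) \<le> y - t * f' (sol y t)"
      using foot_mono[OF t entropy_sol_in[OF t] entropy_sol_in[OF t], of x y] by (cases "x = y") auto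
  qed
  then have "(\<lambda>x. x - t * f' (sol x t)) \<in> borel_measurable borel" by (rule borel_measurable_mono)
  then have "(\<lambda>x. (x - (x - t * f' (sol x t))) / t) \<in> borel_measurable borel" by measurable
  moreover have "(\<lambda>x. (x - (x - t * f' (sol x t))) / t) = (\<lambda>x. f' (sol x t))" using t by auto
  ultimately have "(\<lambda>x. f' (sol x t)) \<in> borel_measurable lborel" by simp
  then show ?thesis by (rule measurable_completion)
qed

lemma wave_difference:
  assumes "t > 0" "(x - z) / t \<in> range f'" "wx = inv f' ((x - z) / t)"
  shows "f' (sol x t) - f' wx = - (x - t * f' (sol x t) - z) / t"
  using assms by (simp add: f_inv_into_f field_simps)

text \<open>The N-wave is the fan centred at \<open>z\<close>. As the feet of the solution are near
  \<open>z\<close>, the fan speeds are eventually attained, and the deviation is the distance of the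
  feet divided by \<open>t\<close>.\<close>

lemma side_wave:
  assumes feet: "\<forall>\<^sub>F t in at_top. \<forall>x. l t < x \<and> x < r t \<longrightarrow> (\<forall>u\<in>M x t. \<bar>x - t * f' u - z\<bar> \<le> 1)"
    and w: "\<forall>\<^sub>F t in at_top. \<forall>x. l t < x \<and> x < r t \<longrightarrow> w x t = inv f' ((x - z) / t)"
  shows "\<forall>\<^sub>F t in at_top. set_borel_measurable lebesgue {l t..r t} (\<lambda>x. f' (sol x t) - f' (w x t)) \<and>
      (\<forall>x. l t < x \<and> x < r t \<longrightarrow> \<bar>f' (sol x t) - f' (w x t)\<bar> = \<bar>x - t * f' (sol x t) - z\<bar> / t)"
  using feet w eventually_gt_at_top[of 0] speed_range[of 1]
proof eventually_elim
  case (elim t)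
  have *: "(x - z) / t \<in> range f' \<and> f' (sol x t) - f' (w x t) = - (x - t * f' (sol x t) - z) / t"
    if x: "l t < x" "x < r t" for x
  proof -
    have u: "sol x t \<in> M x t" by (rule entropy_sol_in[OF elim(3)])
    have "(x - z) / t = f' (sol x t) + (x - t * f' (sol x t) - z) / t" using elim(3) by (simp add: field_simps)
    then have "(x - z) / t \<in> range f'"
      using elim(4)[rule_format, of "sol x t" "x - t * f' (sol x t) - z"] minimizers_bounded[OF elim(3) u] elim(1) x u by auto
    then show ?thesis using wave_difference[OF elim(3), of x z "w x t"] elim(2) x by blast
  qed
  have "(\<lambda>x. - (x - t * f' (sol x t) - z) / t) \<in> borel_measurable lebesgue"
    by (intro borel_measurable_divide borel_measurable_uminus borel_measurable_diff borel_measurable_times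
        borel_measurable_const ident_measurable_lebesgue sol_measurable elim(3))
  then have "set_borel_measurable lebesgue {l t..r t} (\<lambda>x. f' (sol x t) - f' (w x t))"
    by (rule set_borel_measurable_Icc) (use * in blast)
  moreover have "\<bar>f' (sol x t) - f' (w x t)\<bar> = \<bar>x - t * f' (sol x t) - z\<bar> / t" if "l t < x" "x < r t" for x
    using *[OF that] elim(3) by (simp add: abs_minus_commute)
  ultimately show ?case by blast
qed

lemma AE_not_endpoints: "AE x in lebesgue. x \<noteq> a \<and> x \<noteq> (b::real)"
proof -
  have "negligible {a, b}" by simp
  then have "{a, b} \<in> null_sets lebesgue" by (simp add: negligible_iff_null_sets)
  from AE_I'[OF this, of "\<lambda>x. x \<noteq> a \<and> x \<noteq> b"] show ?thesis by auto
qed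

lemma side_decays:
  assumes feet: "\<And>\<eta>. \<eta> > 0 \<Longrightarrow> \<forall>\<^sub>F t in at_top. \<forall>x. l t < x \<and> x < r t \<longrightarrow> (\<forall>u\<in>M x t. \<bar>x - t * f' u - z\<bar> \<le> \<eta>)"
    and w: "\<forall>\<^sub>F t in at_top. \<forall>x. l t < x \<and> x < r t \<longrightarrow> w x t = inv f' ((x - z) / t)"
    and C: "C \<ge> 0" "\<forall>\<^sub>F t in at_top. r t - l t \<le> C * t powr \<kappa>"
  shows "decays_on (\<lambda>t. {l t..r t}) (deviation w) \<kappa>"
proof -
  note S = side_wave[OF feet[OF zero_less_one] w]
  have "\<forall>\<^sub>F t in at_top. concentrated {l t..r t} (\<lambda>x. deviation w x t) (C * t powr \<kappa>) (\<eta> / t)" if "\<eta> > 0" for \<eta>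
    using S feet[OF that] C(2) eventually_gt_at_top[of 0]
  proof eventually_elim
    case (elim t)
    note diff = elim(1)[THEN conjunct2, rule_format] and near = elim(2)[rule_format] and t = elim(4)
    have "emeasure lebesgue {l t<..<r t} \<le> ennreal (C * t powr \<kappa>)"
      using elim(3) by (cases "l t \<le> r t") (auto intro: ennreal_leI)
    moreover have "AE x in lebesgue. x \<in> {l t..r t} \<longrightarrow> \<bar>f' (sol x t) - f' (w x t)\<bar> \<le> (if x \<in> {l t<..<r t} then \<eta> / t else 0)"
      using AE_not_endpoints[of "l t" "r t"]
    proof eventually_elim
      case (elim x)
      show ?case
      proof
        assume "x \<in> {l t..r t}"
        then have x: "l t < x" "x < r t" using elim by auto
        have "\<bar>x - t * f' (sol x t) - z\<bar> / t \<le> \<eta> / t"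
          using near x entropy_sol_in[OF t] t by (intro divide_right_mono) auto
        then show "\<bar>f' (sol x t) - f' (w x t)\<bar> \<le> (if x \<in> {l t<..<r t} then \<eta> / t else 0)"
          using diff x by simp
      qed
    qed
    ultimately show ?case
      unfolding concentrated_def by (intro bexI[where x = "{l t<..<r t}"] conjI) (assumption | simp)+
  qed
  moreover have "\<forall>\<^sub>F t in at_top. {l t..r t} \<in> sets lebesgue \<and>
      set_borel_measurable lebesgue {l t..r t} (\<lambda>x. f' (sol x t) - f' (w x t))"
    using S by eventually_elim simp
  ultimately show ?thesis unfolding decays_on_def using C(1) by blast
qed

text \<open>With equal feet the deviation vanishes off the end points, so the exceptional set is
  empty and \<kappa> is arbitrary, whatever the width.\<close>

lemma side_decays_exact:
  assumes feet: "\<forall>\<^sub>F t in at_top. \<forall>x. l t < x \<and> x < r t \<longrightarrow> (\<forall>u\<in>M x t. x - t * f' u = z)"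
    and w: "\<forall>\<^sub>F t in at_top. \<forall>x. l t < x \<and> x < r t \<longrightarrow> w x t = inv f' ((x - z) / t)"
  shows "decays_on (\<lambda>t. {l t..r t}) (deviation w) \<kappa>"
proof -
  have "\<forall>\<^sub>F t in at_top. \<forall>x. l t < x \<and> x < r t \<longrightarrow> (\<forall>u\<in>M x t. \<bar>x - t * f' u - z\<bar> \<le> 1)"
    using feet by eventually_elim simp
  note S = side_wave[OF this w]
  have "\<forall>\<^sub>F t in at_top. concentrated {l t..r t} (\<lambda>x. deviation w x t) (0 * t powr \<kappa>) (\<eta> / t)" for \<eta>
    using S feet eventually_gt_at_top[of 0]
  proof eventually_elim
    case (elim t)
    have zero: "\<bar>f' (sol x t) - f' (w x t)\<bar> = 0" if "l t < x" "x < r t" for x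
      using elim that entropy_sol_in[OF elim(3), of x] by simp
    have "AE x in lebesgue. x \<in> {l t..r t} \<longrightarrow> \<bar>f' (sol x t) - f' (w x t)\<bar> \<le> (if x \<in> {} then \<eta> / t else 0)"
      using AE_not_endpoints[of "l t" "r t"]
    proof eventually_elim
      case (elim x)
      then show ?case using zero[of x] by auto
    qed
    then show ?case unfolding concentrated_def by (intro bexI[of _ "{}"]) auto
  qed
  moreover have "\<forall>\<^sub>F t in at_top. {l t..r t} \<in> sets lebesgue \<and>
      set_borel_measurable lebesgue {l t..r t} (\<lambda>x. f' (sol x t) - f' (w x t))"
    using S by eventually_elim simp
  ultimately show ?thesis unfolding decays_on_def by blast
qed

definition gaps :: "real \<Rightarrow> real \<Rightarrow> (real \<times> real) set" where
  "gaps a b = {(e, h). bounded_gap \<phi> e h \<and> a \<le> e \<and> h \<le> b}"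

lemma bounded_gap_supports:
  assumes "bounded_gap \<phi> e h"
  shows "supp (gap_slope \<phi> e h) e" "supp (gap_slope \<phi> e h) h" "e < h"
    "\<And>y d. e < y \<Longrightarrow> y < h \<Longrightarrow> \<not> supp d y"
proof -
  have g: "e < h" "\<exists>c. supp c e" "\<exists>c. supp c h" and no: "\<And>y d. e < y \<Longrightarrow> y < h \<Longrightarrow> \<not> supp d y"
    using assms unfolding bounded_gap_iff by auto
  obtain s r where s: "supp s e" "supp r h" using g by auto
  show "supp (gap_slope \<phi> e h) e" "supp (gap_slope \<phi> e h) h"
    unfolding gap_slope_def by (rule gap_slope_supports[OF g(1) s no]; assumption)+
  show "e < h" by (rule g)
  show "\<And>y d. e < y \<Longrightarrow> y < h \<Longrightarrow> \<not> supp d y" by (rule no)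
qed

lemma bounded_gap_disjoint:
  assumes "bounded_gap \<phi> e h" "bounded_gap \<phi> e' h'" "(e, h) \<noteq> (e', h')"
  shows "h \<le> e' \<or> h' \<le> e"
proof -
  note g = bounded_gap_supports[OF assms(1)] and g' = bounded_gap_supports[OF assms(2)]
  consider "e < e'" | "e' < e" | "e = e'" "h < h'" | "e = e'" "h' < h" using assms(3) by fastforce
  then show ?thesis
  proof cases
    case 1
    then show ?thesis using g(4)[of e' "gap_slope \<phi> e' h'"] g'(1) by force
  next
    case 2
    then show ?thesis using g'(4)[of e "gap_slope \<phi> e h"] g(1) by force
  next
    case 3
    then show ?thesis using g'(4)[of h "gap_slope \<phi> e h"] g(2,3) by force
  next
    case 4
    then show ?thesis using g(4)[of h' "gap_slope \<phi> e' h'"] g'(2,3) by force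
  qed
qed

text \<open>Left ends of disjoint gaps of width at least \<eta> are at least \<eta> apart, so the
  integer parts of \<open>e / \<eta>\<close> are distinct; they lie in a finite range.\<close>

lemma finite_large_gaps:
  assumes "\<eta> > 0"
  shows "finite {(e, h) \<in> gaps a b. \<eta> \<le> h - e}"
proof (rule inj_on_finite)
  show "inj_on (\<lambda>(e, h). \<lfloor>e / \<eta>\<rfloor>) {(e, h) \<in> gaps a b. \<eta> \<le> h - e}"
  proof (rule inj_onI, clarify)
    fix e h e' h'
    assume *: "(e, h) \<in> gaps a b" "\<eta> \<le> h - e" "(e', h') \<in> gaps a b" "\<eta> \<le> h' - e'" "\<lfloor>e / \<eta>\<rfloor> = \<lfloor>e' / \<eta>\<rfloor>"
    have "\<bar>e / \<eta> - e' / \<eta>\<bar> < 1" using *(5) by linarith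
    then have "\<bar>(e - e') / \<eta>\<bar> < 1" by (simp add: diff_divide_distrib)
    then have "\<bar>e - e'\<bar> < \<eta>" using assms by (simp add: abs_divide)
    then have "\<not> (h \<le> e' \<or> h' \<le> e)" using *(2,4) by linarith
    moreover have "bounded_gap \<phi> e h" "bounded_gap \<phi> e' h'" using *(1,3) unfolding gaps_def by auto
    ultimately have "(e, h) = (e', h')" using bounded_gap_disjoint by blast
    then show "e = e' \<and> h = h'" by simp
  qed
  show "(\<lambda>(e, h). \<lfloor>e / \<eta>\<rfloor>) ` {(e, h) \<in> gaps a b. \<eta> \<le> h - e} \<subseteq> {\<lfloor>a / \<eta>\<rfloor>..\<lfloor>b / \<eta>\<rfloor>}"
  proof clarify
    fix e h assume "(e, h) \<in> gaps a b"
    then have "a \<le> e" "e \<le> b" using bounded_gap_supports(3)[of e h] unfolding gaps_def by auto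
    then show "\<lfloor>e / \<eta>\<rfloor> \<in> {\<lfloor>a / \<eta>\<rfloor>..\<lfloor>b / \<eta>\<rfloor>}" using assms by (simp add: floor_mono divide_right_mono)
  qed
qed simp

lemma countable_gaps: "countable (gaps a b)"
proof -
  have "gaps a b \<subseteq> (\<Union>n. {(e, h) \<in> gaps a b. inverse (real (Suc n)) \<le> h - e})"
  proof clarify
    fix e h assume "(e, h) \<in> gaps a b"
    then have "0 < h - e" using bounded_gap_supports(3) unfolding gaps_def by force
    then obtain n where "inverse (real (Suc n)) < h - e" using reals_Archimedean by blast
    then have "(e, h) \<in> {(e, h) \<in> gaps a b. inverse (real (Suc n)) \<le> h - e}"
      using \<open>(e, h) \<in> gaps a b\<close> by simp
    then show "(e, h) \<in> (\<Union>n. {(e, h) \<in> gaps a b. inverse (real (Suc n)) \<le> h - e})" by blast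
  qed
  moreover have "countable (\<Union>n. {(e, h) \<in> gaps a b. inverse (real (Suc n)) \<le> h - e})"
    by (rule countable_UN, simp, rule countable_finite, rule finite_large_gaps) (simp del: of_nat_Suc)
  ultimately show ?thesis by (rule countable_subset)
qed

definition gap_fiber :: "real \<Rightarrow> real \<times> real \<Rightarrow> real set" where
  "gap_fiber t = (\<lambda>(e, h). {e + t * f' (gap_slope \<phi> e h)<..<h + t * f' (gap_slope \<phi> e h)})"

text \<open>At time \<open>t\<close> each gap is translated by \<open>t\<close> times the speed of
  its slope. Slopes increase from left to right, so the translates remain disjoint, and their total
  width is that of the gaps.\<close>

lemma emeasure_gap_fibers:
  assumes "a \<le> b" "t > 0"
  shows "emeasure lebesgue (\<Union>(gap_fiber t ` gaps a b)) \<le> ennreal (b - a)"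
proof -
  let ?I = "\<lambda>(e, h). {e<..<h}"
  have pair: "((e, h) = (e', h')) \<or> (h \<le> e' \<and> h + t * f' (gap_slope \<phi> e h) \<le> e' + t * f' (gap_slope \<phi> e' h')) \<or>
     (h' \<le> e \<and> h' + t * f' (gap_slope \<phi> e' h') \<le> e + t * f' (gap_slope \<phi> e h))"
    if g: "bounded_gap \<phi> e h" and g': "bounded_gap \<phi> e' h'" for e h e' h'
  proof -
    have "h + t * f' (gap_slope \<phi> e h) \<le> e' + t * f' (gap_slope \<phi> e' h')"
      if g: "bounded_gap \<phi> e h" and g': "bounded_gap \<phi> e' h'" and le: "h \<le> e'" for e h e' h'
    proof -
      note b = bounded_gap_supports[OF g] and b' = bounded_gap_supports[OF g']
      have "gap_slope \<phi> e h \<le> gap_slope \<phi> e' h'" using supports_mono[OF b(1) b'(2)] b(3) b'(3) le by simp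
      then have "t * f' (gap_slope \<phi> e h) \<le> t * f' (gap_slope \<phi> e' h')" using \<open>t > 0\<close> f'_le by simp
      then show ?thesis using le by simp
    qed
    then show ?thesis using bounded_gap_disjoint[OF g g'] g g' by blast
  qed
  have d1: "disjoint_family_on (gap_fiber t) (gaps a b)"
    unfolding disjoint_family_on_def
  proof (intro ballI impI)
    fix i j assume "i \<in> gaps a b" "j \<in> gaps a b" "i \<noteq> j"
    moreover obtain e h e' h' where "i = (e, h)" "j = (e', h')" by (metis surj_pair)
    ultimately show "gap_fiber t i \<inter> gap_fiber t j = {}"
      using pair[of e h e' h'] unfolding gaps_def gap_fiber_def by fastforce
  qed
  have d2: "disjoint_family_on ?I (gaps a b)"
    unfolding disjoint_family_on_def
  proof (intro ballI impI)
    fix i j assume "i \<in> gaps a b" "j \<in> gaps a b" "i \<noteq> j"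
    moreover obtain e h e' h' where "i = (e, h)" "j = (e', h')" by (metis surj_pair)
    ultimately show "?I i \<inter> ?I j = {}"
      using pair[of e h e' h'] unfolding gaps_def by fastforce
  qed
  have "emeasure lebesgue (\<Union>(gap_fiber t ` gaps a b)) = (\<integral>\<^sup>+i. emeasure lebesgue (gap_fiber t i) \<partial>count_space (gaps a b))"
    by (intro emeasure_UN_countable countable_gaps d1) (auto simp: gap_fiber_def)
  also have "\<dots> = (\<integral>\<^sup>+i. emeasure lebesgue (?I i) \<partial>count_space (gaps a b))"
  proof (rule nn_integral_cong)
    fix i assume "i \<in> space (count_space (gaps a b))"
    then obtain e h where "i = (e, h)" "e < h" using bounded_gap_supports(3) unfolding gaps_def by auto
    then show "emeasure lebesgue (gap_fiber t i) = emeasure lebesgue (?I i)" unfolding gap_fiber_def by simp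
  qed
  also have "\<dots> = emeasure lebesgue (\<Union>(?I ` gaps a b))"
    by (intro emeasure_UN_countable[symmetric] countable_gaps d2) auto
  also have "\<dots> \<le> emeasure lebesgue {a..b}"
    by (intro emeasure_mono) (auto simp: gaps_def)
  also have "\<dots> = ennreal (b - a)" using assms by simp
  finally show ?thesis .
qed

text \<open>A point of the strip outside all gap regions lies on a divide, where solution and N-wave
  both take the value of its slope.\<close>

lemma off_gaps:
  assumes wdiv: "\<And>c y. supp c y \<Longrightarrow> w (y + t * f' c) t = c"
    and t: "t > 0" and s: "supp c1 y1" "supp c2 y2" "y1 \<le> y2"
    and x: "y1 + t * f' c1 \<le> x" "x \<le> y2 + t * f' c2" "x \<notin> \<Union>(gap_fiber t ` gaps y1 y2)"
  shows "f' (sol x t) - f' (w x t) = 0"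
proof -
  have "\<exists>c y. supp c y \<and> x = y + t * f' c"
  proof (rule ccontr)
    assume "\<nexists>c y. supp c y \<and> x = y + t * f' c"
    then obtain e h where g: "y1 \<le> e" "e < h" "h \<le> y2" "\<exists>c. supp c e" "\<exists>c. supp c h" "\<forall>y d. e < y \<and> y < h \<longrightarrow> \<not> supp d y"
      and xe: "e + t * f' (gap_slope \<phi> e h) < x" "x < h + t * f' (gap_slope \<phi> e h)"
      using strip_cover[OF s t x(1,2)] unfolding gap_slope_def by blast
    have "(e, h) \<in> gaps y1 y2" using g unfolding gaps_def bounded_gap_iff by simp
    moreover have "x \<in> gap_fiber t (e, h)" using xe unfolding gap_fiber_def by simp
    ultimately show False using x(3) by blast
  qed
  then obtain c y where c: "supp c y" "x = y + t * f' c" by blast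
  have "sol x t = c" using entropy_sol_in[OF t, of x] minimizers_supports[OF t c(1)] c(2) by simp
  moreover have "w x t = c" using wdiv[OF c(1)] c(2) by simp
  ultimately show ?thesis by simp
qed

lemma gap_foot_bounds:
  assumes "bounded_gap \<phi> e h" "t > 0" "x \<in> gap_fiber t (e, h)" "u \<in> M x t"
  shows "e \<le> x - t * f' u" "x - t * f' u \<le> h"
proof -
  have x: "e + t * f' (gap_slope \<phi> e h) < x" "x < h + t * f' (gap_slope \<phi> e h)"
    using assms(3) unfolding gap_fiber_def by auto
  show "e \<le> x - t * f' u"
    by (rule feet_right_of_supports[OF assms(2) bounded_gap_supports(1)[OF assms(1)] x(1) assms(4)])
  show "x - t * f' u \<le> h"
    by (rule feet_left_of_supports[OF assms(2) bounded_gap_supports(2)[OF assms(1)] x(2) assms(4)])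
qed

lemma gap_region_char:
  assumes "bounded_gap \<phi> e h" "fwd_char f' f'' \<phi> t0 X" "runs_in t0 X (gap_region f' \<phi> e h)" "t0 + 1 \<le> t"
  shows "e + t * f' (gap_slope \<phi> e h) < X t \<and> X t < h + t * f' (gap_slope \<phi> e h)"
proof -
  have "0 < t" "t0 \<le> t" using fwd_char_imp_char_from(1)[OF assms(2)] assms(4) by auto
  then have "(X t, t) \<in> gap_region f' \<phi> e h" using assms(3) unfolding runs_in_def by blast
  then show ?thesis unfolding gap_region_def by simp
qed

text \<open>The exponent is 0 because the total width of the gap regions does not grow. The bound is
  uniform over the gaps: the finitely many wide ones are treated one at a time, the narrow ones by
  their width.\<close>

lemma strip_decays:
  assumes w: "gen_N_wave f' f'' \<phi> w" and s: "supp c1 y1" "supp c2 y2" "y1 \<le> y2"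
  shows "decays_on (\<lambda>t. {y1 + t * f' c1..y2 + t * f' c2}) (deviation w) 0"
proof -
  define Q where "Q e h X \<longleftrightarrow> fwd_char f' f'' \<phi> 0 X \<and> runs_in 0 X (gap_region f' \<phi> e h) \<and>
          (\<forall>x t. t > 0 \<longrightarrow>
             (e + t * f' (gap_slope \<phi> e h) < x \<and> x < X t \<longrightarrow> w x t = inv f' ((x - e) / t)) \<and>
             (X t < x \<and> x < h + t * f' (gap_slope \<phi> e h) \<longrightarrow> w x t = inv f' ((x - h) / t)))" for e h X
  \<comment> \<open>An N-wave provides a characteristic for each gap separately; they are chosen all
    at once here.\<close>
  define X where "X e h = (SOME X. Q e h X)" for e h
  have Q: "Q e h (X e h)" if "bounded_gap \<phi> e h" for e h
    unfolding X_def
    using w[unfolded gen_N_wave_def, THEN conjunct2, THEN conjunct1, folded Q_def, rule_format, OF that]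
    by (rule someI_ex)
  have wdiv: "w (y + t * f' c) t = c" if "supp c y" "t > 0" for c y t
  proof -
    have "(y + t * f' c, t) \<in> ray f' c y" using that unfolding ray_def by simp
    then have "w (y + t * f' c) t = inv f' ((y + t * f' c - y) / t)"
      using w[unfolded gen_N_wave_def, THEN conjunct1] that(1) is_divide_iff by blast
    then show ?thesis using that inv_f' by simp
  qed
  define z where "z e h x t = (if x < X e h t then e else h)" for e h x t
  have char: "char_from 1 (X e h)" if "bounded_gap \<phi> e h" for e h
    using fwd_char_imp_char_from(2)[of 0 "X e h"] Q[OF that] unfolding Q_def by simp
  have close: "\<forall>\<^sub>F t in at_top. \<forall>(e, h) \<in> gaps y1 y2. \<forall>x\<in>gap_fiber t (e, h). x \<noteq> X e h t \<longrightarrow>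
      \<bar>x - t * f' (sol x t) - z e h x t\<bar> \<le> \<eta>" if "\<eta> > 0" for \<eta>
  proof -
    have "\<forall>\<^sub>F t in at_top. \<forall>i \<in> {(e, h) \<in> gaps y1 y2. \<eta> \<le> h - e}. \<forall>x\<in>gap_fiber t i. x \<noteq> X (fst i) (snd i) t \<longrightarrow>
      \<bar>x - t * f' (sol x t) - z (fst i) (snd i) x t\<bar> \<le> \<eta>"
    proof (rule eventually_ball_finite[OF finite_large_gaps[OF that]], clarify)
      fix e h assume "(e, h) \<in> gaps y1 y2"
      then have g: "bounded_gap \<phi> e h" unfolding gaps_def by simp
      have reg: "e + t * f' (gap_slope \<phi> e h) < X e h t \<and> X e h t < h + t * f' (gap_slope \<phi> e h)" if "1 \<le> t" for t
        using gap_region_char[OF g, of 0 "X e h" t] Q[OF g] that unfolding Q_def by simp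
      note gs = bounded_gap_supports[OF g]
      have "\<forall>\<^sub>F t in at_top. \<forall>x. e + t * f' (gap_slope \<phi> e h) < x \<and> x < h + t * f' (gap_slope \<phi> e h) \<and> x \<noteq> X e h t \<longrightarrow>
          (\<forall>u\<in>M x t. \<bar>x - t * f' u - (if x < X e h t then e else h)\<bar> \<le> \<eta>)"
        by (rule gap_close[OF char[OF g] gs(1,2)]) (use gs(4) reg \<open>\<eta> > 0\<close> in auto)
      then show "\<forall>\<^sub>F t in at_top. \<forall>x\<in>gap_fiber t (e, h). x \<noteq> X (fst (e, h)) (snd (e, h)) t \<longrightarrow>
         \<bar>x - t * f' (sol x t) - z (fst (e, h)) (snd (e, h)) x t\<bar> \<le> \<eta>"
        using eventually_gt_at_top[of 0]
      proof eventually_elim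
        case (elim t)
        then show ?case using entropy_sol_in[OF elim(2)] unfolding z_def gap_fiber_def by auto
      qed
    qed
    then show ?thesis using eventually_gt_at_top[of 0]
    proof eventually_elim
      case (elim t)
      show ?case
      proof clarify
        fix e h x assume *: "(e, h) \<in> gaps y1 y2" "x \<in> gap_fiber t (e, h)" "x \<noteq> X e h t"
        then have g: "bounded_gap \<phi> e h" unfolding gaps_def by simp
        show "\<bar>x - t * f' (sol x t) - z e h x t\<bar> \<le> \<eta>"
        \<comment> \<open>In a narrow gap the foot of the solution and the foot \<open>z\<close> of
          the N-wave both lie in \<open>{e..h}\<close>, so their distance is below \<eta> without
          any limit.\<close>
        proof (cases "\<eta> \<le> h - e")
          case True
          then show ?thesis using elim(1) * by force
        next
          case False
          then show ?thesis using gap_foot_bounds[OF g elim(2) *(2) entropy_sol_in[OF elim(2)]]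
            unfolding z_def by auto
        qed
      qed
    qed
  qed
  have diff: "\<forall>\<^sub>F t in at_top. \<forall>(e, h) \<in> gaps y1 y2. \<forall>x\<in>gap_fiber t (e, h). x \<noteq> X e h t \<longrightarrow>
      f' (sol x t) - f' (w x t) = - (x - t * f' (sol x t) - z e h x t) / t"
    using speed_range[of "y2 - y1"] eventually_gt_at_top[of 0]
  proof eventually_elim
    case (elim t)
    show ?case
    proof clarify
      fix e h x assume *: "(e, h) \<in> gaps y1 y2" "x \<in> gap_fiber t (e, h)" "x \<noteq> X e h t"
      then have g: "bounded_gap \<phi> e h" "h - e \<le> y2 - y1" unfolding gaps_def by auto
      have u: "sol x t \<in> M x t" using entropy_sol_in[OF elim(2)] .
      have "\<bar>x - t * f' (sol x t) - z e h x t\<bar> \<le> y2 - y1"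
        using gap_foot_bounds[OF g(1) elim(2) *(2) u] g(2) unfolding z_def by auto
      then have "f' (sol x t) + (x - t * f' (sol x t) - z e h x t) / t \<in> range f'"
        using elim(1) minimizers_bounded[OF elim(2) u] by blast
      moreover have "f' (sol x t) + (x - t * f' (sol x t) - z e h x t) / t = (x - z e h x t) / t"
        using elim(2) by (simp add: field_simps)
      ultimately have "(x - z e h x t) / t \<in> range f'" by simp
      moreover have "w x t = inv f' ((x - z e h x t) / t)"
        using Q[OF g(1)] *(2,3) elim(2) unfolding Q_def z_def gap_fiber_def by auto
      ultimately show "f' (sol x t) - f' (w x t) = - (x - t * f' (sol x t) - z e h x t) / t"
        by (rule wave_difference[OF elim(2)])
    qed
  qed
  let ?S = "\<lambda>t. {y1 + t * f' c1..y2 + t * f' c2}"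
  let ?U = "\<lambda>t. \<Union>(gap_fiber t ` gaps y1 y2)"
  have fib: "gap_fiber t i \<in> sets lebesgue" for t i unfolding gap_fiber_def by (cases i) simp
  have U: "?U t \<in> sets lebesgue" for t
    by (rule sets.countable_UN'[OF countable_gaps]) (use fib in auto)
  have meas: "\<forall>\<^sub>F t in at_top. ?S t \<in> sets lebesgue \<and> set_borel_measurable lebesgue (?S t) (\<lambda>x. f' (sol x t) - f' (w x t))"
    using diff eventually_gt_at_top[of 0]
  proof eventually_elim
    case (elim t)
    \<comment> \<open>On either side of its characteristic the deviation in a gap is explicit in
      \<open>sol\<close>; on the characteristic itself \<open>w\<close> is unspecified, so that
      point is a piece of its own.\<close>
    define pieces where "pieces = (\<lambda>(e, h). {gap_fiber t (e, h) \<inter> {..<X e h t}, {X e h t}, gap_fiber t (e, h) \<inter> {X e h t<..}})"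
    define P where "P = insert (?S t - ?U t) (\<Union>(pieces ` gaps y1 y2))"
    have "set_borel_measurable lebesgue (\<Union>P) (\<lambda>x. f' (sol x t) - f' (w x t))"
    proof (rule set_borel_measurable_countable_pieces)
      show "countable P" unfolding P_def pieces_def by (auto intro!: countable_gaps)
      fix A assume A: "A \<in> P"
      show "A \<in> sets lebesgue"
        using A U fib unfolding P_def pieces_def by auto
      consider "A = ?S t - ?U t" | e h where "(e, h) \<in> gaps y1 y2" "A \<in> pieces (e, h)"
        using A unfolding P_def by auto
      then show "\<exists>k\<in>borel_measurable lebesgue. \<forall>x\<in>A. f' (sol x t) - f' (w x t) = k x"
      proof cases
        case 1
        then have "\<forall>x\<in>A. f' (sol x t) - f' (w x t) = 0"
          using off_gaps[of w t, OF wdiv[OF _ elim(2)] elim(2) s] by auto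
        then show ?thesis by (intro bexI[of _ "\<lambda>_. 0"]) auto
      next
        case 2
        have m: "(\<lambda>x. - (x - t * f' (sol x t) - y) / t) \<in> borel_measurable lebesgue" for y
          by (intro borel_measurable_divide borel_measurable_uminus borel_measurable_diff borel_measurable_times
              borel_measurable_const ident_measurable_lebesgue sol_measurable elim(2))
        have d: "f' (sol x t) - f' (w x t) = - (x - t * f' (sol x t) - z e h x t) / t"
          if "x \<in> gap_fiber t (e, h)" "x \<noteq> X e h t" for x using elim(1) 2(1) that by blast
        from 2(2) consider "A = gap_fiber t (e, h) \<inter> {..<X e h t}" | "A = {X e h t}" | "A = gap_fiber t (e, h) \<inter> {X e h t<..}"
          unfolding pieces_def by auto
        then show ?thesis
        proof cases
          case 1
          then show ?thesis using d unfolding z_def by (intro bexI[OF _ m[of e]]) auto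
        next
          case 2
          then show ?thesis by (intro bexI[of _ "\<lambda>_. f' (sol (X e h t) t) - f' (w (X e h t) t)"]) auto
        next
          case 3
          then show ?thesis using d unfolding z_def by (intro bexI[OF _ m[of h]]) auto
        qed
      qed
    qed
    moreover have "?S t \<subseteq> \<Union>P"
    proof
      fix x assume "x \<in> ?S t"
      show "x \<in> \<Union>P"
      proof (cases "x \<in> ?U t")
        case True
        then obtain e h where i: "(e, h) \<in> gaps y1 y2" "x \<in> gap_fiber t (e, h)" by auto
        then have "x \<in> \<Union>(pieces (e, h))" unfolding pieces_def by (cases "x < X e h t"; cases "x = X e h t") auto
        then show ?thesis using i unfolding P_def by blast
      next
        case False
        then show ?thesis using \<open>x \<in> ?S t\<close> unfolding P_def by blast
      qed
    qed
    ultimately show ?case by (simp add: set_borel_measurable_subset)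
  qed
  have "\<forall>\<^sub>F t in at_top. concentrated (?S t) (\<lambda>x. deviation w x t) ((y2 - y1) * t powr 0) (\<eta> / t)" if "\<eta> > 0" for \<eta>
    using close[OF that] diff eventually_gt_at_top[of 0]
  proof eventually_elim
    case (elim t)
    \<comment> \<open>The points at which \<open>w\<close> is unspecified: one for each gap, hence
      countably many.\<close>
    define N where "N = (\<lambda>(e, h). X e h t) ` gaps y1 y2"
    have N: "N \<in> null_sets lebesgue"
      unfolding N_def by (intro null_sets_completionI countable_imp_null_set_lborel countable_image countable_gaps)
    have bound: "\<bar>f' (sol x t) - f' (w x t)\<bar> \<le> (if x \<in> ?U t then \<eta> / t else 0)" if "x \<in> ?S t" "x \<notin> N" for x
    proof (cases "x \<in> ?U t")
      case True
      then obtain e h where i: "(e, h) \<in> gaps y1 y2" "x \<in> gap_fiber t (e, h)" by auto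
      then have ne: "x \<noteq> X e h t" using \<open>x \<notin> N\<close> unfolding N_def by force
      have "f' (sol x t) - f' (w x t) = - (x - t * f' (sol x t) - z e h x t) / t"
        and close: "\<bar>x - t * f' (sol x t) - z e h x t\<bar> \<le> \<eta>"
        using bspec[OF elim(2) i(1)] bspec[OF elim(1) i(1)] i(2) ne by auto
      then have "\<bar>f' (sol x t) - f' (w x t)\<bar> = \<bar>x - t * f' (sol x t) - z e h x t\<bar> / t"
        using elim(3) by (simp add: abs_minus_commute)
      also have "\<dots> \<le> \<eta> / t" using close elim(3) by (intro divide_right_mono) auto
      finally show ?thesis using True by simp
    next
      case False
      then show ?thesis using off_gaps[of w t, OF wdiv[OF _ elim(3)] elim(3) s _ _ False] that by simp
    qed
    have "AE x in lebesgue. x \<in> ?S t \<longrightarrow> \<bar>f' (sol x t) - f' (w x t)\<bar> \<le> (if x \<in> ?U t then \<eta> / t else 0)"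
      by (rule AE_I'[OF N]) (use bound in blast)
    moreover have "emeasure lebesgue (?U t) \<le> ennreal ((y2 - y1) * t powr 0)"
      using emeasure_gap_fibers[OF s(3) elim(3)] elim(3) by simp
    ultimately show ?case unfolding concentrated_def by (intro bexI[OF _ U[of t]] conjI)
  qed
  moreover have "0 \<le> y2 - y1" using s by simp
  ultimately show ?thesis using meas unfolding decays_on_def by blast
qed

end

section \<open>Data with integrable tails\<close>

text \<open>The sign \<sigma> selects the direction. A chord from \<open>a\<close> to a point far
  out in that direction has slope almost \<open>c\<close>, since \<open>F\<close> stays below the
  line up to a sublinear error.\<close>

lemma convex_env_ray:
  assumes F: "continuous_on UNIV F" "supports F c a" and \<sigma>: "\<bar>\<sigma>\<bar> = (1::real)"
    and gr: "\<And>\<epsilon>. \<epsilon> > 0 \<Longrightarrow> \<exists>C. \<forall>y. 0 \<le> \<sigma> * y \<longrightarrow> F y \<le> c * y + \<epsilon> * \<bar>y\<bar> + C" and z: "0 \<le> \<sigma> * (z - a)"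
  shows "convex_env F z = ereal (F a + c * (z - a))"
proof (rule convex_env_eqI[OF F])
  fix \<epsilon> :: real assume \<epsilon>: "\<epsilon> > 0"
  obtain C where C: "\<And>y. 0 \<le> \<sigma> * y \<Longrightarrow> F y \<le> c * y + \<epsilon> / 2 * \<bar>y\<bar> + C" using gr[of "\<epsilon> / 2"] \<epsilon> by auto
  define D where "D = C + c * a - F a + \<epsilon> * \<bar>a\<bar>"
  \<comment> \<open>Large enough for \<open>y\<close> to lie beyond \<open>z\<close> and for half of
    the error \<open>\<epsilon> * r\<close> to dominate the constants collected in
    \<open>D\<close>.\<close>
  define r where "r = \<bar>z\<bar> + \<bar>a\<bar> + 2 * \<bar>D\<bar> / \<epsilon>"
  define y where "y = \<sigma> * r"
  have r: "\<bar>z\<bar> \<le> r" "\<bar>a\<bar> \<le> r" unfolding r_def using \<epsilon> by auto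
  have y: "0 \<le> \<sigma> * y" "\<bar>y\<bar> = r" "z \<in> closed_segment a y"
    using \<sigma> r z unfolding y_def by (auto simp: abs_if closed_segment_eq_real_ivl split: if_splits)
  have "\<epsilon> / 2 * (2 * \<bar>D\<bar> / \<epsilon>) \<le> \<epsilon> / 2 * r" using \<epsilon> unfolding r_def by (intro mult_left_mono) auto
  then have "D \<le> \<epsilon> / 2 * r" using \<epsilon> by simp
  then have "F y \<le> F a + c * (y - a) + \<epsilon> * (r - \<bar>a\<bar>)"
    using C[OF y(1)] unfolding y(2) D_def by (simp add: algebra_simps)
  also have "\<dots> \<le> F a + c * (y - a) + \<epsilon> * \<bar>y - a\<bar>" using y(2) \<epsilon> by simp
  finally show "\<exists>y. z \<in> closed_segment a y \<and> F y \<le> F a + c * (y - a) + \<epsilon> * \<bar>y - a\<bar>" using y(3) by blast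
qed

locale decaying_tails = conservation_law +
  fixes p :: real
  assumes p1: "1 \<le> p"
    and tail_r: "set_integrable lebesgue {0..} (\<lambda>x. \<bar>\<phi> x - u_right \<phi>\<bar> powr p)"
    and tail_l: "set_integrable lebesgue {..0} (\<lambda>x. \<bar>\<phi> x - u_left \<phi>\<bar> powr p)"
    and slopes: "u_left \<phi> < u_right \<phi> \<or> u_left \<phi> = u_right \<phi> \<and> contact_set \<phi> \<noteq> {}"
begin

abbreviation "ur \<equiv> u_right \<phi>"
abbreviation "ul \<equiv> u_left \<phi>"
abbreviation "K0 \<equiv> contact_set \<phi>"

text \<open>The sum of both tails, so that one constant serves in the growth bounds on either
  side.\<close>

definition "tail_mass = integral {0..} (\<lambda>x. \<bar>\<phi> x - ur\<bar> powr p) + integral {..0} (\<lambda>x. \<bar>\<phi> x - ul\<bar> powr p)"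

lemma tail_masses_nonneg:
  "0 \<le> integral {0..} (\<lambda>x. \<bar>\<phi> x - ur\<bar> powr p)" "0 \<le> integral {..0} (\<lambda>x. \<bar>\<phi> x - ul\<bar> powr p)"
  using set_lebesgue_integral_eq_integral(1)[OF tail_r] set_lebesgue_integral_eq_integral(1)[OF tail_l]
  by (auto intro!: Henstock_Kurzweil_Integration.integral_nonneg)

lemma tail_mass_nonneg: "0 \<le> tail_mass"
  unfolding tail_mass_def using tail_masses_nonneg by simp

lemma primitive_0: "\<Phi> 0 = 0"
  using interval_lebesgue_integral_lebesgue(1)[OF order_refl absolutely_integrable, of 0]
  unfolding primitive_def by (simp add: zero_ereal_def)

lemma growth_right:
  assumes "\<epsilon> > 0" "0 \<le> x"
  shows "\<bar>\<Phi> x - ur * x\<bar> \<le> \<epsilon> * x + tail_mass * \<epsilon> powr (1 - p)"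
proof -
  have "integral {0..} (\<lambda>x. \<bar>\<phi> x - ur\<bar> powr p) * \<epsilon> powr (1 - p) \<le> tail_mass * \<epsilon> powr (1 - p)"
    unfolding tail_mass_def using tail_masses_nonneg by (intro mult_right_mono) auto
  then show ?thesis
    using primitive_growth[OF p1 tail_r _ assms(2,1)] primitive_0 by auto
qed

lemma growth_left:
  assumes "\<epsilon> > 0" "x \<le> 0"
  shows "\<bar>\<Phi> x - ul * x\<bar> \<le> \<epsilon> * \<bar>x\<bar> + tail_mass * \<epsilon> powr (1 - p)"
proof -
  have "integral {..0} (\<lambda>x. \<bar>\<phi> x - ul\<bar> powr p) * \<epsilon> powr (1 - p) \<le> tail_mass * \<epsilon> powr (1 - p)"
    unfolding tail_mass_def using tail_masses_nonneg by (intro mult_right_mono) auto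
  moreover have "\<bar>\<Phi> 0 - \<Phi> x - ul * (0 - x)\<bar> = \<bar>\<Phi> x - ul * x\<bar>"
    using primitive_0 by (simp add: abs_minus_commute)
  ultimately show ?thesis
    using primitive_growth[OF p1 tail_l _ assms(2,1)] assms(2) by auto
qed

lemma contact_nonempty: "K0 \<noteq> {}"
proof (cases "ul < ur")
  case True
  then show ?thesis
    using supports_exists[of ur tail_mass p "ul"] growth_right growth_left
    unfolding contact_set_eq by blast
qed (use slopes in auto)

definition "a_right = Sup K0"
definition "b_left = Inf K0"

lemma a_right_in: "bdd_above K0 \<Longrightarrow> a_right \<in> K0"
  unfolding a_right_def by (rule closed_contains_Sup[OF contact_nonempty _ contact_set_closed])

lemma b_left_in: "bdd_below K0 \<Longrightarrow> b_left \<in> K0"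
  unfolding b_left_def by (rule closed_contains_Inf[OF contact_nonempty _ contact_set_closed])

lemma contact_le_a_right: "bdd_above K0 \<Longrightarrow> supp d y \<Longrightarrow> y \<le> a_right"
  unfolding a_right_def by (rule cSup_upper) (auto simp: contact_set_eq)

lemma b_left_le_contact: "bdd_below K0 \<Longrightarrow> supp d y \<Longrightarrow> b_left \<le> y"
  unfolding b_left_def by (rule cInf_lower) (auto simp: contact_set_eq)

lemma right_growth_locale:
  assumes "bdd_above K0"
  shows "hopf_lax_growth f f' \<Phi> B ur a_right p tail_mass"
proof -
  obtain s where s: "supp s a_right" using a_right_in[OF assms] unfolding contact_set_eq by auto
  have no: "\<not> supp d y" if "a_right < y" for y d
    using contact_le_a_right[OF assms, of d y] that by auto
  show ?thesis
  proof
    show "supp ur a_right" by (rule extreme_slope_supports[OF growth_right s no])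
    show "v \<le> ur" if "supp v a_right" for v by (rule max_slope_of_growth[OF growth_right that])
  qed (use p1 tail_mass_nonneg growth_right no in auto)
qed

text \<open>State and space are reflected together, so the slope and the contact point both change
  sign and the infimum of the contact set becomes a supremum.\<close>

lemma left_growth_locale:
  assumes "bdd_below K0"
  shows "hopf_lax_growth (\<lambda>u. f (- u)) (\<lambda>u. - f' (- u)) (\<lambda>x. \<Phi> (- x)) B (- ul) (- b_left) p tail_mass"
proof -
  interpret R: hopf_lax "\<lambda>u. f (- u)" "\<lambda>u. - f' (- u)" "\<lambda>x. \<Phi> (- x)" B
    by (rule hopf_lax_reflect) (rule hopf_lax_axioms)
  have gr: "\<bar>\<Phi> (- x) - - ul * x\<bar> \<le> \<epsilon> * x + tail_mass * \<epsilon> powr (1 - p)" if "\<epsilon> > 0" "0 \<le> x" for \<epsilon> x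
    using growth_left[of \<epsilon> "- x"] that by simp
  have refl: "R.supp d y \<longleftrightarrow> supp (- d) (- y)" for d y
    using supports_reflect[of "\<Phi>" "- d" "- y"] by simp
  obtain s where s: "supp s b_left" using b_left_in[OF assms] unfolding contact_set_eq by auto
  then have s': "R.supp (- s) (- b_left)" unfolding refl by simp
  have no: "\<not> R.supp d y" if "- b_left < y" for y d
    unfolding refl using b_left_le_contact[OF assms, of "- d" "- y"] that by auto
  show ?thesis
  proof
    show "R.supp (- ul) (- b_left)" by (rule R.extreme_slope_supports[OF gr s' no])
    show "v \<le> - ul" if "R.supp v (- b_left)" for v by (rule R.max_slope_of_growth[OF gr that])
  qed (use p1 tail_mass_nonneg gr no in auto)
qed

lemma supp_a_right: "bdd_above K0 \<Longrightarrow> supp ur a_right"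
  using right_growth_locale unfolding hopf_lax_growth_def hopf_lax_right_def hopf_lax_right_axioms_def by blast

lemma supp_b_left: "bdd_below K0 \<Longrightarrow> supp ul b_left"
  using left_growth_locale supports_reflect[of "\<Phi>" "ul" b_left]
  unfolding hopf_lax_growth_def hopf_lax_right_def hopf_lax_right_axioms_def by blast

lemma right_region_char:
  assumes "bdd_above K0" "fwd_char f' f'' \<phi> t0 X" "runs_in t0 X (right_region f' \<phi>)"
  shows "hopf_lax_right.char_right f f' \<Phi> ur a_right (t0 + 1) X"
proof -
  interpret R: hopf_lax_growth f f' \<Phi> B ur a_right p tail_mass
    by (rule right_growth_locale[OF assms(1)])
  have "a_right + t * f' ur < X t" if "t0 + 1 \<le> t" for t
  proof -
    have "0 < t" "t0 \<le> t" using fwd_char_imp_char_from(1)[OF assms(2)] that by auto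
    then have "(X t, t) \<in> right_region f' \<phi>" using assms(3) unfolding runs_in_def by blast
    then show ?thesis unfolding right_region_def a_right_def by simp
  qed
  then show ?thesis unfolding R.char_right_def using fwd_char_imp_char_from(2)[OF assms(2)] by simp
qed

lemma left_region_char:
  assumes "bdd_below K0" "fwd_char f' f'' \<phi> t0 X" "runs_in t0 X (left_region f' \<phi>)"
  shows "hopf_lax_right.char_right (\<lambda>u. f (- u)) (\<lambda>u. - f' (- u)) (\<lambda>x. \<Phi> (- x)) (- ul) (- b_left) (t0 + 1) (\<lambda>t. - X t)"
proof -
  interpret R: hopf_lax_growth "\<lambda>u. f (- u)" "\<lambda>u. - f' (- u)" "\<lambda>x. \<Phi> (- x)" B "- ul" "- b_left" p tail_mass
    by (rule left_growth_locale[OF assms(1)])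
  have "- b_left + t * - f' (- (- ul)) < - X t" if "t0 + 1 \<le> t" for t
  proof -
    have "0 < t" "t0 \<le> t" using fwd_char_imp_char_from(1)[OF assms(2)] that by auto
    then have "(X t, t) \<in> left_region f' \<phi>" using assms(3) unfolding runs_in_def by blast
    then show ?thesis unfolding left_region_def b_left_def by simp
  qed
  moreover have "R.char_from (t0 + 1) (\<lambda>t. - X t)"
    by (rule char_from_reflect[OF hopf_lax_axioms fwd_char_imp_char_from(2)[OF assms(2)]])
  ultimately show ?thesis unfolding R.char_right_def by simp
qed

text \<open>Beyond the last contact point the hull is the line of limiting slope, so its one-sided
  derivative there is \<open>ur\<close>.\<close>

lemma convex_env_right:
  assumes "bdd_above K0" "a_right \<le> z"
  shows "convex_env \<Phi> z = ereal (\<Phi> a_right + ur * (z - a_right))"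
proof (rule convex_env_ray[OF F_cont supp_a_right[OF assms(1)], of 1])
  fix \<epsilon> :: real assume "\<epsilon> > 0"
  then show "\<exists>C. \<forall>y. 0 \<le> 1 * y \<longrightarrow> \<Phi> y \<le> ur * y + \<epsilon> * \<bar>y\<bar> + C"
    using growth_right[of \<epsilon>] by (intro exI[of _ "tail_mass * \<epsilon> powr (1 - p)"]) (force simp: abs_le_iff)
qed (use assms in auto)

lemma convex_env_left:
  assumes "bdd_below K0" "z \<le> b_left"
  shows "convex_env \<Phi> z = ereal (\<Phi> b_left + ul * (z - b_left))"
proof (rule convex_env_ray[OF F_cont supp_b_left[OF assms(1)], of "-1"])
  fix \<epsilon> :: real assume "\<epsilon> > 0"
  then show "\<exists>C. \<forall>y. 0 \<le> - 1 * y \<longrightarrow> \<Phi> y \<le> ul * y + \<epsilon> * \<bar>y\<bar> + C"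
    using growth_left[of \<epsilon>] by (intro exI[of _ "tail_mass * \<epsilon> powr (1 - p)"]) (force simp: abs_le_iff)
qed (use assms in auto)

lemma right_deriv_convex_env:
  assumes bdd: "bdd_above K0"
  shows "right_deriv (convex_env \<Phi>) a_right = ereal ur"
proof -
  have "\<forall>\<^sub>F l in at_right 0. (convex_env \<Phi> (a_right + l) - convex_env \<Phi> a_right) / ereal l = ereal ur"
    using eventually_at_right_less[of 0]
    by eventually_elim (simp add: convex_env_right[OF bdd])
  then have "((\<lambda>l. (convex_env \<Phi> (a_right + l) - convex_env \<Phi> a_right) / ereal l) \<longlongrightarrow> ereal ur) (at_right 0)"
    by (rule tendsto_eventually)
  then show ?thesis unfolding right_deriv_def by (intro tendsto_Lim) auto
qed

lemma left_deriv_convex_env: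
  assumes bdd: "bdd_below K0"
  shows "left_deriv (convex_env \<Phi>) b_left = ereal ul"
proof -
  have "\<forall>\<^sub>F l in at_left 0. (convex_env \<Phi> (b_left + l) - convex_env \<Phi> b_left) / ereal l = ereal ul"
    using eventually_at_left_real[of "-1" "0::real", simplified]
    by eventually_elim (simp add: convex_env_left[OF bdd])
  then have "((\<lambda>l. (convex_env \<Phi> (b_left + l) - convex_env \<Phi> b_left) / ereal l) \<longlongrightarrow> ereal ul) (at_left 0)"
    by (rule tendsto_eventually)
  then show ?thesis unfolding left_deriv_def by (intro tendsto_Lim) auto
qed

section \<open>The deviation in the right unbounded region\<close>

context
  fixes w t0 X
  assumes w: "gen_N_wave f' f'' \<phi> w" and bdd: "bdd_above K0"
    and X: "fwd_char f' f'' \<phi> t0 X" "runs_in t0 X (right_region f' \<phi>)"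
begin

interpretation R: hopf_lax_growth f f' \<Phi> B ur a_right p tail_mass
  by (rule right_growth_locale[OF bdd])

lemmas right_X = right_region_char[OF bdd X]

text \<open>The N-wave is prescribed only up to its own characteristic \<open>Y\<close>; as
  \<open>Y\<close> eventually coincides with \<open>X\<close>, it is known up to
  \<open>X\<close>.\<close>

lemma right_wave:
  shows "\<forall>\<^sub>F t in at_top. \<forall>x. a_right + t * f' ur < x \<and> x < X t \<longrightarrow> w x t = inv f' ((x - a_right) / t)"
proof -
  obtain Y where Y: "fwd_char f' f'' \<phi> 0 Y" "runs_in 0 Y (right_region f' \<phi>)"
    "\<forall>x t. t > 0 \<and> a_right + t * f' ur < x \<and> x < Y t \<longrightarrow> w x t = inv f' ((x - a_right) / t)"
    using w[unfolded gen_N_wave_def, THEN conjunct2, THEN conjunct2, THEN conjunct1] bdd unfolding a_right_def by blast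
  have "\<forall>\<^sub>F t in at_top. X t = Y t"
    by (rule R.right_char_unique[OF right_X right_region_char[OF bdd Y(1,2)]])
  then show ?thesis using eventually_gt_at_top[of 0] by eventually_elim (use Y(3) in simp)
qed

lemma right_feet_near:
  assumes "\<eta> > 0"
  shows "\<forall>\<^sub>F t in at_top. \<forall>x. a_right + t * f' ur < x \<and> x < X t \<longrightarrow> (\<forall>u\<in>M x t. \<bar>x - t * f' u - a_right\<bar> \<le> \<eta>)"
  using R.right_feet_close[OF right_X assms]
proof eventually_elim
  case (elim t)
  show ?case
  proof (intro allI impI ballI)
    fix x u assume "a_right + t * f' ur < x \<and> x < X t" "u \<in> M x t"
    then show "\<bar>x - t * f' u - a_right\<bar> \<le> \<eta>" using elim[rule_format, of x u] by (simp add: abs_le_iff)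
  qed
qed

lemma right_decays:
  assumes \<alpha>: "degeneracy_exponent f'' ur \<alpha>"
  shows "decays_on (\<lambda>t. {a_right + t * f' ur..X t}) (deviation w) (p / (p + 1 + \<alpha>))"
proof -
  obtain N where "0 \<le> \<alpha>" "0 < N" "((\<lambda>u. f'' u / \<bar>u - ur\<bar> powr \<alpha>) \<longlongrightarrow> N) (at_right ur)"
    using \<alpha> unfolding degeneracy_exponent_def by blast
  then obtain C where "C \<ge> 0" "\<forall>\<^sub>F t in at_top. X t - (a_right + t * f' ur) \<le> C * t powr (p / (p + 1 + \<alpha>))"
    using R.right_width[OF right_X f'_deriv] by blast
  then show ?thesis
    by (intro side_decays[OF right_feet_near right_wave])
qed

text \<open>A number \<open>m\<close> strictly between \<open>ur\<close> and the Dini derivative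
  turns the latter into a uniform gain of slope \<open>m - ur\<close> on a right neighbourhood of
  \<open>a_right\<close>.\<close>

lemma right_decays_exact:
  assumes Dini: "right_deriv (convex_env \<Phi>) a_right < lower_right_Dini \<Phi> a_right"
  shows "decays_on (\<lambda>t. {a_right + t * f' ur..X t}) (deviation w) 0"
proof -
  obtain m where m: "ereal ur < ereal m" "ereal m < lower_right_Dini \<Phi> a_right"
    using ereal_dense2 Dini unfolding right_deriv_convex_env[OF bdd] by blast
  have "\<forall>\<^sub>F l in at_right 0. ereal m < ereal ((\<Phi> (a_right + l) - \<Phi> a_right) / l)"
    using m(2) unfolding lower_right_Dini_def by (rule less_LiminfD)
  then obtain \<delta> where \<delta>: "\<delta> > 0" "\<And>l. 0 < l \<Longrightarrow> l < \<delta> \<Longrightarrow> m < (\<Phi> (a_right + l) - \<Phi> a_right) / l"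
    unfolding eventually_at_right_field by auto
  define \<eta> where "\<eta> = m - ur"
  have steep: "\<Phi> a_right + (ur + \<eta>) * (y - a_right) \<le> \<Phi> y"
    if "a_right < y" "y < a_right + \<delta>" for y
    using \<delta>(2)[of "y - a_right"] that unfolding \<eta>_def by (simp add: less_divide_eq)
  have "\<eta> > 0" using m(1) unfolding \<eta>_def by simp
  then have "\<forall>\<^sub>F t in at_top. \<forall>x. a_right + t * f' ur < x \<and> x < X t \<longrightarrow> (\<forall>u\<in>M x t. x - t * f' u = a_right)"
    by (rule R.right_feet_exact[OF right_X _ \<delta>(1) steep])
  then show ?thesis by (rule side_decays_exact[OF _ right_wave])
qed

end

section \<open>The deviation in the left unbounded region, by reflection\<close>

context
  fixes w t0 X
  assumes w: "gen_N_wave f' f'' \<phi> w" and bdd: "bdd_below K0"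
    and X: "fwd_char f' f'' \<phi> t0 X" "runs_in t0 X (left_region f' \<phi>)"
begin

interpretation R: hopf_lax_growth "\<lambda>u. f (- u)" "\<lambda>u. - f' (- u)" "\<lambda>x. \<Phi> (- x)" B "- ul" "- b_left" p tail_mass
  by (rule left_growth_locale[OF bdd])

lemmas left_X = left_region_char[OF bdd X]

lemma left_wave:
  shows "\<forall>\<^sub>F t in at_top. \<forall>x. X t < x \<and> x < b_left + t * f' ul \<longrightarrow> w x t = inv f' ((x - b_left) / t)"
proof -
  obtain Y where Y: "fwd_char f' f'' \<phi> 0 Y" "runs_in 0 Y (left_region f' \<phi>)"
    "\<forall>x t. t > 0 \<and> Y t < x \<and> x < b_left + t * f' ul \<longrightarrow> w x t = inv f' ((x - b_left) / t)"
    using w[unfolded gen_N_wave_def, THEN conjunct2, THEN conjunct2, THEN conjunct2] bdd unfolding b_left_def by blast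
  have "\<forall>\<^sub>F t in at_top. - X t = - Y t"
    by (rule R.right_char_unique[OF left_X left_region_char[OF bdd Y(1,2)]])
  then show ?thesis using eventually_gt_at_top[of 0] by eventually_elim (use Y(3) in simp)
qed

lemma left_feet_near:
  assumes "\<eta> > 0"
  shows "\<forall>\<^sub>F t in at_top. \<forall>x. X t < x \<and> x < b_left + t * f' ul \<longrightarrow> (\<forall>u\<in>M x t. \<bar>x - t * f' u - b_left\<bar> \<le> \<eta>)"
  using R.right_feet_close[OF left_X assms]
proof eventually_elim
  case (elim t)
  show ?case
  proof (intro allI impI ballI)
    fix x u assume x: "X t < x \<and> x < b_left + t * f' ul" and u: "u \<in> M x t"
    have "- u \<in> R.M (- x) t" using u unfolding minimizers_reflect by blast
    then show "\<bar>x - t * f' u - b_left\<bar> \<le> \<eta>" using elim[rule_format, of "- x" "- u"] x by (simp add: abs_le_iff)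
  qed
qed

lemma left_decays:
  assumes \<alpha>: "degeneracy_exponent f'' ul \<alpha>"
  shows "decays_on (\<lambda>t. {X t..b_left + t * f' ul}) (deviation w) (p / (p + 1 + \<alpha>))"
proof -
  obtain N where N: "0 \<le> \<alpha>" "0 < N" "((\<lambda>u. f'' u / \<bar>u - ul\<bar> powr \<alpha>) \<longlongrightarrow> N) (at_left ul)"
    using \<alpha> unfolding degeneracy_exponent_def by blast
  have lim: "((\<lambda>u. f'' (- u) / \<bar>u - - ul\<bar> powr \<alpha>) \<longlongrightarrow> N) (at_right (- ul))"
    using N(3) unfolding at_left_minus[of "ul"] filterlim_filtermap by (simp add: abs_minus_commute add.commute)
  have d: "((\<lambda>u. - f' (- u)) has_real_derivative f'' (- x)) (at x)" for x
  proof -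
    have "((\<lambda>u. f' (- u)) has_real_derivative f'' (- x) * - 1) (at x)"
      by (rule DERIV_chain2[OF f'_deriv]) (auto intro!: derivative_eq_intros)
    then have "((\<lambda>u. - f' (- u)) has_real_derivative - (f'' (- x) * - 1)) (at x)" by (rule DERIV_minus)
    then show ?thesis by simp
  qed
  obtain C where "C \<ge> 0" "\<forall>\<^sub>F t in at_top. - X t - (- b_left + t * - f' (- (- ul))) \<le> C * t powr (p / (p + 1 + \<alpha>))"
    using R.right_width[OF left_X d N(1,2) lim] by blast
  then show ?thesis
    by (intro side_decays[OF left_feet_near left_wave]) (auto simp: algebra_simps)
qed

lemma left_decays_exact:
  assumes Dini: "upper_left_Dini \<Phi> b_left < left_deriv (convex_env \<Phi>) b_left"
  shows "decays_on (\<lambda>t. {X t..b_left + t * f' ul}) (deviation w) 0"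
proof -
  obtain m where m: "ereal m < ereal ul" "upper_left_Dini \<Phi> b_left < ereal m"
    using ereal_dense2 Dini unfolding left_deriv_convex_env[OF bdd] by blast
  have "\<forall>\<^sub>F l in at_left 0. ereal ((\<Phi> (b_left + l) - \<Phi> b_left) / l) < ereal m"
    using m(2) unfolding upper_left_Dini_def by (rule Limsup_lessD)
  then obtain \<delta>' where \<delta>': "\<delta>' < 0" "\<And>l. \<delta>' < l \<Longrightarrow> l < 0 \<Longrightarrow> (\<Phi> (b_left + l) - \<Phi> b_left) / l < m"
    unfolding eventually_at_left_field by auto
  define \<delta> where "\<delta> = - \<delta>'"
  define \<eta> where "\<eta> = ul - m"
  have steep: "\<Phi> (- (- b_left)) + (- ul + \<eta>) * (y - - b_left) \<le> \<Phi> (- y)"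
    if "- b_left < y" "y < - b_left + \<delta>" for y
  proof -
    define l where "l = - y - b_left"
    have l: "\<delta>' < l" "l < 0" using that unfolding l_def \<delta>_def by auto
    have "m * l < \<Phi> (b_left + l) - \<Phi> b_left" using \<delta>'(2)[OF l] l(2) by (simp add: neg_divide_less_eq)
    then show ?thesis unfolding \<eta>_def l_def by (simp add: algebra_simps)
  qed
  have "\<eta> > 0" "\<delta> > 0" using m(1) \<delta>' unfolding \<eta>_def \<delta>_def by auto
  have "\<forall>\<^sub>F t in at_top. \<forall>x. - b_left + t * - f' (- (- ul)) < x \<and> x < - X t \<longrightarrow> (\<forall>u\<in>R.M x t. x - t * - f' (- u) = - b_left)"
    by (rule R.right_feet_exact[OF left_X \<open>\<eta> > 0\<close> \<open>\<delta> > 0\<close> steep])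
  then have "\<forall>\<^sub>F t in at_top. \<forall>x. X t < x \<and> x < b_left + t * f' ul \<longrightarrow> (\<forall>u\<in>M x t. x - t * f' u = b_left)"
  proof eventually_elim
    case (elim t)
    show ?case
    proof (intro allI impI ballI)
      fix x u assume x: "X t < x \<and> x < b_left + t * f' ul" and u: "u \<in> M x t"
      have "- u \<in> R.M (- x) t" using u unfolding minimizers_reflect by blast
      then show "x - t * f' u = b_left" using elim[rule_format, of "- x" "- u"] x by simp
    qed
  qed
  then show ?thesis by (rule side_decays_exact[OF _ left_wave])
qed

end

lemma gap_char_between:
  assumes gap: "bounded_gap \<phi> e h" "fwd_char f' f'' \<phi> t0 X" "runs_in t0 X (gap_region f' \<phi> e h)"
  shows "\<forall>\<^sub>F t in at_top. e + t * f' (gap_slope \<phi> e h) \<le> X t" "\<forall>\<^sub>F t in at_top. X t \<le> h + t * f' (gap_slope \<phi> e h)"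
proof -
  have "\<forall>\<^sub>F t in at_top. e + t * f' (gap_slope \<phi> e h) < X t \<and> X t < h + t * f' (gap_slope \<phi> e h)"
    using eventually_ge_at_top[of "t0 + 1"] by eventually_elim (rule gap_region_char[OF gap])
  then show "\<forall>\<^sub>F t in at_top. e + t * f' (gap_slope \<phi> e h) \<le> X t"
    "\<forall>\<^sub>F t in at_top. X t \<le> h + t * f' (gap_slope \<phi> e h)" by (auto elim: eventually_mono)
qed

text \<open>The interval is covered by the strip between two divides and the two parts outside it.
  The second alternatives are for characteristics in a gap, which stay inside the strip.\<close>

lemma strip_glue:
  assumes w: "gen_N_wave f' f'' \<phi> w" and s: "supp c1 y1" "supp c2 y2" "y1 \<le> y2" and \<kappa>: "0 \<le> \<kappa>"
    and left: "decays_on (\<lambda>t. {x1 t..y1 + t * f' c1}) (deviation w) \<kappa> \<or> (\<forall>\<^sub>F t in at_top. y1 + t * f' c1 \<le> x1 t)"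
    and right: "decays_on (\<lambda>t. {y2 + t * f' c2..x2 t}) (deviation w) \<kappa> \<or> (\<forall>\<^sub>F t in at_top. x2 t \<le> y2 + t * f' c2)"
  shows "decays_on (\<lambda>t. {x1 t..x2 t}) (deviation w) \<kappa>"
proof -
  let ?S = "\<lambda>t. {y1 + t * f' c1..y2 + t * f' c2}"
  have S: "decays_on ?S (deviation w) \<kappa>" by (rule decays_on_mono[OF strip_decays[OF w s] \<kappa>])
  obtain A where A: "decays_on A (deviation w) \<kappa>" "\<forall>\<^sub>F t in at_top. \<forall>x. x1 t \<le> x \<and> x < y1 + t * f' c1 \<longrightarrow> x \<in> A t"
  \<comment> \<open>If \<open>x1\<close> is eventually inside the strip, nothing remains to be
    covered on this side, and the strip itself may stand in for \<open>A\<close>.\<close>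
  proof (cases "\<forall>\<^sub>F t in at_top. y1 + t * f' c1 \<le> x1 t")
    case True
    then show ?thesis by (intro that[OF S]) (auto elim: eventually_mono)
  next
    case False
    with left show ?thesis by (intro that[of "\<lambda>t. {x1 t..y1 + t * f' c1}"]) auto
  qed
  obtain D where D: "decays_on D (deviation w) \<kappa>" "\<forall>\<^sub>F t in at_top. \<forall>x. y2 + t * f' c2 < x \<and> x \<le> x2 t \<longrightarrow> x \<in> D t"
  proof (cases "\<forall>\<^sub>F t in at_top. x2 t \<le> y2 + t * f' c2")
    case True
    then show ?thesis by (intro that[OF S]) (auto elim: eventually_mono)
  next
    case False
    with right show ?thesis by (intro that[of "\<lambda>t. {y2 + t * f' c2..x2 t}"]) auto
  qed
  show ?thesis
  proof (rule decays_on_subset[OF decays_on_Un[OF A(1) decays_on_Un[OF S D(1)]]])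
    show "\<forall>\<^sub>F t in at_top. {x1 t..x2 t} \<subseteq> A t \<union> (?S t \<union> D t)"
      using A(2) D(2) by eventually_elim force
  qed simp
qed

end

theorem theorem7p9:
  fixes f f' f'' \<phi> :: "real \<Rightarrow> real" and w :: "real \<Rightarrow> real \<Rightarrow> real" and p :: real
  assumes "\<And>x. (f has_real_derivative f' x) (at x)"
    and "\<And>x. (f' has_real_derivative f'' x) (at x)"
    and "continuous_on UNIV f''"
    and "\<And>x. 0 \<le> f'' x"
    and "{x. f'' x = 0} \<in> null_sets lebesgue"
    and "\<phi> \<in> borel_measurable lebesgue"
    and "\<exists>M. AE x in lebesgue. \<bar>\<phi> x\<bar> \<le> M"
    and "u_left \<phi> < u_right \<phi> \<or> u_left \<phi> = u_right \<phi> \<and> contact_set \<phi> \<noteq> {}"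
    and "1 \<le> p"
    and "set_integrable lebesgue {0..} (\<lambda>x. \<bar>\<phi> x - u_right \<phi>\<bar> powr p)"
    and "set_integrable lebesgue {..0} (\<lambda>x. \<bar>\<phi> x - u_left \<phi>\<bar> powr p)"
    and "gen_N_wave f' f'' \<phi> w"
  shows
    "(\<forall>c1 y1 c2 y2 q.
        is_divide f' f'' \<phi> c1 y1 \<and> is_divide f' f'' \<phi> c2 y2 \<and>
        (\<forall>t>0. y1 + t * f' c1 < y2 + t * f' c2) \<and> q > 0 \<longrightarrow>
        Lq_rate q (\<lambda>t. y1 + t * f' c1) (\<lambda>t. y2 + t * f' c2)
          (\<lambda>x t. f' (entropy_sol f' f'' \<phi> x t) - f' (w x t)) (-1))
   \<and> (\<forall>t1 x1 t2 x2 \<alpha> q.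
        fwd_char f' f'' \<phi> t1 x1 \<and> fwd_char f' f'' \<phi> t2 x2 \<and>
        (\<forall>t>0. t1 \<le> t \<and> t2 \<le> t \<longrightarrow> x1 t < x2 t) \<and>
        (  (bdd_below (contact_set \<phi>) \<and> runs_in t1 x1 (left_region f' \<phi>) \<and>
            (\<exists>e h. bounded_gap \<phi> e h \<and> runs_in t2 x2 (gap_region f' \<phi> e h)) \<and>
            degeneracy_exponent f'' (u_left \<phi>) \<alpha>)
         \<or> (bdd_above (contact_set \<phi>) \<and> runs_in t2 x2 (right_region f' \<phi>) \<and>
            (\<exists>e h. bounded_gap \<phi> e h \<and> runs_in t1 x1 (gap_region f' \<phi> e h)) \<and>
            degeneracy_exponent f'' (u_right \<phi>) \<alpha>)
         \<or> (bdd_below (contact_set \<phi>) \<and> runs_in t1 x1 (left_region f' \<phi>) \<and>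
            bdd_above (contact_set \<phi>) \<and> runs_in t2 x2 (right_region f' \<phi>) \<and>
            (\<exists>\<alpha>l \<alpha>r. degeneracy_exponent f'' (u_left \<phi>) \<alpha>l \<and>
                      degeneracy_exponent f'' (u_right \<phi>) \<alpha>r \<and> \<alpha> = min \<alpha>l \<alpha>r))) \<and>
        q > p / (p + 1 + \<alpha>) \<longrightarrow>
        Lq_rate q x1 x2 (\<lambda>x t. f' (entropy_sol f' f'' \<phi> x t) - f' (w x t))
          (- 1 + (p / q) / (p + 1 + \<alpha>)))
   \<and> (\<forall>t1 x1 t2 x2 q.
        fwd_char f' f'' \<phi> t1 x1 \<and> fwd_char f' f'' \<phi> t2 x2 \<and>
        (\<forall>t>0. t1 \<le> t \<and> t2 \<le> t \<longrightarrow> x1 t < x2 t) \<and>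
        (  (bdd_below (contact_set \<phi>) \<and> runs_in t1 x1 (left_region f' \<phi>) \<and>
            (\<exists>e h. bounded_gap \<phi> e h \<and> runs_in t2 x2 (gap_region f' \<phi> e h)) \<and>
            upper_left_Dini (primitive \<phi>) (Inf (contact_set \<phi>))
              < left_deriv (convex_env (primitive \<phi>)) (Inf (contact_set \<phi>)))
         \<or> (bdd_above (contact_set \<phi>) \<and> runs_in t2 x2 (right_region f' \<phi>) \<and>
            (\<exists>e h. bounded_gap \<phi> e h \<and> runs_in t1 x1 (gap_region f' \<phi> e h)) \<and>
            right_deriv (convex_env (primitive \<phi>)) (Sup (contact_set \<phi>))
              < lower_right_Dini (primitive \<phi>) (Sup (contact_set \<phi>)))
         \<or> (bdd_below (contact_set \<phi>) \<and> runs_in t1 x1 (left_region f' \<phi>) \<and>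
            bdd_above (contact_set \<phi>) \<and> runs_in t2 x2 (right_region f' \<phi>) \<and>
            upper_left_Dini (primitive \<phi>) (Inf (contact_set \<phi>))
              < left_deriv (convex_env (primitive \<phi>)) (Inf (contact_set \<phi>)) \<and>
            right_deriv (convex_env (primitive \<phi>)) (Sup (contact_set \<phi>))
              < lower_right_Dini (primitive \<phi>) (Sup (contact_set \<phi>)))) \<and>
        q > 0 \<longrightarrow>
        Lq_rate q x1 x2 (\<lambda>x t. f' (entropy_sol f' f'' \<phi> x t) - f' (w x t)) (-1))"
proof -
  obtain B where B: "AE x in lebesgue. \<bar>\<phi> x\<bar> \<le> B" using assms(7) by blast
  interpret decaying_tails \<phi> B f f' f'' p
    by unfold_locales (use assms B in auto)
  note w = assms(12)
  have exponent: "(p / q) / (p + 1 + \<alpha>) = (p / (p + 1 + \<alpha>)) / q" for q \<alpha> by simp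
  have nonneg: "0 \<le> p / (p + 1 + \<alpha>)" if "degeneracy_exponent f'' c \<alpha>" for c \<alpha>
    using that p1 unfolding degeneracy_exponent_def by auto
  show ?thesis
  proof (intro conjI allI impI, goal_cases)
    case (1 c1 y1 c2 y2 q)
    then have d: "is_divide f' f'' \<phi> c1 y1" "is_divide f' f'' \<phi> c2 y2"
      and lt: "\<forall>t>0. y1 + t * f' c1 < y2 + t * f' c2" and q: "q > 0"
      by blast+
    \<comment> \<open>Only the order of the rays is given. Feet in the opposite order would force
      the slopes, and hence the rays, into that order too.\<close>
    have "y1 \<le> y2"
    proof (rule ccontr)
      assume "\<not> y1 \<le> y2"
      then have "c2 \<le> c1" using supports_mono d is_divide_iff by auto
      then have "f' c2 \<le> f' c1" using f'_le by blast
      then show False using lt[rule_format, of 1] \<open>\<not> y1 \<le> y2\<close> by simp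
    qed
    then show ?case
      using Lq_rate_of_decays_on[OF strip_decays[OF w] q] d is_divide_iff by simp
  next
    case (2 t1 x1 t2 x2 \<alpha> q)
    then have x1: "fwd_char f' f'' \<phi> t1 x1" and x2: "fwd_char f' f'' \<phi> t2 x2" and q: "p / (p + 1 + \<alpha>) < q"
      by blast+
    from 2[THEN conjunct2, THEN conjunct2, THEN conjunct2, THEN conjunct1] consider
        (left) e h where "bdd_below K0" "runs_in t1 x1 (left_region f' \<phi>)"
          "bounded_gap \<phi> e h" "runs_in t2 x2 (gap_region f' \<phi> e h)" "degeneracy_exponent f'' ul \<alpha>"
      | (right) e h where "bdd_above K0" "runs_in t2 x2 (right_region f' \<phi>)"
          "bounded_gap \<phi> e h" "runs_in t1 x1 (gap_region f' \<phi> e h)" "degeneracy_exponent f'' ur \<alpha>"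
      | (both) \<alpha>l \<alpha>r where "bdd_below K0" "runs_in t1 x1 (left_region f' \<phi>)"
          "bdd_above K0" "runs_in t2 x2 (right_region f' \<phi>)"
          "degeneracy_exponent f'' ul \<alpha>l" "degeneracy_exponent f'' ur \<alpha>r" "\<alpha> = min \<alpha>l \<alpha>r"
      by (elim disjE exE conjE) iprover+
    then have "0 \<le> p / (p + 1 + \<alpha>) \<and>
      decays_on (\<lambda>t. {x1 t..x2 t}) (deviation w) (p / (p + 1 + \<alpha>))"
    proof cases
      case left
      note g = bounded_gap_supports[OF left(3)] and X = gap_char_between[OF left(3) x2 left(4)]
      show ?thesis
        using strip_glue[OF w supp_b_left[OF left(1)] g(2) b_left_le_contact[OF left(1) g(2)] nonneg[OF left(5)]]
          left_decays[OF w left(1) x1 left(2,5)] X(2) nonneg[OF left(5)] by blast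
    next
      case right
      note g = bounded_gap_supports[OF right(3)] and X = gap_char_between[OF right(3) x1 right(4)]
      show ?thesis
        using strip_glue[OF w g(1) supp_a_right[OF right(1)] contact_le_a_right[OF right(1) g(1)] nonneg[OF right(5)]]
          right_decays[OF w right(1) x2 right(2,5)] X(1) nonneg[OF right(5)] by blast
    next
      case both
      have pos: "0 \<le> \<alpha>l" "0 \<le> \<alpha>r" using both(5,6) unfolding degeneracy_exponent_def by auto
      \<comment> \<open>The smaller degeneracy exponent allows the larger width, so its power of
        \<open>t\<close> dominates both sides.\<close>
      have le: "p / (p + 1 + \<alpha>l) \<le> p / (p + 1 + \<alpha>)" "p / (p + 1 + \<alpha>r) \<le> p / (p + 1 + \<alpha>)" "0 \<le> p / (p + 1 + \<alpha>)"
        using p1 pos both(7) by (auto intro!: divide_left_mono mult_pos_pos add_pos_nonneg)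
      show ?thesis
        using strip_glue[OF w supp_b_left[OF both(1)] supp_a_right[OF both(3)] contact_le_a_right[OF both(3) supp_b_left[OF both(1)]] le(3)]
          decays_on_mono[OF left_decays[OF w both(1) x1 both(2,5)] le(1)]
          decays_on_mono[OF right_decays[OF w both(3) x2 both(4,6)] le(2)] le(3) by blast
    qed
    moreover from this q have "q > 0" by linarith
    ultimately show ?case
      unfolding exponent by (intro Lq_rate_of_decays_on) auto
  next
    case (3 t1 x1 t2 x2 q)
    then have x1: "fwd_char f' f'' \<phi> t1 x1" and x2: "fwd_char f' f'' \<phi> t2 x2" and q: "0 < q"
      by blast+
    from 3[THEN conjunct2, THEN conjunct2, THEN conjunct2, THEN conjunct1] consider
        (left) e h where "bdd_below K0" "runs_in t1 x1 (left_region f' \<phi>)"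
          "bounded_gap \<phi> e h" "runs_in t2 x2 (gap_region f' \<phi> e h)"
          "upper_left_Dini \<Phi> b_left < left_deriv (convex_env \<Phi>) b_left"
      | (right) e h where "bdd_above K0" "runs_in t2 x2 (right_region f' \<phi>)"
          "bounded_gap \<phi> e h" "runs_in t1 x1 (gap_region f' \<phi> e h)"
          "right_deriv (convex_env \<Phi>) a_right < lower_right_Dini \<Phi> a_right"
      | (both) "bdd_below K0" "runs_in t1 x1 (left_region f' \<phi>)"
          "bdd_above K0" "runs_in t2 x2 (right_region f' \<phi>)"
          "upper_left_Dini \<Phi> b_left < left_deriv (convex_env \<Phi>) b_left"
          "right_deriv (convex_env \<Phi>) a_right < lower_right_Dini \<Phi> a_right"
      unfolding a_right_def b_left_def by (elim disjE exE conjE) iprover+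
    then have "decays_on (\<lambda>t. {x1 t..x2 t}) (deviation w) 0"
    proof cases
      case left
      note g = bounded_gap_supports[OF left(3)] and X = gap_char_between[OF left(3) x2 left(4)]
      show ?thesis
        using strip_glue[OF w supp_b_left[OF left(1)] g(2) b_left_le_contact[OF left(1) g(2)] order_refl]
          left_decays_exact[OF w left(1) x1 left(2,5)] X(2) by blast
    next
      case right
      note g = bounded_gap_supports[OF right(3)] and X = gap_char_between[OF right(3) x1 right(4)]
      show ?thesis
        using strip_glue[OF w g(1) supp_a_right[OF right(1)] contact_le_a_right[OF right(1) g(1)] order_refl]
          right_decays_exact[OF w right(1) x2 right(2,5)] X(1) by blast
    next
      case both
      show ?thesis
        using strip_glue[OF w supp_b_left[OF both(1)] supp_a_right[OF both(3)] contact_le_a_right[OF both(3) supp_b_left[OF both(1)]] order_refl]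
          left_decays_exact[OF w both(1) x1 both(2,5)] right_decays_exact[OF w both(3) x2 both(4,6)] by blast
    qed
    from Lq_rate_of_decays_on[OF this q]
    show ?case by simp
  qed
qed

end
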